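(* Let $N,n$ be positive integers. The linear map $\mathfrak f:\mathcal F_N(n)\to\mathcal H_N(n,1)$ given on basis elements by $$\psi^{a_1}_{m_1}\cdots\psi^{a_N}_{m_N}|\emptyset\rangle\longmapsto\sum_{i_1,\dots,i_N}\epsilon^{i_1i_2\cdots i_N}(A^{a_1}X^{m_1})_{i_1}\cdots(A^{a_N}X^{m_N})_{i_N}$$ is a $GL_n[z]\rtimes\mathbb C^\times_q$-equivariant isomorphism.
   Context: Let $\mathbb C[X,A]$ be the polynomial ring in the entries of an $N\times N$ matrix $X=(X^i_j)$ and an $n\times N$ matrix $A=(A^a_i)$, and $\mathcal H_N(n,1)=\{f\in\mathbb C[X,A]: f(gXg^{-1},Ag^{-1})=\det(g)^{-1}f(X,A)\ \forall g\in GL_N(\mathbb C)\}$, where $(A^aX^m)_i=\sum_jA^a_j(X^m)^j_i$ and $\epsilon$ is the Levi-Civita symbol. $\mathcal F(n)$ is the fermion Fock space: the module generated by $|\emptyset\rangle$ over the algebra with generators $\psi^a_m,\psi^*_{a,m}$ ($1\le a\le n$, $m\in\mathbb Z_{\ge0}$) and relations $\{\psi^a_m,\psi^*_{b,m'}\}=\delta^a_b\delta_{mm'}$, $\{\psi^a_m,\psi^b_{m'}\}=\{\psi^*_{a,m},\psi^*_{b,m'}\}=0$, subject to $\psi^*_{a,m}|\emptyset\rangle=0$. $\mathcal F_N(n)$ is the span of the elements $\psi^{a_1}_{m_1}\cdots\psi^{a_N}_{m_N}|\emptyset\rangle$, i.e. $\bigwedge^N(\mathbb C^n\otimes\mathbb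 C[z])$ with $\psi^a_m\leftrightarrow e_a\otimes z^m$. $GL_n[z]$ is the group of automorphisms of the $\mathbb C[z]$-module $\mathbb C[z]^{\oplus n}$ (a group ind-scheme) with Lie algebra $\mathfrak{gl}_n[z]$. Its action on $\mathcal F_N(n)$ integrates $E^a_b\otimes z^m\mapsto\sum_{\ell\ge0}\psi^a_{\ell+m}\psi^*_{b,\ell}$, and its action on $\mathcal H_N(n,1)$ integrates $E^a_b\otimes z^m\mapsto\sum_{i,j}A^a_i(X^m)^i_j\,\partial/\partial A^b_j$. The $\mathbb C^\times_q$-actions are given by the gradings $\deg\psi^a_m=m$ (and $\deg|\emptyset\rangle=0$) on $\mathcal F_N(n)$, and $\deg X=1,\deg A=0$ on $\mathcal H_N(n,1)$. *)

theory Defs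
  imports
    "HOL-Analysis.Analysis"
    "HOL-Computational_Algebra.Polynomial"
    "HOL-Library.Poly_Mapping"
begin

text \<open>
  The index sets \<open>{1..N}\<close> and \<open>{1..n}\<close> are the finite types \<open>'N\<close> and \<open>'n\<close>, so
  \<open>N = CARD('N)\<close> and \<open>n = CARD('n)\<close> are arbitrary positive integers; \<open>'N\<close> is linearly
  ordered because the Levi-Civita symbol refers to the order of \<open>{1..N}\<close>.

  The group ind-scheme \<open>GL_n[z]\<close> is not reduced (its Lie algebra is not visible on complex
  points: for \<open>n = 1\<close> the complex points are only the nonzero constants). It is therefore treated
  through its functor of points: for a commutative \<open>\<complex>\<close>-algebra \<open>R\<close>, \<open>GL_n[z](R)\<close> is the group of
  automorphisms of \<open>R[z]^n\<close>, acting on \<open>R \<otimes> F_N(n)\<close> and on \<open>R \<otimes> \<complex>[X,A] = R[X,A]\<close>.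
  For this reason the Fock space and the polynomial ring are defined over any commutative ring.
\<close>

section \<open>The fermion Fock space\<close>

datatype 'n fermion = Psi 'n nat | PsiStar 'n nat

fun anticomm :: "'n fermion \<Rightarrow> 'n fermion \<Rightarrow> 'r::comm_ring_1" where
  "anticomm (Psi a m) (PsiStar b k) = (if a = b \<and> m = k then 1 else 0)"
| "anticomm (PsiStar b k) (Psi a m) = (if a = b \<and> m = k then 1 else 0)"
| "anticomm (Psi _ _) (Psi _ _) = 0"
| "anticomm (PsiStar _ _) (PsiStar _ _) = 0"

text \<open>
  The cyclic module is the quotient of the free module on the formal expressions
  \<open>x\<^sub>1 x\<^sub>2 \<dots> x\<^sub>k |\<emptyset>\<rangle>\<close>, encoded as the words \<open>[x\<^sub>1, \<dots>, x\<^sub>k]\<close> in the generators (that is, of the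
  free algebra on the generators), by the relations \<open>u (x y + y x - {x,y}) v |\<emptyset>\<rangle> = 0\<close> and
  \<open>u \<psi>*_{a,m} |\<emptyset>\<rangle> = 0\<close>.
\<close>

definition word_scale :: "'r::comm_ring_1 \<Rightarrow> ('n fermion list \<Rightarrow>\<^sub>0 'r) \<Rightarrow> ('n fermion list \<Rightarrow>\<^sub>0 'r)" where
  "word_scale c p = Poly_Mapping.map ((*) c) p"

lemma lookup_word_scale [simp]: "Poly_Mapping.lookup (word_scale c p) w = c * Poly_Mapping.lookup p w"
  unfolding word_scale_def by transfer (auto simp: when_def)

interpretation words: module word_scale
  by unfold_locales (auto intro!: poly_mapping_eqI simp: lookup_add algebra_simps)

definition fock_relations :: "('n fermion list \<Rightarrow>\<^sub>0 'r::comm_ring_1) set" where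
  "fock_relations = words.span
     ({Poly_Mapping.single (u @ x # y # v) 1 + Poly_Mapping.single (u @ y # x # v) 1
         - Poly_Mapping.single (u @ v) (anticomm x y) | u x y v. True}
      \<union> {Poly_Mapping.single (u @ [PsiStar a m]) 1 | u a m. True})"

definition fock_rel ::
    "('n fermion list \<Rightarrow>\<^sub>0 'r::comm_ring_1) \<Rightarrow> ('n fermion list \<Rightarrow>\<^sub>0 'r) \<Rightarrow> bool" where
  "fock_rel p q \<longleftrightarrow> p - q \<in> fock_relations"

lemma fock_rel_equivp: "equivp (fock_rel :: ('n fermion list \<Rightarrow>\<^sub>0 'r::comm_ring_1) \<Rightarrow> _)"
proof (rule equivpI)
  show "reflp (fock_rel :: ('n fermion list \<Rightarrow>\<^sub>0 'r) \<Rightarrow> _)"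
    by (auto simp: reflp_def fock_rel_def fock_relations_def words.span_zero)
  show "symp (fock_rel :: ('n fermion list \<Rightarrow>\<^sub>0 'r) \<Rightarrow> _)"
  proof (rule sympI)
    fix p q :: "'n fermion list \<Rightarrow>\<^sub>0 'r"
    assume "fock_rel p q"
    then have "- (p - q) \<in> fock_relations"
      unfolding fock_rel_def fock_relations_def by (rule words.span_neg)
    then show "fock_rel q p" by (simp add: fock_rel_def)
  qed
  show "transp (fock_rel :: ('n fermion list \<Rightarrow>\<^sub>0 'r) \<Rightarrow> _)"
  proof (rule transpI)
    fix p q r :: "'n fermion list \<Rightarrow>\<^sub>0 'r"
    assume "fock_rel p q" "fock_rel q r"
    then have "(p - q) + (q - r) \<in> fock_relations"
      unfolding fock_rel_def fock_relations_def by (rule words.span_add)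
    then show "fock_rel p r" by (simp add: fock_rel_def)
  qed
qed

quotient_type (overloaded) ('n, 'r) fock = "'n fermion list \<Rightarrow>\<^sub>0 ('r::comm_ring_1)" / fock_rel
  by (rule fock_rel_equivp)

instantiation fock :: (type, comm_ring_1) ab_group_add
begin

lift_definition zero_fock :: "('a, 'b) fock" is 0 .

lift_definition plus_fock :: "('a, 'b) fock \<Rightarrow> ('a, 'b) fock \<Rightarrow> ('a, 'b) fock" is "(+)"
  by (unfold fock_rel_def fock_relations_def add_diff_add, rule words.span_add)

lift_definition minus_fock :: "('a, 'b) fock \<Rightarrow> ('a, 'b) fock \<Rightarrow> ('a, 'b) fock" is "(-)"
proof (unfold fock_rel_def fock_relations_def)
  fix p p' q q' :: "'a fermion list \<Rightarrow>\<^sub>0 'b" and S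
  assume "p - p' \<in> words.span S" "q - q' \<in> words.span S"
  then have "(p - p') - (q - q') \<in> words.span S" by (rule words.span_diff)
  then show "(p - q) - (p' - q') \<in> words.span S" by (simp add: algebra_simps)
qed

lift_definition uminus_fock :: "('a, 'b) fock \<Rightarrow> ('a, 'b) fock" is uminus
  by (unfold fock_rel_def fock_relations_def minus_diff_minus, rule words.span_neg)

instance
proof
  fix a b c :: "('a, 'b) fock"
  note refl = equivp_reflp[OF fock_rel_equivp]
  show "a + b + c = a + (b + c)" by transfer (simp add: refl add.assoc)
  show "a + b = b + a" by transfer (simp add: refl add.commute)
  show "0 + a = a" by transfer (simp add: refl)
  show "- a + a = 0" by transfer (simp add: refl)
  show "a - b = a + - b" by transfer (simp add: refl)
qed

end

lift_definition fock_scale :: "'r::comm_ring_1 \<Rightarrow> ('n, 'r) fock \<Rightarrow> ('n, 'r) fock" is word_scale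
  by (unfold fock_rel_def fock_relations_def words.scale_right_diff_distrib [symmetric],
      rule words.span_scale)

interpretation fock: module fock_scale
proof
  note refl = equivp_reflp[OF fock_rel_equivp]
  fix a b :: "'r::comm_ring_1" and x y :: "('n, 'r) fock"
  show "fock_scale a (x + y) = fock_scale a x + fock_scale a y"
    by transfer (simp add: refl words.scale_right_distrib)
  show "fock_scale (a + b) x = fock_scale a x + fock_scale b x"
    by transfer (simp add: refl words.scale_left_distrib)
  show "fock_scale a (fock_scale b x) = fock_scale (a * b) x"
    by transfer (simp add: refl)
  show "fock_scale 1 x = x"
    by transfer (simp add: refl)
qed

lift_definition vac :: "('n, 'r::comm_ring_1) fock" is "Poly_Mapping.single [] 1" .

definition prepend :: "'n fermion \<Rightarrow> ('n fermion list \<Rightarrow>\<^sub>0 'r) \<Rightarrow> ('n fermion list \<Rightarrow>\<^sub>0 'r::comm_ring_1)" where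
  "prepend x p = (\<Sum>w\<in>Poly_Mapping.keys p. Poly_Mapping.single (x # w) (Poly_Mapping.lookup p w))"

lemma prepend_add: "prepend x (p + q) = prepend x p + prepend x q"
  unfolding prepend_def by (rule setsum_keys_plus_distrib) (auto simp: single_add)

lemma prepend_single: "prepend x (Poly_Mapping.single w c) = Poly_Mapping.single (x # w) c"
  by (cases "c = 0") (auto simp: prepend_def)

lemma word_scale_single: "word_scale c (Poly_Mapping.single w d) = Poly_Mapping.single w (c * d)"
  by (auto intro!: poly_mapping_eqI simp: lookup_single when_def)

lemma words_expand: "p = (\<Sum>w\<in>Poly_Mapping.keys p. Poly_Mapping.single w (Poly_Mapping.lookup p w))"
  by (rule poly_mapping_eqI)
     (auto simp: lookup_sum lookup_single when_def sum.delta in_keys_iff)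

lemma prepend_zero [simp]: "prepend x 0 = 0"
  by (simp add: prepend_def)

lemma prepend_sum: "prepend x (sum f S) = (\<Sum>i\<in>S. prepend x (f i))"
  by (induction S rule: infinite_finite_induct) (auto simp: prepend_add)

lemma prepend_scale: "prepend x (word_scale c p) = word_scale c (prepend x p)"
proof -
  have "prepend x (word_scale c p)
      = prepend x (word_scale c (\<Sum>w\<in>Poly_Mapping.keys p. Poly_Mapping.single w (Poly_Mapping.lookup p w)))"
    using words_expand[of p] by simp
  also have "\<dots> = word_scale c (\<Sum>w\<in>Poly_Mapping.keys p. Poly_Mapping.single (x # w) (Poly_Mapping.lookup p w))"
    by (simp add: words.scale_sum_right word_scale_single prepend_sum prepend_single)
  finally show ?thesis by (simp add: prepend_def)
qed

interpretation prepend: module_hom word_scale word_scale "prepend x"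
  by unfold_locales (auto simp: prepend_add prepend_scale)

lemma prepend_relations:
  assumes "p \<in> fock_relations"
  shows "prepend x p \<in> fock_relations"
  using assms unfolding fock_relations_def
proof (induction p rule: words.span_induct_alt)
  case base
  then show ?case by (simp add: words.span_zero)
next
  case (step c r q)
  have "prepend x r \<in> words.span
     ({Poly_Mapping.single (u @ x # y # v) 1 + Poly_Mapping.single (u @ y # x # v) 1
         - Poly_Mapping.single (u @ v) (anticomm x y) | u x y v. True}
      \<union> {Poly_Mapping.single (u @ [PsiStar a m]) 1 | u a m. True})"
  proof (rule words.span_base)
    show "prepend x r \<in> {Poly_Mapping.single (u @ x # y # v) 1 + Poly_Mapping.single (u @ y # x # v) 1
         - Poly_Mapping.single (u @ v) (anticomm x y) | u x y v. True}
      \<union> {Poly_Mapping.single (u @ [PsiStar a m]) 1 | u a m. True}"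
      using step(1)
    proof
      assume "r \<in> {Poly_Mapping.single (u @ x # y # v) 1 + Poly_Mapping.single (u @ y # x # v) 1
         - Poly_Mapping.single (u @ v) (anticomm x y) | u x y v. True}"
      then obtain u y z v where r: "r = Poly_Mapping.single (u @ y # z # v) 1
          + Poly_Mapping.single (u @ z # y # v) 1 - Poly_Mapping.single (u @ v) (anticomm y z)"
        by auto
      have "prepend x r = Poly_Mapping.single ((x # u) @ y # z # v) 1
          + Poly_Mapping.single ((x # u) @ z # y # v) 1
          - Poly_Mapping.single ((x # u) @ v) (anticomm y z)"
        by (simp add: r prepend.diff prepend.add prepend_single)
      then show ?thesis by blast
    next
      assume "r \<in> {Poly_Mapping.single (u @ [PsiStar a m]) 1 | u a m. True}"
      then obtain u a m where r: "r = Poly_Mapping.single (u @ [PsiStar a m]) 1"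
        by auto
      have "prepend x r = Poly_Mapping.single ((x # u) @ [PsiStar a m]) 1"
        by (simp add: r prepend_single)
      then show ?thesis by blast
    qed
  qed
  then show ?case
    using step(2) by (simp add: prepend.add prepend.scale words.span_add words.span_scale)
qed

lift_definition fock_op :: "'n fermion \<Rightarrow> ('n, 'r::comm_ring_1) fock \<Rightarrow> ('n, 'r) fock" is prepend
  by (unfold fock_rel_def prepend.diff [symmetric], rule prepend_relations)

text \<open>The vector \<open>\<psi>^{a\<^sub>1}_{m\<^sub>1} \<dots> \<psi>^{a\<^sub>k}_{m\<^sub>k} |\<emptyset>\<rangle>\<close> for \<open>[(a\<^sub>1,m\<^sub>1), \<dots>, (a\<^sub>k,m\<^sub>k)]\<close>.\<close>

definition psi_word :: "('n \<times> nat) list \<Rightarrow> ('n, 'r::comm_ring_1) fock" where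
  "psi_word w = foldr (\<lambda>(a, m). fock_op (Psi a m)) w vac"

definition fock_N :: "nat \<Rightarrow> ('n, 'r::comm_ring_1) fock set" where
  "fock_N N = fock.span {psi_word w | w. length w = N}"

text \<open>
  Recursion on the presentation: \<open>fock_rec s T v0\<close> is the map \<open>x\<^sub>1 \<dots> x\<^sub>k |\<emptyset>\<rangle> \<mapsto> T x\<^sub>1 (\<dots> (T x\<^sub>k v0))\<close>
  into a module with scalar multiplication \<open>s\<close>, meaningful when \<open>T\<close> and \<open>v0\<close> satisfy the defining
  relations.
\<close>

definition fock_rec ::
    "('r \<Rightarrow> 'm \<Rightarrow> 'm) \<Rightarrow> ('n fermion \<Rightarrow> 'm \<Rightarrow> 'm) \<Rightarrow> 'm
      \<Rightarrow> ('n, 'r::comm_ring_1) fock \<Rightarrow> 'm::ab_group_add" where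
  "fock_rec s T v0 v = (\<Sum>w\<in>Poly_Mapping.keys (rep_fock v). s (Poly_Mapping.lookup (rep_fock v) w) (foldr T w v0))"

locale fock_rep = module s
  for s :: "'r::comm_ring_1 \<Rightarrow> 'm::ab_group_add \<Rightarrow> 'm" +
  fixes T :: "'n fermion \<Rightarrow> 'm \<Rightarrow> 'm" and v0 :: 'm
  assumes T_hom: "module_hom s s (T x)"
    and T_anticomm: "T x (T y v) + T y (T x v) = s (anticomm x y) v"
    and T_vac: "T (PsiStar a m) v0 = 0"
begin

definition ev :: "('n fermion list \<Rightarrow>\<^sub>0 'r) \<Rightarrow> 'm" where
  "ev p = (\<Sum>w\<in>Poly_Mapping.keys p. s (Poly_Mapping.lookup p w) (foldr T w v0))"

lemma foldr_hom: "module_hom s s (foldr T u)"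
proof (induction u)
  case Nil
  then show ?case by (simp add: module_hom_id[unfolded id_def] id_def)
next
  case (Cons x u)
  then show ?case
    using module_hom_compose[OF Cons T_hom[of x]] by (simp add: comp_def fun_eq_iff)
qed

lemma ev_add: "ev (p + q) = ev p + ev q"
  unfolding ev_def by (rule setsum_keys_plus_distrib) (auto simp: scale_left_distrib)

lemma ev_single: "ev (Poly_Mapping.single w c) = s c (foldr T w v0)"
  by (cases "c = 0") (auto simp: ev_def)

lemma ev_sum: "ev (sum f S) = (\<Sum>i\<in>S. ev (f i))"
  by (induction S rule: infinite_finite_induct) (auto simp: ev_add ev_def[of 0])

lemma ev_scale: "ev (word_scale c p) = s c (ev p)"
proof -
  have "ev (word_scale c p)
      = ev (word_scale c (\<Sum>w\<in>Poly_Mapping.keys p. Poly_Mapping.single w (Poly_Mapping.lookup p w)))"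
    using words_expand[of p] by simp
  also have "\<dots> = s c (ev p)"
    by (simp add: words.scale_sum_right word_scale_single ev_sum ev_single ev_def[of p] scale_sum_right)
  finally show ?thesis .
qed

lemma ev_hom: "module_hom word_scale s ev"
  by unfold_locales (auto simp: ev_add ev_scale)

lemma ev_prepend: "ev (prepend x p) = T x (ev p)"
proof -
  interpret T: module_hom s s "T x" by (rule T_hom)
  show ?thesis
    by (simp add: prepend_def ev_sum ev_single ev_def[of p] T.sum T.scale)
qed

lemma ev_relations: "p \<in> fock_relations \<Longrightarrow> ev p = 0"
  unfolding fock_relations_def
proof (induction p rule: words.span_induct_alt)
  case base
  then show ?case by (simp add: ev_def)
next
  case (step c r q)
  have "ev r = 0"
    using step(1)
  proof
    assume "r \<in> {Poly_Mapping.single (u @ x # y # v) 1 + Poly_Mapping.single (u @ y # x # v) 1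
         - Poly_Mapping.single (u @ v) (anticomm x y) | u x y v. True}"
    then obtain u y z v where r: "r = Poly_Mapping.single (u @ y # z # v) 1
        + Poly_Mapping.single (u @ z # y # v) 1 - Poly_Mapping.single (u @ v) (anticomm y z)"
      by auto
    interpret E: module_hom word_scale s ev by (rule ev_hom)
    interpret F: module_hom s s "foldr T u" by (rule foldr_hom)
    have "ev r = foldr T u (T y (T z (foldr T v v0)) + T z (T y (foldr T v v0))
              - s (anticomm y z) (foldr T v v0))"
      by (simp add: r E.diff E.add ev_single F.add F.diff F.scale)
    then show ?thesis by (simp add: T_anticomm)
  next
    assume "r \<in> {Poly_Mapping.single (u @ [PsiStar a m]) 1 | u a m. True}"
    then obtain u a m where r: "r = Poly_Mapping.single (u @ [PsiStar a m]) 1"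
      by auto
    interpret F: module_hom s s "foldr T u" by (rule foldr_hom)
    show ?thesis by (simp add: r ev_single T_vac)
  qed
  then show ?case using step(2) by (simp add: ev_add ev_scale)
qed

lemma fock_rec_abs: "fock_rec s T v0 (abs_fock p) = ev p"
proof -
  interpret E: module_hom word_scale s ev by (rule ev_hom)
  have "fock_rel (rep_fock (abs_fock p)) p"
    using Quotient_fock fock_rel_equivp by (rule Quotient_rep_abs [OF _ equivp_reflp])
  then have "ev (rep_fock (abs_fock p) - p) = 0"
    by (simp add: fock_rel_def ev_relations)
  then show ?thesis
    by (simp add: E.diff fock_rec_def ev_def[of "rep_fock (abs_fock p)"])
qed

lemma fock_rec_vac: "fock_rec s T v0 vac = v0"
  by (simp add: vac_def fock_rec_abs ev_single)

lemma fock_rec_op: "fock_rec s T v0 (fock_op x v) = T x (fock_rec s T v0 v)"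
proof -
  obtain p where "v = abs_fock p" by (metis Quotient_abs_rep[OF Quotient_fock])
  then show ?thesis by (simp add: fock_op.abs_eq fock_rec_abs ev_prepend)
qed

lemma fock_rec_add: "fock_rec s T v0 (v + w) = fock_rec s T v0 v + fock_rec s T v0 w"
proof -
  obtain p q where "v = abs_fock p" "w = abs_fock q"
    by (metis Quotient_abs_rep[OF Quotient_fock])
  then show ?thesis by (simp add: plus_fock.abs_eq fock_rec_abs ev_add)
qed

lemma fock_rec_scale: "fock_rec s T v0 (fock_scale c v) = s c (fock_rec s T v0 v)"
proof -
  obtain p where "v = abs_fock p" by (metis Quotient_abs_rep[OF Quotient_fock])
  then show ?thesis by (simp add: fock_scale.abs_eq fock_rec_abs ev_scale)
qed

lemma fock_rec_hom: "module_hom fock_scale s (fock_rec s T v0)"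
  by unfold_locales (auto simp: fock_rec_add fock_rec_scale)

end


section \<open>Actions on the Fock space\<close>

text \<open>\<open>E^a_b \<otimes> z^m\<close> acts by \<open>\<Sum>\<^sub>l \<psi>^a_{l+m} \<psi>*_{b,l}\<close>; on each vector only finitely many terms are nonzero.\<close>

definition gl_fock :: "'n \<Rightarrow> 'n \<Rightarrow> nat \<Rightarrow> ('n, 'r::comm_ring_1) fock \<Rightarrow> ('n, 'r) fock" where
  "gl_fock a b m v = Sum_any (\<lambda>l. fock_op (Psi a (l + m)) (fock_op (PsiStar b l) v))"

text \<open>
  An automorphism \<open>g\<close> of \<open>R[z]^n\<close>, given by its invertible matrix, acts on \<open>\<Lambda>(R^n \<otimes> R[z])\<close> by
  \<open>\<psi>(u) \<mapsto> \<psi>(g u)\<close>, where \<open>\<psi>^a_m = \<psi>(e_a z^m)\<close>. The operators \<open>\<psi>*\<close> are transformed by the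
  inverse transpose, as is forced by the relations; this does not matter on \<open>F_N(n)\<close>.
\<close>

fun glz_op ::
    "'r::comm_ring_1 poly ^ 'n ^ 'n \<Rightarrow> 'n::finite fermion \<Rightarrow> ('n, 'r) fock \<Rightarrow> ('n, 'r) fock" where
  "glz_op g (Psi a m) v =
     (\<Sum>b\<in>UNIV. \<Sum>k\<le>Polynomial.degree (g $ b $ a).
        fock_scale (coeff (g $ b $ a) k) (fock_op (Psi b (m + k)) v))"
| "glz_op g (PsiStar a m) v =
     (\<Sum>b\<in>UNIV. \<Sum>k\<le>m.
        fock_scale (coeff (matrix_inv g $ a $ b) k) (fock_op (PsiStar b (m - k)) v))"

definition glz_fock ::
    "'r::comm_ring_1 poly ^ 'n ^ 'n \<Rightarrow> ('n::finite, 'r) fock \<Rightarrow> ('n, 'r) fock" where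
  "glz_fock g = fock_rec fock_scale (glz_op g) vac"

definition unit_inv :: "'r::comm_ring_1 \<Rightarrow> 'r" where
  "unit_inv q = (THE r. q * r = 1)"

fun rot_op :: "'r::comm_ring_1 \<Rightarrow> 'n fermion \<Rightarrow> ('n, 'r) fock \<Rightarrow> ('n, 'r) fock" where
  "rot_op q (Psi a m) v = fock_scale (q ^ m) (fock_op (Psi a m) v)"
| "rot_op q (PsiStar a m) v = fock_scale (unit_inv q ^ m) (fock_op (PsiStar a m) v)"

text \<open>The action \<open>q^deg\<close> of a unit \<open>q\<close>.\<close>

definition rot_fock :: "'r::comm_ring_1 \<Rightarrow> ('n, 'r) fock \<Rightarrow> ('n, 'r) fock" where
  "rot_fock q = fock_rec fock_scale (rot_op q) vac"


section \<open>The polynomial ring \<open>R[X,A]\<close>\<close>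

type_synonym ('N, 'n) xa_var = "('N \<times> 'N) + ('n \<times> 'N)"

type_synonym ('N, 'n, 'r) xa_poly = "(('N, 'n) xa_var \<Rightarrow>\<^sub>0 nat) \<Rightarrow>\<^sub>0 'r"

definition xa_const :: "'r::comm_ring_1 \<Rightarrow> ('N, 'n, 'r) xa_poly" where
  "xa_const c = Poly_Mapping.single 0 c"

definition xa_scale :: "'r::comm_ring_1 \<Rightarrow> ('N, 'n, 'r) xa_poly \<Rightarrow> ('N, 'n, 'r) xa_poly" where
  "xa_scale c p = xa_const c * p"

definition Xmat :: "('N::finite, 'n, 'r::comm_ring_1) xa_poly ^ 'N ^ 'N" where
  "Xmat = (\<chi> i j. Poly_Mapping.single (Poly_Mapping.single (Inl (i, j)) 1) 1)"

definition Amat :: "('N::finite, 'n::finite, 'r::comm_ring_1) xa_poly ^ 'N ^ 'n" where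
  "Amat = (\<chi> a i. Poly_Mapping.single (Poly_Mapping.single (Inr (a, i)) 1) 1)"

text \<open>The library's power on the type of square matrices is the componentwise one.\<close>

primrec mat_pow :: "'a::semiring_1 ^ 'N ^ 'N \<Rightarrow> nat \<Rightarrow> 'a ^ 'N ^ 'N" where
  "mat_pow M 0 = mat 1"
| "mat_pow M (Suc m) = mat_pow M m ** M"

text \<open>Substitution of the matrices \<open>Y\<close>, \<open>B\<close> of polynomials for \<open>X\<close>, \<open>A\<close>.\<close>

definition xa_subst ::
    "('N::finite, 'n::finite, 'r::comm_ring_1) xa_poly ^ 'N ^ 'N \<Rightarrow> ('N, 'n, 'r) xa_poly ^ 'N ^ 'n
      \<Rightarrow> ('N, 'n, 'r) xa_poly \<Rightarrow> ('N, 'n, 'r) xa_poly" where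
  "xa_subst Y B p = (\<Sum>mon\<in>Poly_Mapping.keys p. xa_const (Poly_Mapping.lookup p mon) *
     (\<Prod>v\<in>UNIV. (case v of Inl (i, j) \<Rightarrow> Y $ i $ j | Inr (a, i) \<Rightarrow> B $ a $ i)
                 ^ Poly_Mapping.lookup mon v))"

definition const_mat :: "'r::comm_ring_1 ^ 'N ^ 'N \<Rightarrow> ('N, 'n, 'r) xa_poly ^ 'N ^ 'N" where
  "const_mat g = (\<chi> i j. xa_const (g $ i $ j))"

text \<open>The space \<open>H_N(n,1)\<close>.\<close>

definition semi_invariants :: "('N::finite, 'n::finite, complex) xa_poly set" where
  "semi_invariants = {f. \<forall>g :: complex ^ 'N ^ 'N. invertible g \<longrightarrow>
     xa_subst (const_mat g ** Xmat ** const_mat (matrix_inv g)) (Amat ** const_mat (matrix_inv g)) f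
       = xa_scale (inverse (det g)) f}"

definition partial_A :: "'n \<Rightarrow> 'N \<Rightarrow> ('N, 'n, 'r::comm_ring_1) xa_poly \<Rightarrow> ('N, 'n, 'r) xa_poly" where
  "partial_A b j p = (\<Sum>mon\<in>Poly_Mapping.keys p.
     Poly_Mapping.single (mon - Poly_Mapping.single (Inr (b, j)) 1)
       (Poly_Mapping.lookup p mon * of_nat (Poly_Mapping.lookup mon (Inr (b, j)))))"

definition gl_xa ::
    "'n \<Rightarrow> 'n \<Rightarrow> nat \<Rightarrow> ('N::finite, 'n::finite, 'r::comm_ring_1) xa_poly \<Rightarrow> ('N, 'n, 'r) xa_poly" where
  "gl_xa a b m p = (\<Sum>i\<in>UNIV. \<Sum>j\<in>UNIV. Amat $ a $ i * mat_pow Xmat m $ i $ j * partial_A b j p)"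

text \<open>
  \<open>g\<close> acts by the substitution \<open>A^b \<mapsto> \<Sum>\<^sub>a \<Sum>\<^sub>k (g_k)^a_b A^a X^k\<close>, where \<open>g = \<Sum>\<^sub>k g_k z^k\<close>.
\<close>

definition glz_xa ::
    "'r::comm_ring_1 poly ^ 'n ^ 'n \<Rightarrow> ('N::finite, 'n::finite, 'r) xa_poly \<Rightarrow> ('N, 'n, 'r) xa_poly" where
  "glz_xa g = xa_subst Xmat (\<chi> b j. \<Sum>a\<in>UNIV. \<Sum>k\<le>Polynomial.degree (g $ a $ b).
     xa_const (coeff (g $ a $ b) k) * (Amat ** mat_pow Xmat k) $ a $ j)"

definition rot_xa :: "'r::comm_ring_1 \<Rightarrow> ('N::finite, 'n::finite, 'r) xa_poly \<Rightarrow> ('N, 'n, 'r) xa_poly" where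
  "rot_xa q = xa_subst (\<chi> i j. xa_const q * Xmat $ i $ j) Amat"

definition levi_civita :: "'a::linorder list \<Rightarrow> int" where
  "levi_civita is = (if distinct is
     then (-1) ^ card {(k, l). k < l \<and> l < length is \<and> is ! l < is ! k} else 0)"

text \<open>
  The image of \<open>psi_word w\<close>; the indices \<open>i\<^sub>1, \<dots>, i\<^sub>N\<close> are encoded as a list, and list positions
  start at 0.
\<close>

definition epsilon_poly :: "('n \<times> nat) list \<Rightarrow> ('N::{finite,linorder}, 'n::finite, 'r::comm_ring_1) xa_poly" where
  "epsilon_poly w = (\<Sum>is\<in>{is :: 'N list. length is = CARD('N)}.
     of_int (levi_civita is) *
     (\<Prod>k<CARD('N). (Amat ** mat_pow Xmat (snd (w ! k))) $ fst (w ! k) $ (is ! k)))"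


section \<open>Linear maps on subspaces and extension of scalars\<close>

definition linear_on_set ::
    "('r \<Rightarrow> 'a \<Rightarrow> 'a) \<Rightarrow> ('r \<Rightarrow> 'b \<Rightarrow> 'b) \<Rightarrow> 'a::plus set \<Rightarrow> ('a \<Rightarrow> 'b::plus) \<Rightarrow> bool" where
  "linear_on_set s t V f \<longleftrightarrow>
     (\<forall>x\<in>V. \<forall>y\<in>V. f (x + y) = f x + f y) \<and> (\<forall>c. \<forall>x\<in>V. f (s c x) = t c (f x))"

definition complex_algebra :: "(complex \<Rightarrow> 'r::comm_ring_1) \<Rightarrow> bool" where
  "complex_algebra h \<longleftrightarrow>
     h 1 = 1 \<and> (\<forall>x y. h (x + y) = h x + h y) \<and> (\<forall>x y. h (x * y) = h x * h y)"

text \<open>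
  For a complex algebra \<open>R\<close> with structure map \<open>h\<close>, this is \<open>v \<mapsto> 1 \<otimes> v\<close>, where the Fock space over
  \<open>R\<close> is identified with \<open>R \<otimes> F(n)\<close> (they have the same presentation). The analogous map for
  \<open>\<complex>[X,A]\<close> is \<open>Poly_Mapping.map h\<close>.
\<close>

definition fock_base :: "(complex \<Rightarrow> 'r::comm_ring_1) \<Rightarrow> ('n, complex) fock \<Rightarrow> ('n, 'r) fock" where
  "fock_base h = fock_rec (\<lambda>c. fock_scale (h c)) fock_op vac"

text \<open>
  \<open>fR\<close> is \<open>id \<otimes> f\<close> on \<open>R \<otimes> F_N(n)\<close>; this determines it there, since \<open>R \<otimes> F_N(n)\<close> is spanned
  over \<open>R\<close> by the vectors \<open>1 \<otimes> v\<close>.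
\<close>

definition is_base_change ::
    "(complex \<Rightarrow> 'r::comm_ring_1) \<Rightarrow> nat
      \<Rightarrow> (('n, complex) fock \<Rightarrow> ('N, 'n, complex) xa_poly)
      \<Rightarrow> (('n, 'r) fock \<Rightarrow> ('N, 'n, 'r) xa_poly) \<Rightarrow> bool" where
  "is_base_change h N f fR \<longleftrightarrow>
     linear_on_set fock_scale xa_scale (fock_N N) fR \<and>
     (\<forall>v\<in>fock_N N. fR (fock_base h v) = Poly_Mapping.map h (f v))"


section \<open>The definitions are the intended ones\<close>

subsection \<open>The Fock module\<close>

lemma fock_abs_cases: obtains p where "v = abs_fock p"
  by (metis Quotient_abs_rep [OF Quotient_fock])

interpretation fock_op: module_hom fock_scale fock_scale "fock_op x"
proof
  fix v w :: "('n, 'r::comm_ring_1) fock" and c :: 'r and x :: "'n fermion"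
  obtain p q where [simp]: "v = abs_fock p" "w = abs_fock q"
    by (metis fock_abs_cases)
  show "fock_op x (v + w) = fock_op x v + fock_op x w"
    by (simp add: plus_fock.abs_eq fock_op.abs_eq prepend.add)
  show "fock_op x (fock_scale c v) = fock_scale c (fock_op x v)"
    by (simp add: fock_scale.abs_eq fock_op.abs_eq prepend.scale)
qed

lemma abs_fock_eq_0: "p \<in> fock_relations \<Longrightarrow> abs_fock p = 0"
  by (simp add: zero_fock.abs_eq fock.abs_eq_iff fock_rel_def)

lemma fock_induct:
  assumes "P vac" and "\<And>x v. P v \<Longrightarrow> P (fock_op x v)"
    and "\<And>v w. P v \<Longrightarrow> P w \<Longrightarrow> P (v + w)" and "\<And>c v. P v \<Longrightarrow> P (fock_scale c v)"
  shows "P v"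
proof -
  have word: "P (abs_fock (Poly_Mapping.single w 1))" for w
  proof (induction w)
    case Nil
    then show ?case using assms(1) by (simp add: vac_def)
  next
    case (Cons x w)
    then show ?case
      using assms(2) [OF Cons] by (simp add: fock_op.abs_eq prepend_single)
  qed
  have single: "P (abs_fock (Poly_Mapping.single w c))" for w c
    using assms(4) [OF word [of w], of c] by (simp add: fock_scale.abs_eq word_scale_single)
  have zero: "P (abs_fock 0)"
    using single [of "[]" 0] by simp
  have "P (abs_fock (\<Sum>w\<in>S. Poly_Mapping.single w (f w)))" for S f
    by (induction S rule: infinite_finite_induct)
       (auto simp: zero plus_fock.abs_eq [symmetric] intro: assms(3) single)
  then show ?thesis
    by (metis fock_abs_cases words_expand)
qed

lemma fock_op_anticomm:
  "fock_op x (fock_op y v) + fock_op y (fock_op x v) = fock_scale (anticomm x y) v"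
proof -
  obtain p where p: "v = abs_fock p" by (rule fock_abs_cases)
  let ?d = "\<lambda>p. prepend x (prepend y p) + prepend y (prepend x p) - word_scale (anticomm x y) p"
  have single: "?d (Poly_Mapping.single w c) \<in> fock_relations" for w c
  proof -
    have "?d (Poly_Mapping.single w c) = word_scale c
        (Poly_Mapping.single ([] @ x # y # w) 1 + Poly_Mapping.single ([] @ y # x # w) 1
          - Poly_Mapping.single ([] @ w) (anticomm x y))"
      by (simp add: prepend_single word_scale_single words.scale_right_distrib
          words.scale_right_diff_distrib mult.commute)
    also have "\<dots> \<in> fock_relations"
      unfolding fock_relations_def by (rule words.span_scale, rule words.span_base) blast
    finally show ?thesis .
  qed
  have "?d (\<Sum>w\<in>Poly_Mapping.keys p. Poly_Mapping.single w (Poly_Mapping.lookup p w))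
      = (\<Sum>w\<in>Poly_Mapping.keys p. ?d (Poly_Mapping.single w (Poly_Mapping.lookup p w)))"
    by (simp add: prepend_sum words.scale_sum_right sum.distrib sum_subtractf)
  also have "\<dots> \<in> fock_relations"
    using single unfolding fock_relations_def by (rule words.span_sum)
  finally have "?d p \<in> fock_relations"
    using words_expand [of p] by simp
  then have "abs_fock (?d p) = 0" by (rule abs_fock_eq_0)
  then show ?thesis
    by (simp add: p fock_op.abs_eq fock_scale.abs_eq plus_fock.abs_eq minus_fock.abs_eq [symmetric])
qed

lemma fock_op_vac: "fock_op (PsiStar a m) (vac :: ('n, 'r::comm_ring_1) fock) = 0"
proof -
  have "Poly_Mapping.single ([] @ [PsiStar a m]) (1 :: 'r) \<in> fock_relations"
    unfolding fock_relations_def by (rule words.span_base) blast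
  then show ?thesis
    by (simp add: vac_def fock_op.abs_eq prepend_single abs_fock_eq_0)
qed

lemma psi_word_Nil: "psi_word [] = vac"
  by (simp add: psi_word_def)

lemma psi_word_Cons: "psi_word ((a, m) # w) = fock_op (Psi a m) (psi_word w)"
  by (simp add: psi_word_def)

subsection \<open>The group actions are well defined on the Fock module\<close>

lemma fock_op_combination_anticomm:
  "(\<Sum>i\<in>I. fock_scale (c i) (fock_op (x i) (\<Sum>j\<in>J. fock_scale (d j) (fock_op (y j) v))))
   + (\<Sum>j\<in>J. fock_scale (d j) (fock_op (y j) (\<Sum>i\<in>I. fock_scale (c i) (fock_op (x i) v))))
   = fock_scale (\<Sum>i\<in>I. \<Sum>j\<in>J. c i * d j * anticomm (x i) (y j)) v"
proof -
  have "(\<Sum>j\<in>J. fock_scale (d j) (fock_op (y j) (\<Sum>i\<in>I. fock_scale (c i) (fock_op (x i) v))))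
      = (\<Sum>i\<in>I. \<Sum>j\<in>J. fock_scale (c i * d j) (fock_op (y j) (fock_op (x i) v)))"
    by (subst sum.swap)
       (simp add: fock_op.sum fock_op.scale fock.scale_sum_right mult.commute)
  moreover have "(\<Sum>i\<in>I. fock_scale (c i) (fock_op (x i) (\<Sum>j\<in>J. fock_scale (d j) (fock_op (y j) v))))
      = (\<Sum>i\<in>I. \<Sum>j\<in>J. fock_scale (c i * d j) (fock_op (x i) (fock_op (y j) v)))"
    by (simp add: fock_op.sum fock_op.scale fock.scale_sum_right)
  moreover have "fock_scale (c i * d j) (fock_op (x i) (fock_op (y j) v))
      + fock_scale (c i * d j) (fock_op (y j) (fock_op (x i) v))
      = fock_scale (c i * d j * anticomm (x i) (y j)) v" for i j
    by (simp add: fock.scale_right_distrib [symmetric] fock_op_anticomm)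
  ultimately show ?thesis
    by (simp add: sum.distrib [symmetric] fock.scale_sum_left)
qed

lemma convolution_anticomm:
  fixes p q :: "'r::comm_ring_1 poly"
  shows "(\<Sum>k\<le>Polynomial.degree p. \<Sum>k'\<le>m'. coeff p k * coeff q k' * (if m + k = m' - k' then 1 else 0))
       = (if m \<le> m' then coeff (p * q) (m' - m) else 0)"
proof -
  have inner: "(\<Sum>k'\<le>m'. coeff p k * coeff q k' * (if m + k = m' - k' then 1 else 0))
      = (if m + k \<le> m' then coeff p k * coeff q (m' - m - k) else 0)" for k
  proof (cases "m + k \<le> m'")
    case True
    then have "m + k = m' - k' \<longleftrightarrow> k' = m' - m - k" if "k' \<le> m'" for k'
      using that by auto
    then have "(\<Sum>k'\<le>m'. coeff p k * coeff q k' * (if m + k = m' - k' then 1 else 0))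
        = (\<Sum>k'\<le>m'. if k' = m' - m - k then coeff p k * coeff q k' else 0)"
      by (intro sum.cong) auto
    then show ?thesis using True by simp
  next
    case False
    then show ?thesis by (auto intro!: sum.neutral)
  qed
  show ?thesis
  proof (cases "m \<le> m'")
    case True
    have "(\<Sum>k\<le>Polynomial.degree p. if m + k \<le> m' then coeff p k * coeff q (m' - m - k) else 0)
        = (\<Sum>k\<in>{..Polynomial.degree p} \<inter> {..m' - m}. coeff p k * coeff q (m' - m - k))"
      using True by (subst sum.inter_restrict) (auto intro!: sum.cong)
    also have "\<dots> = (\<Sum>k\<le>m' - m. coeff p k * coeff q (m' - m - k))"
      by (rule sum.mono_neutral_left) (auto, metis le_degree mult_zero_left)
    finally show ?thesis using True by (simp add: inner coeff_mult)
  next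
    case False
    then show ?thesis by (auto simp: inner)
  qed
qed

lemma glz_op_Psi_alt:
  "glz_op g (Psi a m) v = (\<Sum>(b, k)\<in>Sigma UNIV (\<lambda>b. {..Polynomial.degree (g $ b $ a)}).
     fock_scale (coeff (g $ b $ a) k) (fock_op (Psi b (m + k)) v))"
  by (simp add: sum.Sigma)

lemma glz_op_PsiStar_alt:
  "glz_op g (PsiStar a m) v = (\<Sum>(b, k)\<in>UNIV \<times> {..m}.
     fock_scale (coeff (matrix_inv g $ a $ b) k) (fock_op (PsiStar b (m - k)) v))"
  by (simp add: sum.Sigma)

lemma glz_op_mixed:
  fixes g :: "'r::comm_ring_1 poly ^ 'n ^ 'n" and v :: "('n::finite, 'r) fock"
  assumes "invertible g"
  shows "glz_op g (Psi a m) (glz_op g (PsiStar b m') v) + glz_op g (PsiStar b m') (glz_op g (Psi a m) v)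
    = fock_scale (if a = b \<and> m = m' then 1 else 0) v"
proof -
  let ?h = "matrix_inv g"
  have inv: "?h ** g = mat 1"
    using assms unfolding invertible_def matrix_inv_def by (rule someI2_ex) auto
  have entry: "(\<Sum>c\<in>UNIV. g $ c $ a * ?h $ b $ c) = (if a = b then 1 else 0)"
    using arg_cong [OF inv, of "\<lambda>M. M $ b $ a"]
    by (simp add: matrix_matrix_mult_def mat_def mult.commute)
  have "(\<Sum>(c, k)\<in>Sigma UNIV (\<lambda>c. {..Polynomial.degree (g $ c $ a)}). \<Sum>(d, k')\<in>UNIV \<times> {..m'}.
        coeff (g $ c $ a) k * coeff (?h $ b $ d) k' * anticomm (Psi c (m + k)) (PsiStar d (m' - k')))
     = (\<Sum>c\<in>UNIV. \<Sum>k\<le>Polynomial.degree (g $ c $ a). \<Sum>d\<in>UNIV. \<Sum>k'\<le>m'.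
        if c = d then coeff (g $ c $ a) k * coeff (?h $ b $ d) k' * (if m + k = m' - k' then 1 else 0) else 0)"
    by (simp add: sum.Sigma [symmetric] del: anticomm.simps)
       (auto intro!: sum.cong)
  also have "\<dots> = (\<Sum>c\<in>UNIV. \<Sum>k\<le>Polynomial.degree (g $ c $ a). \<Sum>k'\<le>m'.
        coeff (g $ c $ a) k * coeff (?h $ b $ c) k' * (if m + k = m' - k' then 1 else 0))"
  proof (intro sum.cong refl)
    fix c k
    have "(\<Sum>d\<in>UNIV. \<Sum>k'\<le>m'. if c = d then
          coeff (g $ c $ a) k * coeff (?h $ b $ d) k' * (if m + k = m' - k' then 1 else 0) else 0)
        = (\<Sum>d\<in>UNIV. if c = d then (\<Sum>k'\<le>m'.
          coeff (g $ c $ a) k * coeff (?h $ b $ d) k' * (if m + k = m' - k' then 1 else 0)) else 0)"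
      by (intro sum.cong refl) auto
    then show "(\<Sum>d\<in>UNIV. \<Sum>k'\<le>m'. if c = d then
          coeff (g $ c $ a) k * coeff (?h $ b $ d) k' * (if m + k = m' - k' then 1 else 0) else 0)
        = (\<Sum>k'\<le>m'. coeff (g $ c $ a) k * coeff (?h $ b $ c) k' * (if m + k = m' - k' then 1 else 0))"
      by (simp only: sum.delta' [OF finite_class.finite_UNIV]) simp
  qed
  also have "\<dots> = (if m \<le> m' then coeff (\<Sum>c\<in>UNIV. g $ c $ a * ?h $ b $ c) (m' - m) else 0)"
    by (simp only: convolution_anticomm) (simp add: coeff_sum)
  also have "\<dots> = (if a = b \<and> m = m' then 1 else 0)"
    by (subst entry) auto
  finally have coeffs: "(\<Sum>(c, k)\<in>Sigma UNIV (\<lambda>c. {..Polynomial.degree (g $ c $ a)}). \<Sum>(d, k')\<in>UNIV \<times> {..m'}.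
        coeff (g $ c $ a) k * coeff (?h $ b $ d) k' * anticomm (Psi c (m + k)) (PsiStar d (m' - k')))
     = (if a = b \<and> m = m' then 1 else 0)" .
  show ?thesis
    unfolding glz_op_Psi_alt glz_op_PsiStar_alt coeffs [symmetric]
    using fock_op_combination_anticomm [where
        I = "Sigma UNIV (\<lambda>c. {..Polynomial.degree (g $ c $ a)})" and J = "UNIV \<times> {..m'}"
        and c = "\<lambda>(c, k). coeff (g $ c $ a) k" and d = "\<lambda>(d, k'). coeff (?h $ b $ d) k'"
        and x = "\<lambda>(c, k). Psi c (m + k)" and y = "\<lambda>(d, k'). PsiStar d (m' - k')" and v = v]
    by (simp add: case_prod_unfold)
qed

lemma glz_op_hom: "module_hom fock_scale fock_scale (glz_op g x)"
  by unfold_locales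
     (cases x; simp add: fock_op.add fock_op.scale fock.scale_right_distrib sum.distrib
        fock.scale_sum_right mult.commute)+

lemma glz_rep:
  fixes g :: "'r::comm_ring_1 poly ^ 'n ^ 'n"
  assumes "invertible g"
  shows "fock_rep fock_scale (glz_op g) (vac :: ('n::finite, 'r) fock)"
proof -
  have "glz_op g x (glz_op g y v) + glz_op g y (glz_op g x v) = fock_scale (anticomm x y) v"
    for x y and v :: "('n, 'r) fock"
  proof (cases x; cases y)
    fix a m b m'
    assume "x = Psi a m" "y = Psi b m'"
    then show ?thesis
      using fock_op_combination_anticomm [where
        I = "Sigma UNIV (\<lambda>c. {..Polynomial.degree (g $ c $ a)})"
        and J = "Sigma UNIV (\<lambda>c. {..Polynomial.degree (g $ c $ b)})"
        and c = "\<lambda>(c, k). coeff (g $ c $ a) k" and d = "\<lambda>(c, k). coeff (g $ c $ b) k"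
        and x = "\<lambda>(c, k). Psi c (m + k)" and y = "\<lambda>(c, k). Psi c (m' + k)" and v = v]
      by (simp add: glz_op_Psi_alt case_prod_unfold del: glz_op.simps)
  next
    fix a m b m'
    assume "x = PsiStar a m" "y = PsiStar b m'"
    then show ?thesis
      using fock_op_combination_anticomm [where
        I = "UNIV \<times> {..m}" and J = "UNIV \<times> {..m'}"
        and c = "\<lambda>(c, k). coeff (matrix_inv g $ a $ c) k" and d = "\<lambda>(c, k). coeff (matrix_inv g $ b $ c) k"
        and x = "\<lambda>(c, k). PsiStar c (m - k)" and y = "\<lambda>(c, k). PsiStar c (m' - k)" and v = v]
      by (simp add: glz_op_PsiStar_alt case_prod_unfold del: glz_op.simps)
  next
    fix a m b m'
    assume "x = Psi a m" "y = PsiStar b m'"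
    then show ?thesis using glz_op_mixed [OF assms] by (simp del: glz_op.simps)
  next
    fix a m b m'
    assume "x = PsiStar b m'" "y = Psi a m"
    then show ?thesis
      using glz_op_mixed [OF assms, of a m b m' v] by (simp add: add.commute del: glz_op.simps)
  qed
  then show ?thesis
    by (intro fock_rep.intro fock_rep_axioms.intro fock.module_axioms glz_op_hom)
       (simp_all add: fock_op_vac)
qed

lemma unit_inv:
  assumes "q dvd 1"
  shows "q * unit_inv q = 1"
proof -
  obtain r where r: "q * r = 1" using assms by (auto elim: dvdE)
  have "s = r" if "q * s = 1" for s
    using that r by (metis mult.assoc mult.commute mult.right_neutral)
  then have "\<exists>!s. q * s = 1" using r by blast
  then show ?thesis unfolding unit_inv_def by (rule theI')
qed

lemma rot_rep:
  assumes "q dvd 1"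
  shows "fock_rep fock_scale (rot_op q) (vac :: ('n, 'r::comm_ring_1) fock)"
proof -
  have pow: "q ^ m * unit_inv q ^ m = 1" for m
    using unit_inv [OF assms] by (metis power_mult_distrib power_one)
  have "rot_op q x (rot_op q y v) + rot_op q y (rot_op q x v) = fock_scale (anticomm x y) v"
    for x y and v :: "('n, 'r) fock"
  proof -
    define e where "e z = (case z of Psi a m \<Rightarrow> q ^ m | PsiStar a m \<Rightarrow> unit_inv q ^ m)"
      for z :: "'n fermion"
    have e: "rot_op q z v = fock_scale (e z) (fock_op z v)" 
      for z and v :: "('n, 'r) fock"
      by (cases z) (auto simp: e_def)
    have "rot_op q x (rot_op q y v) + rot_op q y (rot_op q x v)
        = fock_scale (e x * e y) (fock_op x (fock_op y v) + fock_op y (fock_op x v))"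
      by (simp add: e fock_op.scale fock.scale_right_distrib mult.commute)
    also have "\<dots> = fock_scale (anticomm x y) v"
      by (cases x; cases y) (auto simp: fock_op_anticomm e_def pow pow [unfolded mult.commute [of "q ^ _"]])
    finally show ?thesis .
  qed
  moreover have "module_hom fock_scale fock_scale (rot_op q x :: ('n, 'r) fock \<Rightarrow> _)" for x
    by unfold_locales
       (cases x; simp add: fock_op.add fock_op.scale fock.scale_right_distrib mult.commute)+
  ultimately show ?thesis
    by (intro fock_rep.intro fock_rep_axioms.intro fock.module_axioms)
       (simp_all add: fock_op_vac)
qed

lemma base_rep:
  assumes "complex_algebra h"
  shows "fock_rep (\<lambda>c. fock_scale (h c)) fock_op (vac :: ('n, 'r::comm_ring_1) fock)"
proof -
  have add: "h (x + y) = h x + h y" and mult: "h (x * y) = h x * h y" and one: "h 1 = 1" for x y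
    using assms by (auto simp: complex_algebra_def)
  have zero: "h 0 = 0" using add [of 0 0] by simp
  interpret module "\<lambda>c. fock_scale (h c) :: ('n, 'r) fock \<Rightarrow> _"
    by unfold_locales (auto simp: add mult one fock.scale_right_distrib fock.scale_left_distrib)
  have "h (anticomm x y) = anticomm x y" for x y :: "'n fermion"
    by (cases x; cases y) (auto simp: zero one)
  then show ?thesis
    by unfold_locales (auto simp: fock_op.add fock_op.scale fock_op_anticomm fock_op_vac)
qed

lemma glz_fock_psi_word:
  assumes "invertible g"
  shows "glz_fock g (psi_word w) = foldr (\<lambda>(a, m). glz_op g (Psi a m)) w vac"
proof (induction w)
  case Nil
  then show ?case
    by (simp add: psi_word_Nil glz_fock_def fock_rep.fock_rec_vac [OF glz_rep [OF assms]])
next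
  case (Cons am w)
  obtain a m where "am = (a, m)" by fastforce
  then show ?case
    using Cons by (simp add: psi_word_Cons glz_fock_def
        fock_rep.fock_rec_op [OF glz_rep [OF assms]] del: glz_op.simps)
qed

lemma rot_fock_psi_word:
  assumes "q dvd 1"
  shows "rot_fock q (psi_word w) = fock_scale (q ^ sum_list (map snd w)) (psi_word w)"
proof (induction w)
  case Nil
  then show ?case
    by (simp add: psi_word_Nil rot_fock_def fock_rep.fock_rec_vac [OF rot_rep [OF assms]])
next
  case (Cons am w)
  obtain a m where "am = (a, m)" by fastforce
  then show ?case
    using Cons by (simp add: psi_word_Cons rot_fock_def fock_op.scale power_add mult.commute
        fock_rep.fock_rec_op [OF rot_rep [OF assms]])
qed

lemma fock_base_psi_word:
  assumes "complex_algebra h"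
  shows "fock_base h (psi_word w) = psi_word w"
proof (induction w)
  case Nil
  then show ?case
    by (simp add: psi_word_Nil fock_base_def fock_rep.fock_rec_vac [OF base_rep [OF assms]])
next
  case (Cons am w)
  obtain a m where "am = (a, m)" by fastforce
  then show ?case
    using Cons by (simp add: psi_word_Cons fock_base_def
        fock_rep.fock_rec_op [OF base_rep [OF assms]])
qed

subsection \<open>The group actions integrate the actions of \<open>gl_n[z]\<close>\<close>

text \<open>For \<open>e\<^sup>2 = 0\<close>, the automorphism \<open>1 + e E^a_b z^m\<close> acts as \<open>1 + e (E^a_b \<otimes> z^m)\<close>.\<close>

definition glz_infinitesimal :: "'r::comm_ring_1 \<Rightarrow> 'n \<Rightarrow> 'n \<Rightarrow> nat \<Rightarrow> 'r poly ^ 'n ^ 'n" where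
  "glz_infinitesimal e a b m =
     mat 1 + (\<chi> c d. if c = a \<and> d = b then monom e m else 0)"

lemma glz_infinitesimal_nth:
  "glz_infinitesimal e a b m $ c $ d
     = (if c = d then 1 else 0) + (if c = a \<and> d = b then monom e m else 0)"
  by (simp add: glz_infinitesimal_def mat_def)

lemma glz_infinitesimal_inverse:
  fixes e :: "'r::comm_ring_1" and a b :: "'n::finite"
  assumes "e * e = 0"
  shows "glz_infinitesimal e a b m ** glz_infinitesimal (- e) a b m = mat 1"
proof -
  have "(\<Sum>k\<in>UNIV. glz_infinitesimal e a b m $ c $ k * glz_infinitesimal (- e) a b m $ k $ d)
      = (if c = d then 1 else 0)" for c d
  proof -
    have "(\<Sum>k\<in>UNIV. glz_infinitesimal e a b m $ c $ k * glz_infinitesimal (- e) a b m $ k $ d)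
      = (\<Sum>k\<in>UNIV. (if c = k then glz_infinitesimal (- e) a b m $ k $ d else 0)
          + (if k = b then (if c = a then monom e m * glz_infinitesimal (- e) a b m $ k $ d else 0) else 0))"
    proof (intro sum.cong refl)
      fix k
      show "glz_infinitesimal e a b m $ c $ k * u
          = (if c = k then u else 0) + (if k = b then (if c = a then monom e m * u else 0) else 0)" for u
        by (simp add: glz_infinitesimal_nth distrib_right)
    qed
    also have "\<dots> = glz_infinitesimal (- e) a b m $ c $ d
          + (if c = a then monom e m * glz_infinitesimal (- e) a b m $ b $ d else 0)"
      by (simp add: sum.distrib)
    also have "\<dots> = (if c = d then 1 else 0)"
    proof -
      have "monom e m * monom (- e) m = 0" by (simp add: mult_monom assms)
      moreover have "monom (- e) m + monom e m = 0" by (simp add: add_monom)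
      ultimately show ?thesis
        by (cases "c = a"; cases "d = b") (simp_all add: glz_infinitesimal_nth distrib_left add.assoc)
    qed
    finally show ?thesis .
  qed
  then show ?thesis by (simp add: matrix_matrix_mult_def mat_def vec_eq_iff)
qed

lemma glz_infinitesimal_invertible:
  fixes e :: "'r::comm_ring_1" and a b :: "'n::finite"
  assumes "e * e = 0"
  shows "invertible (glz_infinitesimal e a b m)"
  unfolding invertible_def
  using glz_infinitesimal_inverse [OF assms, of a b m]
    glz_infinitesimal_inverse [of "- e" a b m] assms by auto

lemma glz_infinitesimal_degree:
  "Polynomial.degree (glz_infinitesimal e a b m $ c $ d) \<le> m"
  unfolding glz_infinitesimal_nth
  by (rule degree_add_le) (simp_all add: degree_monom_le)

lemma glz_infinitesimal_sum:
  assumes "\<And>x. F 0 x = (0 :: 'm::ab_group_add)" "\<And>c d x. F (c + d) x = F c x + F d x"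
  shows "(\<Sum>k\<le>Polynomial.degree (glz_infinitesimal e a b m $ c $ d).
            F (coeff (glz_infinitesimal e a b m $ c $ d) k) k)
       = (if c = d then F 1 0 else 0) + (if c = a \<and> d = b then F e m else 0)"
proof -
  have "(\<Sum>k\<le>Polynomial.degree (glz_infinitesimal e a b m $ c $ d).
            F (coeff (glz_infinitesimal e a b m $ c $ d) k) k)
      = (\<Sum>k\<le>m. F (coeff (glz_infinitesimal e a b m $ c $ d) k) k)"
    using glz_infinitesimal_degree [of e a b m c d]
    by (intro sum.mono_neutral_left) (auto simp: assms(1) coeff_eq_0)
  also have "\<dots> = (\<Sum>k\<le>m. (if k = 0 then (if c = d then F 1 k else 0) else 0)
      + (if k = m then (if c = a \<and> d = b then F e k else 0) else 0))"
    by (intro sum.cong) (auto simp: glz_infinitesimal_nth assms coeff_1 when_def)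
  finally show ?thesis by (simp add: sum.distrib)
qed

lemma fock_op_star_eventually_zero: "\<exists>L. \<forall>l\<ge>L. fock_op (PsiStar b l) v = 0"
proof (induction v rule: fock_induct)
  case 1
  then show ?case by (simp add: fock_op_vac)
next
  case (2 x v)
  then obtain L where L: "\<forall>l\<ge>L. fock_op (PsiStar b l) v = 0" by blast
  have "fock_op (PsiStar b l) (fock_op x v) = 0"
    if "l \<ge> L + Suc (case x of Psi a m \<Rightarrow> m | PsiStar a m \<Rightarrow> m)" for l
  proof -
    have "fock_op (PsiStar b l) (fock_op x v) + fock_op x (fock_op (PsiStar b l) v)
        = fock_scale (anticomm (PsiStar b l) x) v"
      by (rule fock_op_anticomm)
    moreover have "fock_op (PsiStar b l) v = 0" using L that by auto
    moreover have "anticomm (PsiStar b l) x = (0 :: 'b)" using that by (cases x) auto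
    ultimately show ?thesis by simp
  qed
  then show ?case by blast
next
  case (3 v w)
  then obtain L M where "\<forall>l\<ge>L. fock_op (PsiStar b l) v = 0" "\<forall>l\<ge>M. fock_op (PsiStar b l) w = 0"
    by auto
  then have "\<forall>l\<ge>L + M. fock_op (PsiStar b l) (v + w) = 0" by (simp add: fock_op.add)
  then show ?case by blast
next
  case (4 c v)
  then show ?case by (metis fock_op.scale fock.scale_zero_right)
qed

lemma gl_fock_eq_sum:
  assumes "\<And>l. l \<ge> L \<Longrightarrow> fock_op (PsiStar b l) v = 0"
  shows "gl_fock a b m v = (\<Sum>l<L. fock_op (Psi a (l + m)) (fock_op (PsiStar b l) v))"
  unfolding gl_fock_def
proof (rule Sum_any.expand_superset)
  have "l < L" if "fock_op (Psi a (l + m)) (fock_op (PsiStar b l) v) \<noteq> 0" for l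
    using assms [of l] that by (cases "l < L") auto
  then show "{l. fock_op (Psi a (l + m)) (fock_op (PsiStar b l) v) \<noteq> 0} \<subseteq> {..<L}"
    by blast
qed simp

lemma gl_fock_hom: "module_hom fock_scale fock_scale (gl_fock a b m :: ('n, 'r::comm_ring_1) fock \<Rightarrow> _)"
proof unfold_locales
  fix v w :: "('n, 'r) fock" and c :: 'r
  obtain L1 where L1: "\<forall>l\<ge>L1. fock_op (PsiStar b l) v = 0"
    using fock_op_star_eventually_zero [of b v] by blast
  obtain L2 where L2: "\<forall>l\<ge>L2. fock_op (PsiStar b l) w = 0"
    using fock_op_star_eventually_zero [of b w] by blast
  from L1 L2 have eqs: "gl_fock a b m v = (\<Sum>l<L1 + L2. fock_op (Psi a (l + m)) (fock_op (PsiStar b l) v))"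
    "gl_fock a b m w = (\<Sum>l<L1 + L2. fock_op (Psi a (l + m)) (fock_op (PsiStar b l) w))"
    "gl_fock a b m (v + w) = (\<Sum>l<L1 + L2. fock_op (Psi a (l + m)) (fock_op (PsiStar b l) (v + w)))"
    "gl_fock a b m (fock_scale c v)
       = (\<Sum>l<L1 + L2. fock_op (Psi a (l + m)) (fock_op (PsiStar b l) (fock_scale c v)))"
    by (intro gl_fock_eq_sum; simp add: fock_op.add fock_op.scale)+
  show "gl_fock a b m (v + w) = gl_fock a b m v + gl_fock a b m w"
    unfolding eqs by (simp add: fock_op.add sum.distrib)
  show "gl_fock a b m (fock_scale c v) = fock_scale c (gl_fock a b m v)"
    unfolding eqs by (simp add: fock_op.scale fock.scale_sum_right)
qed

lemma gl_fock_vac: "gl_fock a b m vac = 0"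
  using gl_fock_eq_sum [of 0 b vac] by (simp add: fock_op_vac)

lemma gl_fock_Psi:
  "gl_fock a b m (fock_op (Psi c k) v)
     = fock_op (Psi c k) (gl_fock a b m v) + (if c = b then fock_op (Psi a (k + m)) v else 0)"
proof -
  let ?P = "\<lambda>l. fock_op (Psi a (l + m))" and ?S = "\<lambda>l. fock_op (PsiStar b l)"
  obtain L1 where L1: "\<forall>l\<ge>L1. ?S l v = 0"
    using fock_op_star_eventually_zero [of b v] by blast
  obtain L2 where L2: "\<forall>l\<ge>L2. ?S l (fock_op (Psi c k) v) = 0"
    using fock_op_star_eventually_zero [of b "fock_op (Psi c k) v"] by blast
  define L where "L = L1 + L2 + Suc k"
  have eqs: "gl_fock a b m v = (\<Sum>l<L. ?P l (?S l v))"
    "gl_fock a b m (fock_op (Psi c k) v) = (\<Sum>l<L. ?P l (?S l (fock_op (Psi c k) v)))"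
    by (intro gl_fock_eq_sum; use L1 L2 in \<open>simp add: L_def\<close>)+
  have "?P l (?S l (fock_op (Psi c k) v))
      = fock_op (Psi c k) (?P l (?S l v)) + (if l = k then (if c = b then ?P l v else 0) else 0)" for l
  proof -
    have 1: "?S l (fock_op (Psi c k) v)
        = (if c = b \<and> l = k then v else 0) - fock_op (Psi c k) (?S l v)"
      using fock_op_anticomm [of "PsiStar b l" "Psi c k" v]
      by (auto simp: algebra_simps eq_neg_iff_add_eq_0 split: if_splits)
    have 2: "?P l (fock_op (Psi c k) u) = - fock_op (Psi c k) (?P l u)" for u
      using fock_op_anticomm [of "Psi a (l + m)" "Psi c k" u] by (simp add: eq_neg_iff_add_eq_0)
    show ?thesis by (simp add: 1 2 fock_op.diff)
  qed
  moreover have "k < L" by (simp add: L_def)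
  ultimately show ?thesis
    unfolding eqs by (simp add: sum.distrib fock_op.sum)
qed

lemma glz_fock_integrates:
  fixes e :: "'r::comm_ring_1" and v :: "('n::finite, 'r) fock"
  assumes "e * e = 0" and "v \<in> fock_N N"
  shows "glz_fock (glz_infinitesimal e a b m) v = v + fock_scale e (gl_fock a b m v)"
proof -
  let ?g = "glz_infinitesimal e a b m"
  note rep = glz_rep [OF glz_infinitesimal_invertible [OF assms(1), of a b m]]
  interpret G: module_hom fock_scale fock_scale "glz_fock ?g"
    unfolding glz_fock_def by (rule fock_rep.fock_rec_hom [OF rep])
  interpret D: module_hom fock_scale fock_scale "gl_fock a b m :: ('n, 'r) fock \<Rightarrow> _"
    by (rule gl_fock_hom)
  have op: "glz_op ?g (Psi c k) u
      = fock_op (Psi c k) u + (if c = b then fock_scale e (fock_op (Psi a (k + m)) u) else 0)"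
    for c k and u :: "('n, 'r) fock"
  proof -
    have "glz_op ?g (Psi c k) u = (\<Sum>d\<in>UNIV. (if d = c then fock_op (Psi d k) u else 0)
        + (if d = a then (if c = b then fock_scale e (fock_op (Psi d (k + m)) u) else 0) else 0))"
      unfolding glz_op.simps
      by (intro sum.cong refl, subst glz_infinitesimal_sum)
         (auto simp: fock.scale_left_distrib)
    then show ?thesis by (simp add: sum.distrib)
  qed
  have word: "glz_fock ?g (psi_word w) = psi_word w + fock_scale e (gl_fock a b m (psi_word w))" for w
  proof (induction w)
    case Nil
    then show ?case
      by (simp add: psi_word_Nil glz_fock_def fock_rep.fock_rec_vac [OF rep] gl_fock_vac)
  next
    case (Cons ck w)
    obtain c k where ck: "ck = (c, k)" by fastforce
    have "glz_fock ?g (psi_word (ck # w)) = glz_op ?g (Psi c k) (glz_fock ?g (psi_word w))"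
      by (simp add: ck psi_word_Cons glz_fock_def fock_rep.fock_rec_op [OF rep] del: glz_op.simps)
    also have "\<dots> = psi_word (ck # w) + fock_scale e (gl_fock a b m (psi_word (ck # w)))"
      using assms(1)
      by (simp add: Cons op ck psi_word_Cons gl_fock_Psi fock_op.add fock_op.scale
          fock.scale_right_distrib del: glz_op.simps)
    finally show ?case .
  qed
  show ?thesis
    using assms(2) unfolding fock_N_def
  proof (induction v rule: fock.span_induct_alt)
    case base
    then show ?case by (simp add: D.zero)
  next
    case (step c x y)
    then show ?case
      using word
      by (auto simp: G.add G.scale D.add D.scale fock.scale_right_distrib mult.commute)
  qed
qed

lemma xa_poly_expand: "p = (\<Sum>mon\<in>Poly_Mapping.keys p. Poly_Mapping.single mon (Poly_Mapping.lookup p mon))"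
  by (rule poly_mapping_eqI)
     (auto simp: lookup_sum lookup_single when_def sum.delta in_keys_iff)

lemma xa_monomial:
  fixes mon :: "('N::finite, 'n::finite) xa_var \<Rightarrow>\<^sub>0 nat" and c :: "'r::comm_ring_1"
  shows "Poly_Mapping.single mon c = xa_const c *
    (\<Prod>v\<in>UNIV. Poly_Mapping.single (Poly_Mapping.single v 1) 1 ^ Poly_Mapping.lookup mon v)"
proof -
  have pow: "Poly_Mapping.single (Poly_Mapping.single v 1) (1 :: 'r) ^ k
      = Poly_Mapping.single (Poly_Mapping.single v k) 1" for v :: "('N, 'n) xa_var" and k :: nat
    by (induction k) (auto simp: mult_single single_add [symmetric])
  have prod: "(\<Prod>v\<in>S. Poly_Mapping.single (f v) (1 :: 'r)) = Poly_Mapping.single (\<Sum>v\<in>S. f v) 1"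
    if "finite S" for S :: "('N, 'n) xa_var set" and f :: "_ \<Rightarrow> ('N, 'n) xa_var \<Rightarrow>\<^sub>0 nat"
    using that by (induction S) (auto simp: mult_single)
  have "(\<Sum>v\<in>UNIV. Poly_Mapping.single v (Poly_Mapping.lookup mon v)) = mon"
    by (rule poly_mapping_eqI) (auto simp: lookup_sum lookup_single when_def)
  then show ?thesis
    by (simp only: pow prod [OF finite_class.finite_UNIV]) (simp add: xa_const_def mult_single)
qed

lemma xa_const_add: "xa_const (c + d) = xa_const c + xa_const d"
  by (simp add: xa_const_def single_add)

lemma xa_const_mult: "xa_const (c * d) = xa_const c * xa_const d"
  by (simp add: xa_const_def mult_single)

lemma xa_const_0 [simp]: "xa_const 0 = 0"
  by (simp add: xa_const_def)

lemma xa_const_1 [simp]: "xa_const 1 = 1"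
  by (simp add: xa_const_def)

lemma xa_induct:
  fixes p :: "('N::finite, 'n::finite, 'r::comm_ring_1) xa_poly"
  assumes const: "\<And>c. P (xa_const c)"
    and X: "\<And>i j. P (Xmat $ i $ j)" and A: "\<And>a i. P (Amat $ a $ i)"
    and add: "\<And>p q. P p \<Longrightarrow> P q \<Longrightarrow> P (p + q)" and mult: "\<And>p q. P p \<Longrightarrow> P q \<Longrightarrow> P (p * q)"
  shows "P p"
proof -
  have zero: "P 0" and one: "P 1" using const [of 0] const [of 1] by auto
  have var: "P (Poly_Mapping.single (Poly_Mapping.single v 1) 1)" for v
  proof (cases v)
    case (Inl ij)
    then show ?thesis using X [of "fst ij" "snd ij"] by (simp add: Xmat_def)
  next
    case (Inr ai)
    then show ?thesis using A [of "fst ai" "snd ai"] by (simp add: Amat_def)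
  qed
  have pow: "P (q ^ k)" if "P q" for q k
    using that by (induction k) (auto intro: one mult)
  have prod: "P (\<Prod>v\<in>S. f v)" if "\<And>v. P (f v)" for S :: "('N, 'n) xa_var set" and f
    using that by (induction S rule: infinite_finite_induct) (auto intro: one mult)
  have "P (Poly_Mapping.single mon c)" for mon c
    by (subst xa_monomial) (intro mult const prod pow var)
  then have "P (\<Sum>mon\<in>S. Poly_Mapping.single mon (f mon))" for S f
    by (induction S rule: infinite_finite_induct) (auto intro: zero add)
  then show ?thesis by (subst xa_poly_expand)
qed

text \<open>\<open>xa_subst Y B\<close> is the ring homomorphism with \<open>X \<mapsto> Y\<close>, \<open>A \<mapsto> B\<close>.\<close>

lemma xa_subst_add: "xa_subst Y B (p + q) = xa_subst Y B p + xa_subst Y B q"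
  unfolding xa_subst_def
  by (rule setsum_keys_plus_distrib) (auto simp: xa_const_add distrib_right)

lemma xa_subst_0 [simp]: "xa_subst Y B 0 = 0"
  by (simp add: xa_subst_def)

lemma xa_subst_sum: "xa_subst Y B (sum f S) = (\<Sum>i\<in>S. xa_subst Y B (f i))"
  by (induction S rule: infinite_finite_induct) (auto simp: xa_subst_add)

lemma xa_subst_single:
  "xa_subst Y B (Poly_Mapping.single mon c) = xa_const c *
     (\<Prod>v\<in>UNIV. (case v of Inl (i, j) \<Rightarrow> Y $ i $ j | Inr (a, i) \<Rightarrow> B $ a $ i)
                 ^ Poly_Mapping.lookup mon v)"
  by (cases "c = 0") (auto simp: xa_subst_def)

lemma xa_subst_mult: "xa_subst Y B (p * q) = xa_subst Y B p * xa_subst Y B q"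
proof -
  have single: "xa_subst Y B (Poly_Mapping.single mon c * Poly_Mapping.single mon' d)
      = xa_subst Y B (Poly_Mapping.single mon c) * xa_subst Y B (Poly_Mapping.single mon' d)"
    for mon c mon' d
    by (simp add: mult_single xa_subst_single lookup_add power_add prod.distrib xa_const_mult mult_ac)
  have "xa_subst Y B ((\<Sum>i\<in>S. Poly_Mapping.single i (f i)) * (\<Sum>j\<in>T. Poly_Mapping.single j (g j)))
      = xa_subst Y B (\<Sum>i\<in>S. Poly_Mapping.single i (f i)) * xa_subst Y B (\<Sum>j\<in>T. Poly_Mapping.single j (g j))"
    for S T f g
    by (simp add: sum_product xa_subst_sum single)
  from this [of "Poly_Mapping.lookup p" "Poly_Mapping.keys p" "Poly_Mapping.lookup q" "Poly_Mapping.keys q"]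
  show ?thesis by (simp only: xa_poly_expand [symmetric])
qed

lemma xa_subst_const: "xa_subst Y B (xa_const c) = xa_const c"
  unfolding xa_const_def by (subst xa_subst_single) (simp add: xa_const_def)

lemma xa_subst_var:
  "xa_subst Y B (Poly_Mapping.single (Poly_Mapping.single v 1) 1)
     = (case v of Inl (i, j) \<Rightarrow> Y $ i $ j | Inr (a, i) \<Rightarrow> B $ a $ i)"
proof -
  have "xa_subst Y B (Poly_Mapping.single (Poly_Mapping.single v 1) 1)
      = (\<Prod>w\<in>UNIV. if w = v then (case w of Inl (i, j) \<Rightarrow> Y $ i $ j | Inr (a, i) \<Rightarrow> B $ a $ i) else 1)"
    unfolding xa_subst_single xa_const_1 mult_1_left
    by (intro prod.cong refl) (auto simp: lookup_single when_def)
  then show ?thesis by simp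
qed

lemma xa_subst_Xmat: "xa_subst Y B (Xmat $ i $ j) = Y $ i $ j"
  using xa_subst_var [of Y B "Inl (i, j)"] by (simp add: Xmat_def)

lemma xa_subst_Amat: "xa_subst Y B (Amat $ a $ i) = B $ a $ i"
  using xa_subst_var [of Y B "Inr (a, i)"] by (simp add: Amat_def)

lemma partial_A_add: "partial_A b j (p + q) = partial_A b j p + partial_A b j q"
  unfolding partial_A_def
  by (rule setsum_keys_plus_distrib) (auto simp: single_add distrib_right)

lemma partial_A_sum: "partial_A b j (sum f S) = (\<Sum>i\<in>S. partial_A b j (f i))"
  by (induction S rule: infinite_finite_induct) (auto simp: partial_A_add partial_A_def [of _ _ 0])

lemma partial_A_single:
  "partial_A b j (Poly_Mapping.single mon c) =
     Poly_Mapping.single (mon - Poly_Mapping.single (Inr (b, j)) 1)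
       (c * of_nat (Poly_Mapping.lookup mon (Inr (b, j))))"
  by (cases "c = 0") (auto simp: partial_A_def)

lemma monomial_minus_add:
  fixes mon mon' :: "'v \<Rightarrow>\<^sub>0 nat"
  assumes "Poly_Mapping.lookup mon v \<noteq> 0"
  shows "mon - Poly_Mapping.single v 1 + mon' = mon + mon' - Poly_Mapping.single v 1"
  using assms by (intro poly_mapping_eqI) (auto simp: lookup_add lookup_minus lookup_single when_def)

lemma partial_A_mult: "partial_A b j (p * q) = partial_A b j p * q + p * partial_A b j q"
proof -
  have single: "partial_A b j (Poly_Mapping.single mon c * Poly_Mapping.single mon' d)
      = partial_A b j (Poly_Mapping.single mon c) * Poly_Mapping.single mon' d
        + Poly_Mapping.single mon c * partial_A b j (Poly_Mapping.single mon' d)"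
    for mon c mon' d
  proof -
    let ?v = "Inr (b, j)"
    let ?s = "Poly_Mapping.single (mon + mon' - Poly_Mapping.single ?v 1)"
    have 1: "Poly_Mapping.single (mon - Poly_Mapping.single ?v 1 + mon') (c * of_nat (Poly_Mapping.lookup mon ?v) * d)
        = ?s (c * of_nat (Poly_Mapping.lookup mon ?v) * d)"
    proof (cases "Poly_Mapping.lookup mon ?v = 0")
      case False
      then show ?thesis using monomial_minus_add [of mon ?v mon'] by simp
    qed simp
    have 2: "Poly_Mapping.single (mon + (mon' - Poly_Mapping.single ?v 1)) (c * (d * of_nat (Poly_Mapping.lookup mon' ?v)))
        = ?s (c * (d * of_nat (Poly_Mapping.lookup mon' ?v)))"
    proof (cases "Poly_Mapping.lookup mon' ?v = 0")
      case False
      then show ?thesis using monomial_minus_add [of mon' ?v mon] by (simp add: add.commute)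
    qed simp
    show ?thesis
      unfolding partial_A_single mult_single 1 2 single_add [symmetric]
      by (simp add: lookup_add algebra_simps)
  qed
  have "partial_A b j ((\<Sum>i\<in>S. Poly_Mapping.single i (f i)) * (\<Sum>k\<in>T. Poly_Mapping.single k (g k)))
      = partial_A b j (\<Sum>i\<in>S. Poly_Mapping.single i (f i)) * (\<Sum>k\<in>T. Poly_Mapping.single k (g k))
        + (\<Sum>i\<in>S. Poly_Mapping.single i (f i)) * partial_A b j (\<Sum>k\<in>T. Poly_Mapping.single k (g k))"
    for S T f g
    by (simp add: sum_product partial_A_sum single sum.distrib)
  from this [of "Poly_Mapping.lookup p" "Poly_Mapping.keys p" "Poly_Mapping.lookup q" "Poly_Mapping.keys q"]
  show ?thesis by (simp only: xa_poly_expand [symmetric])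
qed

lemma partial_A_const: "partial_A b j (xa_const c) = 0"
  unfolding xa_const_def by (subst partial_A_single) simp

lemma partial_A_Xmat: "partial_A b j (Xmat $ i $ k) = 0"
  by (simp add: Xmat_def partial_A_single lookup_single)

lemma partial_A_Amat: "partial_A b j (Amat $ c $ i) = (if c = b \<and> i = j then 1 else 0)"
  by (auto simp: Amat_def partial_A_single lookup_single)

lemma gl_xa_add: "gl_xa a b m (p + q) = gl_xa a b m p + gl_xa a b m q"
  by (simp add: gl_xa_def partial_A_add distrib_left sum.distrib)

lemma gl_xa_mult: "gl_xa a b m (p * q) = gl_xa a b m p * q + p * gl_xa a b m q"
  by (simp add: gl_xa_def partial_A_mult distrib_left sum.distrib sum_distrib_left sum_distrib_right mult_ac)

lemma gl_xa_Amat: "gl_xa a b m (Amat $ c $ i) = (if c = b then (Amat ** mat_pow Xmat m) $ a $ i else 0)"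
proof -
  have "gl_xa a b m (Amat $ c $ i)
      = (\<Sum>k\<in>UNIV. \<Sum>j\<in>UNIV. if i = j then (if c = b then Amat $ a $ k * mat_pow Xmat m $ k $ j else 0) else 0)"
    unfolding gl_xa_def partial_A_Amat by (intro sum.cong refl) auto
  then show ?thesis by (cases "c = b") (simp_all add: matrix_matrix_mult_def)
qed

lemma glz_xa_integrates:
  fixes e :: "'r::comm_ring_1" and p :: "('N::finite, 'n::finite, 'r) xa_poly"
  assumes "e * e = 0"
  shows "glz_xa (glz_infinitesimal e a b m) p = p + xa_scale e (gl_xa a b m p)"
proof -
  let ?B = "(\<chi> d j. \<Sum>c\<in>UNIV. \<Sum>k\<le>Polynomial.degree (glz_infinitesimal e a b m $ c $ d).
     xa_const (coeff (glz_infinitesimal e a b m $ c $ d) k)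
       * (Amat ** mat_pow Xmat k) $ c $ j) :: ('N, 'n, 'r) xa_poly ^ 'N ^ 'n"
  have e2: "xa_const e * xa_const e = 0"
    using assms by (simp flip: xa_const_mult)
  have B: "?B $ d $ j = Amat $ d $ j + (if d = b then xa_const e * (Amat ** mat_pow Xmat m) $ a $ j else 0)"
    for d j
  proof -
    have "?B $ d $ j = (\<Sum>c\<in>UNIV. (if c = d then Amat $ c $ j else 0)
        + (if c = a then (if d = b then xa_const e * (Amat ** mat_pow Xmat m) $ c $ j else 0) else 0))"
      unfolding vec_lambda_beta
      by (intro sum.cong refl, subst glz_infinitesimal_sum) (auto simp: xa_const_add distrib_right)
    then show ?thesis by (simp add: sum.distrib)
  qed
  have "xa_subst Xmat ?B p = p + xa_const e * gl_xa a b m p"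
  proof (induction p rule: xa_induct)
    case (1 c)
    then show ?case by (simp add: xa_subst_const gl_xa_def partial_A_const)
  next
    case (2 i j)
    then show ?case by (simp add: xa_subst_Xmat gl_xa_def partial_A_Xmat)
  next
    case (3 c i)
    then show ?case unfolding xa_subst_Amat B gl_xa_Amat by simp
  next
    case (4 p q)
    then show ?case by (simp add: xa_subst_add gl_xa_add distrib_left)
  next
    case (5 p q)
    have "xa_const e * (xa_const e * u) = 0" for u :: "('N, 'n, 'r) xa_poly"
      by (simp add: e2 flip: mult.assoc)
    note e2' = this
    show ?case
      unfolding xa_subst_mult 5 gl_xa_mult by (simp add: algebra_simps e2')
  qed
  then show ?thesis by (simp add: glz_xa_def xa_scale_def)
qed

end

(*
  The fermion algebra acts on functions of finite sets of modes, in which psi and psi* become signed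
  insertion and removal of a mode; this shows that the ordered products of psi's applied to the
  vacuum are linearly independent, so the map is well defined by its values on them. The image of
  a product is the determinant of the matrix with rows A^a X^m, and the equivariance statements
  follow because this determinant is multilinear and alternating in its rows.

  Bijectivity is proved by restricting polynomials to diagonal X. The image of a product
  restricts to the antisymmetrisation of the monomial prod_i A^{a_i}_i x_i^{m_i}, and these are
  linearly independent. Conversely, the restriction of a semi-invariant is multilinear in the
  columns of A (invariance under the diagonal torus) and antisymmetric (permutation matrices),
  hence it is a combination of such antisymmetrisations. Finally a semi-invariant is determined by
  its restriction, because the diagonalisable matrices are Zariski dense.
*)

theory Submission
  imports Defs "HOL-Library.Function_Algebras"
begin

section \<open>The Levi-Civita symbol and alternating functions\<close>

text \<open>Because the Fock space is presented by generators and relations, only a representation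
  can show that a vector is nonzero, and a map out of it has to respect the relations. Here they are
  checked once, for the coordinate functions; the map to polynomials is then a sum with the
  coordinates as coefficients. The same formula serves every commutative ring, so the map over an
  algebra is visibly the base change of the complex one. Division is confined to complex scalars: by
  2 for the vanishing of words with a repeated letter, and by N! when antisymmetric polynomials are
  written as antisymmetrisations. From the torus a diagonal matrix with a single entry 1/2 per
  column suffices, since the powers of 2 are distinct and so reveal the degree in that column.
  Density needs neither discriminants nor roots of complex polynomials: a polynomial is zero once it
  vanishes on a product of infinite sets, so a small box of real matrices around diag(0, ..., N - 1)
  is enough, and there the intermediate value theorem supplies the eigenvalues.\<close>

lemma levi_civita_Nil [simp]: "levi_civita [] = 1"
  by (simp add: levi_civita_def)

lemma card_nth_less:
  assumes "distinct w"
  shows "card {l. l < length w \<and> P (w ! l)} = card {y \<in> set w. P y}"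
proof -
  have "{y \<in> set w. P y} = (!) w ` {l. l < length w \<and> P (w ! l)}"
    by (auto simp: in_set_conv_nth)
  moreover have "inj_on ((!) w) {l. l < length w \<and> P (w ! l)}"
    using assms by (auto simp: inj_on_def nth_eq_iff_index_eq)
  ultimately show ?thesis by (simp add: card_image)
qed

text \<open>An inversion of \<open>x # w\<close> either involves position 0, and is then counted by
  an entry of \<open>w\<close> below \<open>x\<close>, or is an inversion of \<open>w\<close>
  shifted by one. This recursion matches both insertion sort and the sign of a creation
  operator.\<close>

lemma levi_civita_Cons:
  "levi_civita (x # w)
     = (if x \<in> set w then 0 else (-1) ^ card {y \<in> set w. y < x} * levi_civita w)"
proof (cases "distinct (x # w)")
  case True
  define I where "I = (\<lambda>w :: 'a list. {(k, l). k < l \<and> l < length w \<and> w ! l < w ! k})"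
  have fin: "finite (I w)" for w
    by (rule finite_subset [of _ "{..<length w} \<times> {..<length w}"]) (auto simp: I_def)
  have "I (x # w) = (\<lambda>l. (0, Suc l)) ` {l. l < length w \<and> w ! l < x} \<union> map_prod Suc Suc ` I w"
    (is "_ = ?A \<union> ?B")
  proof (intro equalityI subsetI)
    fix p assume "p \<in> I (x # w)"
    then obtain k l where "p = (k, l)" "k < l" "l < length (x # w)" "(x # w) ! l < (x # w) ! k"
      by (auto simp: I_def)
    then show "p \<in> ?A \<union> ?B"
      by (cases k; cases l) (auto simp: I_def image_iff)
  qed (auto simp: I_def)
  moreover have "card (?A \<union> ?B) = card ?A + card ?B"
    by (rule card_Un_disjoint) (auto intro: fin)
  moreover have "card ?A = card {y \<in> set w. y < x}"
    using True card_nth_less [of w "\<lambda>y. y < x"]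
    by (subst card_image) (auto simp: inj_on_def)
  moreover have "card ?B = card (I w)"
    by (rule card_image) (auto simp: inj_on_def)
  ultimately have "card (I (x # w)) = card {y \<in> set w. y < x} + card (I w)" by simp
  moreover have "levi_civita v = (-1) ^ card (I v)" if "distinct v" for v
    using that by (simp add: levi_civita_def I_def)
  ultimately show ?thesis
    using True by (simp add: power_add)
qed (auto simp: levi_civita_def)

context module
begin

text \<open>Swaps carry \<open>x\<close> to the right until it meets its copy. The rules are assumed
  only for lists of length \<open>k\<close> because determinants alternate only in full lists of
  rows.\<close>

lemma alternating_repeated:
  assumes swap: "\<And>u x y v. length (u @ x # y # v) = k \<Longrightarrow> F (u @ x # y # v) = - F (u @ y # x # v)"
    and rep: "\<And>u x v. length (u @ x # x # v) = k \<Longrightarrow> F (u @ x # x # v) = (0 :: 'b)"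
    and "x \<in> set w" "length (u @ x # w) = k"
  shows "F (u @ x # w) = 0"
  using assms(3,4)
proof (induction w arbitrary: u)
  case (Cons y w)
  show ?case
  proof (cases "x = y")
    case True
    then show ?thesis using rep Cons.prems by simp
  next
    case False
    then have "F ((u @ [y]) @ x # w) = 0"
      using Cons.prems by (intro Cons.IH) auto
    then show ?thesis using swap [of u x y w] Cons.prems by simp
  qed
qed simp

text \<open>Each smaller entry that \<open>x\<close> passes on its way to its place costs one
  sign.\<close>

lemma alternating_insort:
  assumes swap: "\<And>u x y v. length (u @ x # y # v) = k \<Longrightarrow> F (u @ x # y # v) = - F (u @ y # x # v)"
    and "sorted l" "x \<notin> set l" "distinct l" "length (u @ x # l) = k"
  shows "F (u @ x # l) = scale ((-1) ^ card {y \<in> set l. y < x}) (F (u @ insort x l) :: 'b)"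
  using assms(2-)
proof (induction l arbitrary: u)
  case (Cons y l)
  show ?case
  proof (cases "x \<le> y")
    case True
    then have "{z \<in> set (y # l). z < x} = {}" using Cons.prems by auto
    then have "card {z \<in> set (y # l). z < x} = 0" by (simp only: card.empty)
    moreover have "insort x (y # l) = x # y # l" using True by simp
    ultimately show ?thesis by (simp only: power_0 scale_one)
  next
    case False
    then have "{z \<in> set (y # l). z < x} = insert y {z \<in> set l. z < x}" by auto
    then have c: "card {z \<in> set (y # l). z < x} = Suc (card {z \<in> set l. z < x})"
      using Cons.prems by simp
    have "F (u @ x # y # l) = - F ((u @ [y]) @ x # l)" using swap [of u x y l] Cons.prems by simp
    also have "F ((u @ [y]) @ x # l) = scale ((-1) ^ card {z \<in> set l. z < x}) (F
        ((u @ [y]) @ insort x l))"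
      using Cons.prems by (intro Cons.IH) auto
    finally show ?thesis using False by (simp only: c) simp
  qed
qed simp

text \<open>Insertion sort, with the signs collected by \<open>levi_civita_Cons\<close>. Vanishing
  on repetitions is a separate hypothesis: over a general ring the swap rule yields only 2F =
  0.\<close>

lemma alternating_sort:
  assumes swap: "\<And>u x y v. length (u @ x # y # v) = k \<Longrightarrow> F (u @ x # y # v) = - F (u @ y # x # v)"
    and rep: "\<And>u x v. length (u @ x # x # v) = k \<Longrightarrow> F (u @ x # x # v) = (0 :: 'b)"
    and "length (u @ w) = k"
  shows "F (u @ w) = scale (of_int (levi_civita w)) (F (u @ sorted_list_of_set (set w)))"
  using assms(3)
proof (induction w arbitrary: u)
  case (Cons x w)
  show ?case
  proof (cases "x \<in> set w")
    case True
    then show ?thesis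
      using alternating_repeated [where F = F, OF swap rep] Cons.prems
      by (simp add: levi_civita_Cons)
  next
    case x: False
    have "F (u @ x # w) = F ((u @ [x]) @ w)" by simp
    also have "\<dots> = scale (of_int (levi_civita w)) (F ((u @ [x]) @ sorted_list_of_set (set w)))"
      using Cons.prems by (intro Cons.IH) simp
    also have "\<dots> = scale (of_int (levi_civita (x # w))) (F (u @ sorted_list_of_set (set (x # w))))"
    \<comment> \<open>If \<open>w\<close> has a repetition, its sorted list is shorter than
      \<open>w\<close>, so the hypotheses on \<open>F\<close> do not reach it; both signs are then
      0.\<close>
    proof (cases "distinct w")
      case True
      then have "length (u @ x # sorted_list_of_set (set w)) = k"
        using Cons.prems by (simp add: distinct_card)
      then have "F (u @ x # sorted_list_of_set (set w))
          = scale ((-1) ^ card {y \<in> set (sorted_list_of_set (set w)). y < x})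
              (F (u @ insort x (sorted_list_of_set (set w))))"
        using x by (intro alternating_insort [where F = F and k = k]) (auto intro: swap)
      then show ?thesis
        using x by (simp add: levi_civita_Cons mult.commute)
    qed (simp add: levi_civita_def)
    finally show ?thesis .
  qed
qed simp

end

section \<open>Coordinates on the Fock space\<close>

text \<open>The type \<open>'n\<close> carries no order, whereas the signs require a total order of
  the modes with finite initial segments. An enumeration by the natural numbers supplies
  one.\<close>

definition mode_index :: "'n::finite \<times> nat \<Rightarrow> nat" where
  "mode_index = to_nat_on UNIV"

definition mode :: "nat \<Rightarrow> 'n::finite \<times> nat" where
  "mode = from_nat_into UNIV"

lemma infinite_modes: "infinite (UNIV :: ('n::finite \<times> nat) set)"
  by (simp add: finite_prod)

lemma mode_mode_index [simp]: "mode (mode_index x) = x"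
  by (simp add: mode_def mode_index_def)

lemma mode_index_mode [simp]: "mode_index (mode i :: 'n::finite \<times> nat) = i"
  unfolding mode_def mode_index_def
  by (rule to_nat_on_from_nat_into_infinite) (simp_all add: infinite_modes)

lemma mode_eq_iff [simp]: "mode i = mode j \<longleftrightarrow> i = j"
  by (metis mode_index_mode)

lemma map_mode_index: "map mode (map mode_index w) = w"
  by (simp add: comp_def)

section \<open>Signed insertion and removal of modes\<close>

text \<open>The sign of moving a new factor i from the front to its place in an increasing product.
  Only finitely many modes lie below \<open>i\<close>, so this makes sense even for infinite
  \<open>S\<close>, and the operators below act on functions of arbitrary sets.\<close>

definition fermi_sign :: "nat \<Rightarrow> nat set \<Rightarrow> 'r::comm_ring_1" where
  "fermi_sign i S = (-1) ^ card {j \<in> S. j < i}"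

lemma fermi_sign_insert:
  "k \<notin> S \<Longrightarrow> fermi_sign i (insert k S) = (if k < i then - fermi_sign i S else fermi_sign i S)"
proof -
  assume "k \<notin> S"
  moreover have "{j. (j = k \<or> j \<in> S) \<and> j < i}
      = (if k < i then insert k {j \<in> S. j < i} else {j \<in> S. j < i})"
    by auto
  ultimately show ?thesis by (simp add: fermi_sign_def)
qed

lemma fermi_sign_remove:
  "k \<in> S \<Longrightarrow> fermi_sign i (S - {k}) = (if k < i then - fermi_sign i S else fermi_sign i S)"
  using fermi_sign_insert [of k "S - {k}" i, where 'a = 'a]
  by (metis Diff_iff insertI1 insert_Diff minus_minus)

lemma fermi_sign_square: "fermi_sign i S * fermi_sign i S = 1"
  by (simp add: fermi_sign_def flip: power_mult_distrib)

lemma fermi_sign_square': "fermi_sign i S * (fermi_sign i S * c) = c"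
  by (simp add: fermi_sign_square flip: mult.assoc)

text \<open>Dual form of insertion: the coefficient at \<open>S\<close> of the product of mode
  \<open>i\<close> with a vector comes from the coefficient at \<open>S - {i}\<close>.\<close>

definition wedge :: "nat \<Rightarrow> (nat set \<Rightarrow> 'r::comm_ring_1) \<Rightarrow> nat set \<Rightarrow> 'r" where
  "wedge i F S = (if i \<in> S then fermi_sign i S * F (S - {i}) else 0)"

definition contract :: "nat \<Rightarrow> (nat set \<Rightarrow> 'r::comm_ring_1) \<Rightarrow> nat set \<Rightarrow> 'r" where
  "contract i F S = (if i \<in> S then 0 else fermi_sign i S * F (insert i S))"

text \<open>For distinct modes, removing the smaller one flips the sign of the larger but not
  conversely, so the two orders differ by a sign. For equal modes both terms vanish.\<close>

lemma wedge_wedge: "wedge i (wedge j F) S + wedge j (wedge i F) S = 0"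
proof -
  have "S - {j} - {i} = S - {i} - {j}" by auto
  then show ?thesis
    by (cases i j rule: linorder_cases) (auto simp: wedge_def fermi_sign_remove)
qed

lemma contract_contract: "contract i (contract j F) S + contract j (contract i F) S = 0"
  by (cases i j rule: linorder_cases)
     (auto simp: contract_def fermi_sign_insert insert_commute)

text \<open>For equal modes exactly one of the two terms survives, according to whether the mode is
  occupied, and its sign occurs squared. For distinct modes the terms cancel.\<close>

lemma wedge_contract:
  "wedge i (contract j F) S + contract j (wedge i F) S = (if i = j then F S else 0)"
proof (cases i j rule: linorder_cases)
  case equal
  then show ?thesis
    by (auto simp: wedge_def contract_def fermi_sign_remove fermi_sign_insert
        fermi_sign_square' insert_absorb)
qed (auto simp: wedge_def contract_def fermi_sign_remove fermi_sign_insert insert_Diff_if)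

lemma contract_wedge:
  "contract i (wedge j F) S + wedge j (contract i F) S = (if i = j then F S else 0)"
  using wedge_contract [of j i F S] by (simp add: add.commute eq_commute)

fun clifford :: "'n::finite fermion \<Rightarrow> (nat set \<Rightarrow> 'r::comm_ring_1) \<Rightarrow> nat set \<Rightarrow> 'r" where
  "clifford (Psi a m) = wedge (mode_index (a, m))"
| "clifford (PsiStar a m) = contract (mode_index (a, m))"

lemma mode_index_eq_iff: "mode_index x = mode_index y \<longleftrightarrow> x = y"
  by (metis mode_mode_index)

definition fun_scale :: "'r::comm_ring_1 \<Rightarrow> ('s \<Rightarrow> 'r) \<Rightarrow> 's \<Rightarrow> 'r" where
  "fun_scale c F = (\<lambda>S. c * F S)"

text \<open>The vacuum becomes the indicator of the empty set; contraction evaluates it at nonempty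
  sets only and hence kills it.\<close>

interpretation coords: fock_rep fun_scale clifford "\<lambda>S. if S = {} then 1 else 0"
proof unfold_locales
  fix x y :: "'n::finite fermion" and F :: "nat set \<Rightarrow> 'r::comm_ring_1"
  have "clifford x (clifford y F) S + clifford y (clifford x F) S = anticomm x y * F S" for S
    by (cases x; cases y)
       (auto simp: wedge_wedge contract_contract wedge_contract contract_wedge
          mode_index_eq_iff)
  then show "clifford x (clifford y F) + clifford y (clifford x F) = fun_scale (anticomm x y) F"
    by (auto simp: fun_scale_def)
next
  fix x :: "'n::finite fermion" and F G :: "nat set \<Rightarrow> 'r::comm_ring_1" and c :: 'r
  show "clifford x (F + G) = clifford x F + clifford x G"
    by (cases x) (auto simp: wedge_def contract_def fun_eq_iff distrib_left)
  show "clifford x (fun_scale c F) = fun_scale c (clifford x F)"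
    by (cases x) (auto simp: wedge_def contract_def fun_eq_iff fun_scale_def)
qed (auto simp: fun_scale_def contract_def fun_eq_iff algebra_simps)

text \<open>
  The coordinates of a Fock vector are indexed by the sets of occupied modes. Their existence
  shows that the vectors \<open>\<psi>_{i\<^sub>1} \<dots> \<psi>_{i\<^sub>k} |\<emptyset>\<rangle>\<close>, \<open>i\<^sub>1 < \<dots> < i\<^sub>k\<close>, are linearly independent.
\<close>

definition coords :: "('n::finite, 'r::comm_ring_1) fock \<Rightarrow> nat set \<Rightarrow> 'r" where
  "coords = fock_rec fun_scale clifford (\<lambda>S. if S = {} then 1 else 0)"

lemma coords_op: "coords (fock_op x v) = clifford x (coords v)"
  unfolding coords_def by (rule coords.fock_rec_op)

lemma coords_vac: "coords vac = (\<lambda>S. if S = {} then 1 else 0)"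
  unfolding coords_def by (rule coords.fock_rec_vac)

lemma coords_add: "coords (v + w) S = coords v S + coords w S"
  unfolding coords_def by (simp add: coords.fock_rec_add)

lemma coords_scale: "coords (fock_scale c v) S = c * coords v S"
  unfolding coords_def by (simp add: coords.fock_rec_scale fun_scale_def)

text \<open>Prepending \<open>i\<close> multiplies by the sign counting the entries of
  \<open>l\<close> below \<open>i\<close>, which is the factor in
  \<open>levi_civita_Cons\<close>.\<close>

lemma coords_psi_word:
  "coords (psi_word (map mode l) :: ('n::finite, 'r::comm_ring_1) fock) S = (if S
      = set l then of_int (levi_civita l) else 0)"
proof (induction l arbitrary: S)
  case (Cons i l)
  obtain a m where am: "mode i = (a :: 'n, m)" by fastforce
  then have "mode_index (a, m) = i" by (metis mode_index_mode)
  then have "coords (psi_word (map mode (i # l)) :: ('n, 'r) fock) S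
      = wedge i (coords (psi_word (map mode l) :: ('n, 'r) fock)) S"
    by (simp add: am psi_word_Cons coords_op)
  also have "\<dots> = (if S = set (i # l) then of_int (levi_civita (i # l)) else 0)"
  proof (cases "i \<in> S \<and> S - {i} = set l")
    case True
    then have "S = insert i (set l)" "i \<notin> set l" by auto
    moreover from this have "fermi_sign i S = (fermi_sign i (set l) :: 'r)"
      by (simp add: fermi_sign_insert)
    ultimately show ?thesis
      using True by (simp add: wedge_def Cons levi_civita_Cons fermi_sign_def)
  next
    case False
    then show ?thesis by (auto simp: wedge_def Cons levi_civita_Cons)
  qed
  finally show ?case .
qed (simp add: psi_word_Nil coords_vac)

text \<open>Each generator changes the occupied set by a single mode, so finiteness of the support
  is inherited. It makes the sum in \<open>coord_sum\<close> meaningful.\<close>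

lemma finite_coords: "finite {S. coords v S \<noteq> 0}"
proof (induction v rule: fock_induct)
  case 1
  then show ?case by (simp add: coords_vac)
next
  case (2 x v)
  obtain a m where x: "x = Psi a m \<or> x = PsiStar a m" by (cases x) auto
  let ?i = "mode_index (a, m)"
  have "{S. coords (fock_op x v) S \<noteq> 0}
      \<subseteq> insert ?i ` {S. coords v S \<noteq> 0} \<union> (\<lambda>S. S - {?i}) ` {S. coords v S \<noteq> 0}"
  proof
    fix S assume "S \<in> {S. coords (fock_op x v) S \<noteq> 0}"
    then have "(?i \<in> S \<and> coords v (S - {?i}) \<noteq> 0) \<or> (?i \<notin> S \<and> coords v (insert ?i S) \<noteq> 0)"
      using x by (auto simp: coords_op wedge_def contract_def split: if_splits)
    then show "S \<in> insert ?i ` {S. coords v S \<noteq> 0} \<union> (\<lambda>S. S - {?i}) ` {S. coords v S \<noteq> 0}"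
    proof
      assume "?i \<in> S \<and> coords v (S - {?i}) \<noteq> 0"
      then have "S = insert ?i (S - {?i})" "S - {?i} \<in> {S. coords v S \<noteq> 0}" by auto
      then show ?thesis by blast
    next
      assume "?i \<notin> S \<and> coords v (insert ?i S) \<noteq> 0"
      then have "S = insert ?i S - {?i}" "insert ?i S \<in> {S. coords v S \<noteq> 0}" by auto
      then show ?thesis by blast
    qed
  qed
  then show ?case by (rule finite_subset) (use 2 in simp)
next
  case (3 v w)
  have "{S. coords (v + w) S \<noteq> 0} \<subseteq> {S. coords v S \<noteq> 0} \<union> {S. coords w S \<noteq> 0}"
    by (auto simp: coords_add)
  then show ?case by (rule finite_subset) (use 3 in simp)
next
  case (4 c v)
  have "{S. coords (fock_scale c v) S \<noteq> 0} \<subseteq> {S. coords v S \<noteq> 0}"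
    by (auto simp: coords_scale)
  then show ?case by (rule finite_subset) (use 4 in simp)
qed

section \<open>Linear maps prescribed on increasing products\<close>

text \<open>The linear map taking the increasing product with occupied set \<open>S\<close> to
  \<open>b S\<close>. It is well defined and linear on the whole Fock space because the coordinates
  are.\<close>

definition coord_sum ::
    "('r::comm_ring_1 \<Rightarrow> 'm \<Rightarrow> 'm) \<Rightarrow> (nat set \<Rightarrow> 'm) \<Rightarrow> ('n::finite, 'r) fock \<Rightarrow> 'm::ab_group_add" where
  "coord_sum s b v = (\<Sum>S\<in>{S. coords v S \<noteq> 0}. s (coords v S) (b S))"

context module
begin

lemma coord_sum_superset:
  assumes "finite T" "\<And>S. coords v S \<noteq> 0 \<Longrightarrow> S \<in> T"
  shows "coord_sum scale b v = (\<Sum>S\<in>T. scale (coords v S) (b S))"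
  unfolding coord_sum_def using assms by (intro sum.mono_neutral_left) auto

lemma coord_sum_hom: "module_hom fock_scale scale (coord_sum scale b)"
proof unfold_locales
  fix v w :: "('n::finite, 'a) fock" and c
  let ?T = "{S. coords v S \<noteq> 0} \<union> {S. coords w S \<noteq> 0}"
  have fin: "finite ?T" using finite_coords by blast
  have "coord_sum scale b u = (\<Sum>S\<in>?T. scale (coords u S) (b S))"
    if "u \<in> {v, w, v + w, fock_scale c v}" for u
    using that by (intro coord_sum_superset fin) (auto simp: coords_add coords_scale)
  then show "coord_sum scale b (v + w) = coord_sum scale b v + coord_sum scale b w"
    and "coord_sum scale b (fock_scale c v) = scale c (coord_sum scale b v)"
    by (simp_all add: coords_add coords_scale scale_left_distrib sum.distrib scale_sum_right)
qed

lemma coord_sum_psi_word: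
  "coord_sum scale b (psi_word (map mode l)) = scale (of_int (levi_civita l)) (b (set l))"
  by (subst coord_sum_superset [of "{set l}"]) (auto simp: coords_psi_word split: if_splits)

end

lemma psi_word_swap:
  "psi_word (u @ x # y # v) = - (psi_word (u @ y # x # v) :: ('n, 'r::comm_ring_1) fock)"
proof -
  have "psi_word (u @ x # y # v) + psi_word (u @ y # x # v) = (0 :: ('n, 'r) fock)"
  proof (induction u)
    case Nil
    obtain a m b k where xy: "x = (a, m)" "y = (b, k)" by (cases x, cases y)
    show ?case
      using fock_op_anticomm [of "Psi a m" "Psi b k" "psi_word v :: ('n, 'r) fock"]
      unfolding xy append_Nil psi_word_Cons anticomm.simps fock.scale_zero_left .
  next
    case (Cons z u)
    obtain a m where z: "z = (a, m)" by (cases z)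
    have "psi_word ((z # u) @ x # y # v) + psi_word ((z # u) @ y # x # v)
        = fock_op (Psi a m) (psi_word (u @ x # y # v) + psi_word (u @ y # x # v) :: ('n, 'r) fock)"
      unfolding z append_Cons psi_word_Cons fock_op.add ..
    also have "\<dots> = 0" unfolding Cons.IH by (rule fock_op.zero)
    finally show ?case .
  qed
  then show ?thesis by (rule eq_neg_iff_add_eq_0 [THEN iffD2])
qed

text \<open>The relation {x, x} = 0 only says that twice the vector vanishes; complex scalars allow
  division by 2.\<close>

lemma psi_word_repeat:
  fixes v :: "('n \<times> nat) list"
  shows "psi_word (u @ x # x # v) = (0 :: ('n, complex) fock)"
proof -
  have "psi_word (u @ x # x # v) + psi_word (u @ x # x # v) = (0 :: ('n, complex) fock)"
    by (rule psi_word_swap [of u x x v, unfolded eq_neg_iff_add_eq_0])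
  then have "fock_scale (1/2) (fock_scale 2 (psi_word (u @ x # x # v))) = (0 :: ('n, complex) fock)"
    by (metis fock.scale_left_distrib fock.scale_one fock.scale_zero_right one_add_one)
  then show ?thesis by simp
qed

lemma fock_N_hom_eqI:
  assumes f: "module_hom fock_scale s f" and g: "module_hom fock_scale s g"
    and eq: "\<And>w. length w = N \<Longrightarrow> f (psi_word w) = g (psi_word w)"
    and v: "v \<in> fock_N N"
  shows "f v = g v"
proof -
  interpret f: module_hom fock_scale s f by (rule f)
  interpret module_pair fock_scale s ..
  show ?thesis
    by (rule module_hom_eq_on_span [OF f g _ v [unfolded fock_N_def]]) (use eq in blast)
qed

text \<open>The increasing products span: a word is its sorted word times the Levi-Civita sign,
  which is also its coordinate. Consequently a vector of \<open>fock_N N\<close> all of whose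
  coordinates vanish is 0.\<close>

lemma coord_sum_psi:
  fixes v :: "('n::finite, complex) fock"
  assumes "v \<in> fock_N N"
  shows "coord_sum fock_scale (\<lambda>S. psi_word (map mode (sorted_list_of_set S))) v = v"
proof -
  let ?C = "coord_sum fock_scale (\<lambda>S. psi_word (map mode (sorted_list_of_set S)))
    :: ('n, complex) fock \<Rightarrow> ('n, complex) fock"
  have "psi_word (map mode ([] @ l)) = fock_scale (of_int (levi_civita l))
      (psi_word (map mode ([] @ sorted_list_of_set (set l))) :: ('n, complex) fock)" for l
    by (rule fock.alternating_sort [where F = "\<lambda>l. psi_word (map mode l)" and u = "[]" and w = l
          and k = "length l"])
       (unfold map_append list.map, rule psi_word_swap, rule psi_word_repeat, simp)
  then have C_mode: "?C (psi_word (map mode l)) = psi_word (map mode l)" for l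
    unfolding fock.coord_sum_psi_word append_Nil by (rule sym)
  have C_psi: "?C (psi_word w) = psi_word w" for w
    using C_mode [of "map mode_index w"] by (simp only: map_mode_index)
  show ?thesis
    by (rule fock_N_hom_eqI [OF fock.coord_sum_hom fock.module_hom_ident C_psi assms])
qed

section \<open>Determinants of lists of rows\<close>

text \<open>The zero-based rank, which translates between matrix rows indexed by \<open>'N\<close>
  and list positions.\<close>

definition index_of :: "'N::{finite,linorder} \<Rightarrow> nat" where
  "index_of i = card {j. j < i}"

lemma index_of_less_iff [simp]: "index_of (i :: 'N::{finite,linorder}) < index_of j \<longleftrightarrow> i < j"
proof -
  have "index_of i < index_of j" if "i < j" for i j :: 'N
    unfolding index_of_def using that by (intro psubset_card_mono) auto
  then show ?thesis by (metis less_asym neqE)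
qed

lemma index_of_eq_iff [simp]: "index_of i = index_of j \<longleftrightarrow> i = j"
  by (metis index_of_less_iff less_irrefl linorder_neqE)

lemma index_of_bound [simp]: "index_of (i :: 'N::{finite,linorder}) < CARD('N)"
  unfolding index_of_def by (intro psubset_card_mono) auto

lemma bij_index_of: "bij_betw (index_of :: 'N \<Rightarrow> nat) UNIV {..<CARD('N::{finite,linorder})}"
proof -
  have "inj (index_of :: 'N \<Rightarrow> nat)" by (simp add: inj_def)
  moreover from this have "card (range (index_of :: 'N \<Rightarrow> nat)) = card {..<CARD('N)}"
    by (simp add: card_image)
  then have "range (index_of :: 'N \<Rightarrow> nat) = {..<CARD('N)}"
    by (intro card_subset_eq) auto
  ultimately show ?thesis by (simp add: bij_betw_def)
qed

lemma obtain_index: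
  fixes k :: nat
  assumes "k < CARD('N::{finite,linorder})"
  obtains i :: "'N::{finite,linorder}" where "index_of i = k"
  using assms bij_index_of [where 'N = 'N] 
  by (metis bij_betw_imp_surj_on imageE lessThan_iff)

lemma nth_sorted_UNIV: "sorted_list_of_set UNIV ! index_of i = (i :: 'N::{finite,linorder})"
proof -
  let ?l = "sorted_list_of_set UNIV :: 'N list"
  have strict: "sorted_wrt (<) ?l" by simp
  obtain k where k: "k < length ?l" "?l ! k = i"
    by (metis finite_class.finite_UNIV in_set_conv_nth set_sorted_list_of_set UNIV_I)
  have less: "?l ! j < ?l ! k \<longleftrightarrow> j < k" if "j < length ?l" for j
    using that k(1) sorted_wrt_nth_less [OF strict]
        by (metis less_asym less_irrefl linorder_neqE_nat)
  have "index_of i = card {j. j < length ?l \<and> ?l ! j < i}"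
    using card_nth_less [of ?l "\<lambda>j. j < i"] by (simp add: index_of_def)
  also have "{j. j < length ?l \<and> ?l ! j < i} = {..<k}"
    using less k by auto
  finally show ?thesis using k by simp
qed

definition row_det :: "('a::comm_ring_1 ^ 'N::{finite,linorder}) list \<Rightarrow> 'a" where
  "row_det vs = det (\<chi> i. vs ! index_of i)"

text \<open>Isolates one row in the form expected by \<open>det_row_add\<close> and
  \<open>det_row_mul\<close>; the 0 is a placeholder that is never read.\<close>

lemma row_det_at:
  assumes "index_of i0 = length u"
  shows "row_det (u @ x # v) = det (\<chi> i. if i = i0 then x else (u @ 0 # v) ! index_of i)"
proof -
  have "(u @ x # v) ! index_of i = (if i = i0 then x else (u @ 0 # v) ! index_of i)" for i
    using index_of_eq_iff [of i i0] assms
    by (cases "index_of i" "length u" rule: linorder_cases)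
       (auto simp: nth_append nth_Cons' simp del: index_of_eq_iff)
  then show ?thesis by (simp add: row_det_def)
qed

lemma row_det_add:
  fixes x y :: "'a::comm_ring_1 ^ 'N::{finite,linorder}"
  assumes "length u < CARD('N)"
  shows "row_det (u @ (x + y) # v) = row_det (u @ x # v) + row_det (u @ y # v)"
proof -
  obtain i0 :: 'N where "index_of i0 = length u" using assms by (rule obtain_index)
  then show ?thesis by (simp only: row_det_at det_row_add)
qed

lemma row_det_scale:
  fixes x :: "'a::comm_ring_1 ^ 'N::{finite,linorder}"
  assumes "length u < CARD('N)"
  shows "row_det (u @ (c *s x) # v) = c * row_det (u @ x # v)"
proof -
  obtain i0 :: 'N where "index_of i0 = length u" using assms by (rule obtain_index)
  then show ?thesis by (simp only: row_det_at det_row_mul)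
qed

lemma row_det_sum:
  fixes x :: "'i \<Rightarrow> 'a::comm_ring_1 ^ 'N::{finite,linorder}"
  assumes "length u < CARD('N)"
  shows "row_det (u @ (\<Sum>t\<in>T. c t *s x t) # v) = (\<Sum>t\<in>T. c t * row_det (u @ x t # v))"
proof (induction T rule: infinite_finite_induct)
  case (insert t T)
  then show ?case by (simp add: row_det_add row_det_scale assms)
qed (use row_det_scale [OF assms, of 0 0 v] in simp_all)

lemma row_det_repeat:
  fixes x :: "'a::comm_ring_1 ^ 'N::{finite,linorder}"
  assumes "length (u @ x # x # v) = CARD('N)"
  shows "row_det (u @ x # x # v) = 0"
proof -
  have len: "length u < CARD('N)" "Suc (length u) < CARD('N)" using assms by auto
  obtain i :: 'N where i: "index_of i = length u" using len(1) by (rule obtain_index)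
  obtain j :: 'N where j: "index_of j = Suc (length u)" using len(2) by (rule obtain_index)
  have "i \<noteq> j" using i j by auto
  moreover have "(u @ x # x # v) ! index_of i = (u @ x # x # v) ! index_of j"
    unfolding i j by (simp add: nth_append)
  ultimately show ?thesis
    unfolding row_det_def by (intro det_identical_rows [of i j]) (simp_all add: row_def)
qed

text \<open>Polarisation: the determinant with x + y in both rows vanishes, and so do two of the
  four terms of its expansion.\<close>

lemma row_det_swap:
  fixes x y :: "'a::comm_ring_1 ^ 'N::{finite,linorder}"
  assumes "length (u @ x # y # v) = CARD('N)"
  shows "row_det (u @ x # y # v) = - row_det (u @ y # x # v)"
proof -
  have len: "length u < CARD('N)" "length (u @ [z]) < CARD('N)" for z :: "('a, 'N) vec"
    using assms by auto
  have "0 = row_det (u @ (x + y) # (x + y) # v)"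
    using assms by (intro row_det_repeat [symmetric]) simp
  also have "\<dots> = row_det ((u @ [x]) @ (x + y) # v) + row_det ((u @ [y]) @ (x + y) # v)"
    by (simp add: row_det_add len(1))
  also have "\<dots> = row_det (u @ x # x # v) + row_det (u @ x # y # v)
      + (row_det (u @ y # x # v) + row_det (u @ y # y # v))"
    unfolding row_det_add [OF len(2)] by simp
  also have "\<dots> = row_det (u @ x # y # v) + row_det (u @ y # x # v)"
    using assms by (simp add: row_det_repeat)
  finally show ?thesis by (simp add: eq_neg_iff_add_eq_0)
qed

section \<open>The Levi-Civita symbol and the Leibniz expansion\<close>

text \<open>The determinant of a list of unit vectors is alternating, so sorting the list produces
  the Levi-Civita sign; the sorted full list gives the identity matrix.\<close>

lemma levi_civita_permutation:
  fixes "is" :: "'N::{finite,linorder} list"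
  assumes "length is = CARD('N)"
  shows "levi_civita is = det (\<chi> i. axis (is ! index_of i) 1 :: ((int, 'N) vec, 'N) vec)"
proof -
  interpret module "(*) :: int \<Rightarrow> int \<Rightarrow> int"
    by unfold_locales (simp_all add: algebra_simps)
  let ?F = "\<lambda>is :: 'N list. row_det (map (\<lambda>j. axis j 1 :: (int, 'N) vec) is)"
  have sort: "?F ([] @ is) = of_int (levi_civita is) * ?F ([] @ sorted_list_of_set (set is))"
    by (rule alternating_sort [where F = ?F and u = "[]" and w = "is" and k = "CARD('N)"];
        (unfold map_append list.map)?, (rule row_det_swap row_det_repeat)?) (simp_all add: assms)
  have expand: "?F js = det (\<chi> i. axis (js ! index_of i) 1 :: ((int, 'N) vec, 'N) vec)"
    if "length js = CARD('N)" for js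
    using that by (simp add: row_det_def)
  show ?thesis
  proof (cases "distinct is")
    case True
    then have UNIV: "set is = UNIV"
      using assms by (metis card_eq_UNIV_imp_eq_UNIV distinct_card finite_class.finite_UNIV)
    have "(\<chi> i. axis i 1 :: ((int, 'N) vec, 'N) vec) = mat 1"
      by (simp add: vec_eq_iff axis_def mat_def)
    then have "?F (sorted_list_of_set UNIV) = 1"
      by (simp add: expand nth_sorted_UNIV)
    then show ?thesis using sort by (simp add: UNIV expand assms)
  next
    case False
    then have "levi_civita is = 0" by (simp add: levi_civita_def)
    then show ?thesis using sort by (simp add: expand assms)
  qed
qed

text \<open>The Leibniz formula, with a permutation encoded by its list of values. Lists with
  repetitions may be added because their symbol is 0.\<close>

lemma row_det_expand:
  fixes vs :: "('a::comm_ring_1 ^ 'N::{finite,linorder}) list"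
  shows "row_det vs = (\<Sum>is\<in>{is :: 'N list. length is = CARD('N)}.
     of_int (levi_civita is) * (\<Prod>k<CARD('N). vs ! k $ (is ! k)))"
proof -
  let ?L = "sorted_list_of_set UNIV :: 'N list"
  let ?D = "{is :: 'N list. length is = CARD('N) \<and> distinct is}"
  have len: "length ?L = CARD('N)" by simp
  have nth_map: "map p ?L ! index_of i = p i" for p :: "'N \<Rightarrow> 'N" and i
    by (simp add: nth_sorted_UNIV)
  have sign: "levi_civita (map p ?L) = sign p" if "p permutes UNIV" for p
  proof -
    have "(\<chi> i. axis (p i) 1 :: ((int, 'N) vec, 'N) vec)
        = (\<chi> i. (mat 1 :: ((int, 'N) vec, 'N) vec) $ p i)"
      by (simp add: vec_eq_iff axis_def mat_def)
    then show ?thesis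
      using levi_civita_permutation [of "map p ?L"] det_permute_rows [OF that, of "mat 1
          :: ((int, 'N) vec, 'N) vec"]
      by (simp add: nth_map del: nth_map) (simp add: nth_sorted_UNIV)
  qed
  have "row_det vs = (\<Sum>p\<in>{p. p permutes UNIV}. of_int (sign p) * (\<Prod>i\<in>UNIV. vs ! index_of i $ p i))"
    by (simp add: row_det_def det_def)
  also have "\<dots> = (\<Sum>is\<in>?D. of_int (levi_civita is) * (\<Prod>k<CARD('N). vs ! k $ (is ! k)))"
  proof (rule sum.reindex_bij_witness [where j = "\<lambda>p. map p ?L" and i = "\<lambda>is i. is ! index_of i"])
    fix p :: "'N \<Rightarrow> 'N" assume "p \<in> {p. p permutes UNIV}"
    then have p: "p permutes UNIV" by simp
    show "(\<lambda>i. map p ?L ! index_of i) = p" by (simp only: nth_map)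
    show "map p ?L \<in> ?D"
      using permutes_inj [OF p] by (auto simp: distinct_map intro: inj_on_subset)
    have "(\<Prod>k<CARD('N). vs ! k $ (map p ?L ! k)) = (\<Prod>i\<in>UNIV. vs ! index_of i $ p i)"
      by (subst prod.reindex_bij_betw [OF bij_index_of, symmetric]) (simp only: nth_map)
    then show "of_int (levi_civita (map p ?L)) * (\<Prod>k<CARD('N). vs ! k $ (map p ?L ! k))
        = of_int (sign p) * (\<Prod>i\<in>UNIV. vs ! index_of i $ p i)"
      by (simp only: sign [OF p])
  next
    fix js :: "'N list" assume js: "js \<in> ?D"
    show "map (\<lambda>i. js ! index_of i) ?L = js"
    proof (rule nth_equalityI)
      fix k assume "k < length (map (\<lambda>i. js ! index_of i) ?L)"
      then have "k < CARD('N)" by simp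
      then obtain i :: 'N where "index_of i = k" by (rule obtain_index)
      then show "map (\<lambda>i. js ! index_of i) ?L ! k = js ! k"
        using nth_map [of "\<lambda>i. js ! index_of i" i] by simp
    qed (use js in simp)
    have "inj (\<lambda>i :: 'N. js ! index_of i)"
      using js by (auto simp: inj_def nth_eq_iff_index_eq)
    then show "(\<lambda>i. js ! index_of i) \<in> {p. p permutes UNIV}"
      by (auto intro!: bij_imp_permutes simp: bij_betw_def finite_UNIV_inj_surj)
  qed
  also have "\<dots> = (\<Sum>is\<in>{is :: 'N list. length is = CARD('N)}.
      of_int (levi_civita is) * (\<Prod>k<CARD('N). vs ! k $ (is ! k)))"
  proof (rule sum.mono_neutral_left)
    show "finite {is :: 'N list. length is = CARD('N)}"
      using finite_lists_length_eq [of "UNIV :: 'N set" "CARD('N)"] by simp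
  qed (auto simp: levi_civita_def)
  finally show ?thesis .
qed

section \<open>Determinants under homomorphisms, matrix products and derivations\<close>

lemma det_hom:
  assumes add: "\<And>x y. \<phi> (x + y) = \<phi> x + \<phi> y" and mult: "\<And>x y. \<phi> (x * y) = \<phi> x * \<phi> y"
    and one: "\<phi> 1 = 1"
  shows "\<phi> (det (A :: 'a::comm_ring_1 ^ 'N ^ 'N)) = (det (\<chi> i j. \<phi> (A $ i $ j)) :: 'b::comm_ring_1)"
proof -
  have zero: "\<phi> 0 = 0" using add [of 0 0] by simp
  have neg: "\<phi> (- x) = - \<phi> x" for x
    using add [of x "- x"] by (simp add: zero eq_neg_iff_add_eq_0 add.commute)
  have sum: "\<phi> (sum f T) = (\<Sum>i\<in>T. \<phi> (f i))" for T and f :: "('N \<Rightarrow> 'N) \<Rightarrow> 'a"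
    by (induction T rule: infinite_finite_induct) (auto simp: zero add)
  have prod: "\<phi> (prod f T) = (\<Prod>i\<in>T. \<phi> (f i))" for T and f :: "'N \<Rightarrow> 'a"
    by (induction T rule: infinite_finite_induct) (auto simp: one mult)
  have sign: "\<phi> (of_int (sign p)) = of_int (sign p)" for p :: "'N \<Rightarrow> 'N"
    by (simp add: sign_def one neg)
  show ?thesis by (simp add: det_def sum mult sign prod)
qed

lemma row_det_hom:
  fixes vs :: "('a::comm_ring_1 ^ 'N::{finite,linorder}) list"
  assumes "\<And>x y. \<phi> (x + y) = \<phi> x + \<phi> y" "\<And>x y. \<phi> (x * y) = \<phi> x * \<phi> y" "\<phi> 1 = 1"
    and "length vs = CARD('N)"
  shows "\<phi> (row_det vs) = (row_det (map (\<lambda>v. \<chi> j. \<phi> (v $ j)) vs) :: 'b::comm_ring_1)"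
  using assms(4) by (simp add: row_det_def det_hom [of \<phi>, OF assms(1-3)])

lemma row_det_rows_scale:
  fixes f :: "'x \<Rightarrow> 'a::comm_ring_1 ^ 'N::{finite,linorder}"
  assumes "length w = CARD('N)"
  shows "row_det (map (\<lambda>x. c x *s f x) w) = prod_list (map c w) * row_det (map f w)"
proof -
  have "prod_list (map c w) = (\<Prod>k<CARD('N). c (w ! k))"
    using assms by (simp add: prod.list_conv_set_nth atLeast0LessThan)
  also have "\<dots> = (\<Prod>i\<in>UNIV. c (w ! index_of (i :: 'N)))"
    by (rule prod.reindex_bij_betw [OF bij_index_of, symmetric])
  finally show ?thesis
    using assms by (simp add: row_det_def det_rows_mul)
qed

lemma row_det_mult:
  fixes f :: "'x \<Rightarrow> 'a::comm_ring_1 ^ 'N::{finite,linorder}"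
  assumes "length w = CARD('N)"
  shows "row_det (map (\<lambda>x. f x v* G) w) = row_det (map f w) * det G"
proof -
  have "(\<chi> i :: 'N. f (w ! index_of i) v* G) = (\<chi> i :: 'N. f (w ! index_of i)) ** G"
    by (simp add: vec_eq_iff matrix_matrix_mult_def vector_matrix_mult_def mult.commute)
  then show ?thesis
    using assms by (simp add: row_det_def det_mul)
qed

text \<open>A derivation differentiates one factor of each Leibniz term at a time and kills the
  signs; exchanging the sums groups the terms by the differentiated row.\<close>

lemma det_derivation:
  assumes add: "\<And>x y. D (x + y) = D x + D y" and mult: "\<And>x y. D (x * y) = D x * y + x * D y"
  shows "D (det (A :: 'a::comm_ring_1 ^ 'N ^ 'N))
    = (\<Sum>k\<in>UNIV. det (\<chi> i. if i = k then (\<chi> j. D (A $ i $ j)) else A $ i))"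
proof -
  have zero: "D 0 = 0" using add [of 0 0] by simp
  have one: "D 1 = 0" using mult [of 1 1] by simp
  have neg: "D (- x) = - D x" for x
    using add [of x "- x"] by (simp add: zero eq_neg_iff_add_eq_0 add.commute)
  have sum: "D (sum f T) = (\<Sum>i\<in>T. D (f i))" for T and f :: "('N \<Rightarrow> 'N) \<Rightarrow> 'a"
    by (induction T rule: infinite_finite_induct) (auto simp: zero add)
  have prod: "D (prod f T) = (\<Sum>k\<in>T. \<Prod>i\<in>T. if i = k then D (f i) else f i)"
    if "finite T" for T and f :: "'N \<Rightarrow> 'a"
    using that
  proof (induction T)
    case (insert t T)
    have "(\<Prod>i\<in>T. if i = t then D (f i) else f i) = prod f T"
      using insert.hyps by (intro prod.cong) auto
    moreover have "(\<Sum>k\<in>T. (if t = k then D (f t) else f t) * (\<Prod>i\<in>T. if i = k then D (f i) else f i))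
        = f t * (\<Sum>k\<in>T. \<Prod>i\<in>T. if i = k then D (f i) else f i)"
      unfolding sum_distrib_left using insert.hyps by (intro sum.cong) auto
    ultimately show ?case using insert by (simp add: mult)
  qed (simp add: one)
  have sign: "D (of_int (sign p) * x) = of_int (sign p) * D x" for p :: "'N \<Rightarrow> 'N" and x
    by (simp add: sign_def neg)
  have entry: "(\<chi> i. if i = k then (\<chi> j. D (A $ i $ j)) else A $ i) $ i $ j
      = (if i = k then D (A $ i $ j) else A $ i $ j)" for i j k
    by simp
  show ?thesis
    unfolding det_def entry sum sign prod [OF finite_class.finite_UNIV] sum_distrib_left
    by (rule sum.swap)
qed

section \<open>The map to polynomials and its equivariance\<close>

definition AX_row :: "'n \<times> nat \<Rightarrow> ('N::finite, 'n::finite, 'r::comm_ring_1) xa_poly ^ 'N" where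
  "AX_row x = (Amat ** mat_pow Xmat (snd x)) $ fst x"

lemma epsilon_poly_row_det:
  fixes w :: "('n::finite \<times> nat) list"
  assumes "length w = CARD('N)"
  shows "epsilon_poly w
    = (row_det (map AX_row w) :: ('N::{finite,linorder}, 'n, 'r::comm_ring_1) xa_poly)"
  unfolding epsilon_poly_def row_det_expand AX_row_def using assms
      by (auto intro!: sum.cong prod.cong)

interpretation xa: module "xa_scale :: 'r::comm_ring_1 \<Rightarrow> ('N, 'n, 'r) xa_poly \<Rightarrow>
    ('N, 'n, 'r) xa_poly"
  by unfold_locales
     (simp_all add: xa_scale_def xa_const_add xa_const_mult distrib_left distrib_right mult.assoc)

lemma xa_const_diff: "xa_const (c - d) = xa_const c - xa_const d"
  by (simp add: xa_const_def single_diff)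

lemma xa_const_of_int: "xa_const (of_int k) = of_int k"
  by (induction k rule: int_induct [of _ 0]) (simp_all add: xa_const_add xa_const_diff)

lemma epsilon_poly_sort:
  fixes l :: "nat list"
  assumes "length l = CARD('N)"
  shows "epsilon_poly (map mode l) = (of_int (levi_civita l) *
    epsilon_poly (map mode (sorted_list_of_set (set l))) ::
      ('N::{finite,linorder}, 'n::finite, 'r::comm_ring_1) xa_poly)"
proof -
  interpret module "(*) :: ('N, 'n, 'r) xa_poly \<Rightarrow> _"
    by unfold_locales (simp_all add: algebra_simps)
  let ?F = "\<lambda>l. row_det (map (\<lambda>i. AX_row (mode i)) l) :: ('N, 'n, 'r) xa_poly"
  have sort: "?F ([] @ l) = of_int (levi_civita l) * ?F ([] @ sorted_list_of_set (set l))"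
    by (rule alternating_sort [where F = ?F and u = "[]" and w = l and k = "CARD('N)"];
        (unfold map_append list.map)?, (rule row_det_swap row_det_repeat)?) (simp_all add: assms)
  show ?thesis
  proof (cases "distinct l")
    case True
    then have "length (sorted_list_of_set (set l)) = CARD('N)"
      using assms by (simp add: distinct_card)
    then show ?thesis using sort assms by (simp add: epsilon_poly_row_det comp_def)
  next
    case False
    then have "levi_civita l = 0" by (simp add: levi_civita_def)
    then show ?thesis using sort assms by (simp add: epsilon_poly_row_det comp_def)
  qed
qed

text \<open>Defined on all of the Fock space, by 0 on sets of the wrong size, and uniformly in the
  coefficient ring, so the same constant serves as the complex map and as its extension of
  scalars.\<close>

definition fock_to_xa ::
    "('n::finite, 'r::comm_ring_1) fock \<Rightarrow> ('N::{finite,linorder}, 'n, 'r) xa_poly" where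
  "fock_to_xa = coord_sum xa_scale
     (\<lambda>S. if card S = CARD('N) then epsilon_poly (map mode (sorted_list_of_set S)) else 0)"

lemma fock_to_xa_hom: "module_hom fock_scale xa_scale fock_to_xa"
  unfolding fock_to_xa_def by (rule xa.coord_sum_hom)

interpretation fock_to_xa: module_hom fock_scale xa_scale fock_to_xa
  by (rule fock_to_xa_hom)

lemma fock_to_xa_psi_word:
  assumes "length w = CARD('N)"
  shows "fock_to_xa (psi_word w)
    = (epsilon_poly w :: ('N::{finite,linorder}, 'n::finite, 'r::comm_ring_1) xa_poly)"
proof -
  have "fock_to_xa (psi_word (map mode l)) = (epsilon_poly (map mode l) :: ('N, 'n, 'r) xa_poly)"
    if "length l = CARD('N)" for l
  proof (cases "distinct l")
    case True
    then have "card (set l) = CARD('N)" using that by (simp add: distinct_card)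
    then show ?thesis
      unfolding fock_to_xa_def xa.coord_sum_psi_word epsilon_poly_sort [OF that]
      by (simp add: xa_scale_def xa_const_of_int)
  next
    case False
    then have "levi_civita l = 0" by (simp add: levi_civita_def)
    then show ?thesis
      unfolding fock_to_xa_def xa.coord_sum_psi_word epsilon_poly_sort [OF that] by simp
  qed
  from this [of "map mode_index w"] assms show ?thesis by (simp add: map_mode_index del: map_map)
qed

subsection \<open>Ring homomorphisms on the polynomials\<close>

lemma mat_pow_add: "mat_pow M (k + m) = mat_pow M k ** mat_pow M m"
  by (induction m) (simp_all add: matrix_mul_assoc)

lemma xa_subst_matrix_mult:
  "xa_subst Y B ((M ** M') $ i $ j) = (\<Sum>k\<in>UNIV. xa_subst Y B (M $ i $ k)
      * xa_subst Y B (M' $ k $ j))"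
  by (simp add: matrix_matrix_mult_def xa_subst_sum xa_subst_mult)

lemma xa_subst_1 [simp]: "xa_subst Y B 1 = 1"
  using xa_subst_const [of Y B 1] by simp

lemma xa_subst_mat_pow: "xa_subst Y B (mat_pow Xmat m $ i $ j) = mat_pow Y m $ i $ j"
  by (induction m arbitrary: j)
     (simp_all add: mat_def xa_subst_matrix_mult xa_subst_Xmat, simp_all add:
         matrix_matrix_mult_def)

lemma xa_subst_AX_row:
  "(\<chi> j. xa_subst Y B (AX_row x $ j)) = (B ** mat_pow Y (snd x)) $ fst x"
  by (simp add: vec_eq_iff AX_row_def xa_subst_matrix_mult xa_subst_Amat xa_subst_mat_pow)
     (simp add: matrix_matrix_mult_def)

lemma xa_subst_epsilon_poly:
  fixes Y :: "((('N::{finite,linorder}, 'n::finite, 'r::comm_ring_1) xa_poly, 'N) vec, 'N) vec"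
  assumes "length w = CARD('N)"
  shows "xa_subst Y B (epsilon_poly w) = row_det (map (\<lambda>x. (B ** mat_pow Y (snd x)) $ fst x) w)"
  using assms
  by (simp add: epsilon_poly_row_det row_det_hom xa_subst_add xa_subst_mult xa_subst_AX_row
      comp_def)

subsection \<open>The action of \<open>GL\<^sub>n[z]\<close>\<close>

text \<open>If an operator replaces each letter by a linear combination of letters, multilinearity
  turns each row into the same combination of rows. The induction expands the letters from the left
  and collects the chosen ones in a prefix \<open>u\<close>.\<close>

lemma fock_to_xa_multilinear:
  fixes r :: "('n::finite \<times> nat) \<Rightarrow> _" and c :: "_ \<Rightarrow> 't \<Rightarrow> 'r::comm_ring_1"
  assumes op: "\<And>x v. op x v
      = (\<Sum>t\<in>T x. fock_scale (c x t) (fock_op (Psi (fst (y x t)) (snd (y x t))) v))"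
    and "length w = CARD('N)"
  shows "fock_to_xa (foldr op w vac)
    = (row_det (map (\<lambda>x. \<Sum>t\<in>T x. xa_const (c x t) *s AX_row (y x t)) w)
        :: ('N::{finite,linorder}, 'n, 'r) xa_poly)"
proof -
  let ?psi = "\<lambda>u v. foldr (\<lambda>(a, m). fock_op (Psi a m)) u v :: ('n, 'r) fock"
  let ?row = "\<lambda>x. \<Sum>t\<in>T x. xa_const (c x t) *s AX_row (y x t) :: (('N, 'n, 'r) xa_poly, 'N) vec"
  have psi_sum: "?psi u (\<Sum>t\<in>S. fock_scale (d t) (fock_op (Psi (fst (z t)) (snd (z t))) v))
      = (\<Sum>t\<in>S. fock_scale (d t) (?psi (u @ [z t]) v))" for u v d z and S :: "'t set"
    by (induction u) (auto simp: fock_op.sum fock_op.scale case_prod_unfold)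
  have "fock_to_xa (?psi u (foldr op w vac)) = (row_det (map AX_row u @ map ?row w))"
    if "length u + length w = CARD('N)" for u
    using that
  proof (induction w arbitrary: u)
    case Nil
    then show ?case by (simp add: fock_to_xa_psi_word epsilon_poly_row_det flip: psi_word_def)
  next
    case (Cons x w)
    have "fock_to_xa (?psi u (foldr op (x # w) vac))
        = (\<Sum>t\<in>T x. xa_const (c x t) * fock_to_xa (?psi (u @ [y x t]) (foldr op w vac)))"
      by (simp only: foldr.simps comp_apply op [of x] psi_sum fock_to_xa.sum fock_to_xa.scale
          xa_scale_def)
    also have "\<dots> = (\<Sum>t\<in>T x. xa_const (c x t) * row_det (map AX_row u @ AX_row
        (y x t) # map ?row w))"
    proof (intro sum.cong refl)
      fix t
      have "fock_to_xa (?psi (u @ [y x t]) (foldr op w vac))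
          = row_det (map AX_row (u @ [y x t]) @ map ?row w)"
        using Cons.prems by (intro Cons.IH) simp
      then show "xa_const (c x t) * fock_to_xa (?psi (u @ [y x t]) (foldr op w vac))
          = xa_const (c x t) * row_det (map AX_row u @ AX_row (y x t) # map ?row w)"
        by simp
    qed
    also have "\<dots> = row_det (map AX_row u @ ?row x # map ?row w)"
      using Cons.prems by (intro row_det_sum [symmetric]) simp
    finally show ?case by simp
  qed
  from this [of "[]"] assms(2) show ?thesis by simp
qed

text \<open>The letter (a, m) becomes the sum of the coefficients of z^k in g_{ba} times (b, m + k).
  Since X^{m+k} = X^k X^m, the resulting row is the substituted row of A, times X^m.\<close>

lemma fock_to_xa_glz_psi_word:
  fixes g :: "'r::comm_ring_1 poly ^ 'n ^ 'n"
  assumes "invertible g" "length w = CARD('N)"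
  shows "fock_to_xa (glz_fock g (psi_word w))
    = (glz_xa g (epsilon_poly w) :: ('N::{finite,linorder}, 'n::finite, 'r) xa_poly)"
proof -
  let ?T = "\<lambda>x :: 'n \<times> nat. Sigma UNIV (\<lambda>b. {..Polynomial.degree (g $ b $ fst x)})"
  let ?c = "\<lambda>(x :: 'n \<times> nat) (b, k). coeff (g $ b $ fst x) k"
  let ?y = "\<lambda>(x :: 'n \<times> nat) (b :: 'n, k). (b, snd x + k)"
  let ?B = "\<chi> b j. \<Sum>a\<in>UNIV. \<Sum>k\<le>Polynomial.degree (g $ a $ b).
     xa_const (coeff (g $ a $ b) k) * (Amat ** mat_pow Xmat k) $ a $ j
     :: ((('N, 'n, 'r) xa_poly, 'N) vec, 'n) vec"
  have "fock_to_xa (glz_fock g (psi_word w))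
      = (row_det (map (\<lambda>x. \<Sum>t\<in>?T x. xa_const (?c x t) *s AX_row (?y x t)) w)
          :: ('N, 'n, 'r) xa_poly)"
    unfolding glz_fock_psi_word [OF assms(1)]
    by (rule fock_to_xa_multilinear [where op = "\<lambda>(a, m). glz_op g (Psi a m)" and T = ?T and c = ?c
          and y = ?y, OF _ assms(2)])
       (auto simp: glz_op_Psi_alt case_prod_unfold simp del: glz_op.simps)
  also have "\<dots> = row_det (map (\<lambda>x. (?B ** mat_pow Xmat (snd x)) $ fst x) w)"
  proof (intro arg_cong [where f = row_det] map_cong refl)
    fix x :: "'n \<times> nat"
    have "(\<Sum>t\<in>?T x. xa_const (?c x t) *s AX_row (?y x t)) $ j
        = (\<Sum>a\<in>UNIV. \<Sum>k\<le>Polynomial.degree (g $ a $ fst x). xa_const (coeff (g $ a $ fst x) k)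
            * ((Amat ** mat_pow Xmat k) ** mat_pow Xmat (snd x)) $ a $ j)" for j
      by (simp add: sum.Sigma AX_row_def case_prod_unfold)
         (simp add: mat_pow_add matrix_mul_assoc add.commute [of "snd x"])
    also have "\<dots> j = (?B ** mat_pow Xmat (snd x)) $ fst x $ j" for j
      unfolding matrix_matrix_mult_def [of _ "mat_pow Xmat (snd x)"]
      by (simp add: sum_distrib_left sum_distrib_right mult.assoc)
         (subst sum.swap, intro sum.cong refl, subst sum.swap, rule refl)
    finally show "(\<Sum>t\<in>?T x. xa_const (?c x t) *s AX_row (?y x t))
        = (?B ** mat_pow Xmat (snd x)) $ fst x"
      by (simp add: vec_eq_iff)
  qed
  also have "\<dots> = glz_xa g (epsilon_poly w)"
    unfolding glz_xa_def xa_subst_epsilon_poly [OF assms(2)] ..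
  finally show ?thesis .
qed

section \<open>The grading action and the semidirect product\<close>

lemma mat_pow_scale:
  "mat_pow (\<chi> i j. (c :: 'a::comm_ring_1) * M $ i $ j) m = (\<chi> i j. c ^ m * mat_pow M m $ i $ j)"
proof (induction m)
  case 0
  show ?case by (simp add: vec_eq_iff mat_def)
next
  case (Suc m)
  then show ?case
    by (simp add: vec_eq_iff matrix_matrix_mult_def sum_distrib_left mult_ac)
qed

lemma xa_const_power: "xa_const (c ^ m) = xa_const c ^ m"
  by (induction m) (simp_all add: xa_const_mult)

text \<open>Scaling X by q multiplies the row A^a X^m by q^m, and the determinant collects these
  factors.\<close>

lemma rot_xa_epsilon_poly:
  assumes "length w = CARD('N)"
  shows "rot_xa q (epsilon_poly w) = xa_scale (q ^ sum_list (map snd w))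
    (epsilon_poly w :: ('N::{finite,linorder}, 'n::finite, 'r::comm_ring_1) xa_poly)"
proof -
  have row: "((Amat :: (('N, 'n, 'r) xa_poly, 'N) vec ^ 'n) ** mat_pow (\<chi> i j. xa_const q
      * Xmat $ i $ j) (snd x)) $ fst x
      = xa_const q ^ snd x *s AX_row x" for x
    by (simp add: mat_pow_scale AX_row_def matrix_matrix_mult_def vec_eq_iff sum_distrib_left
        mult_ac)
  have "prod_list (map (\<lambda>x. xa_const q ^ snd x) w)
      = (xa_const (q ^ sum_list (map snd w)) :: ('N, 'n, 'r) xa_poly)"
    by (induction w) (simp_all add: xa_const_power power_add xa_const_mult)
  then show ?thesis
    unfolding rot_xa_def xa_subst_epsilon_poly [OF assms] row row_det_rows_scale [OF assms]
    by (simp add: xa_scale_def epsilon_poly_row_det [OF assms])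
qed

lemma xa_subst_hom: "module_hom xa_scale xa_scale (xa_subst Y B)"
  by unfold_locales (simp_all add: xa_scale_def xa_subst_add xa_subst_mult xa_subst_const)

lemma fock_to_xa_glz_rot:
  fixes g :: "'r::comm_ring_1 poly ^ 'n ^ 'n" and v :: "('n::finite, 'r) fock"
  assumes g: "invertible g" and q: "q dvd 1" and v: "v \<in> fock_N CARD('N)"
  shows "fock_to_xa (glz_fock g (rot_fock q v))
    = (glz_xa g (rot_xa q (fock_to_xa v)) :: ('N::{finite,linorder}, 'n, 'r) xa_poly)"
proof -
  let ?l = "\<lambda>v. fock_to_xa (glz_fock g (rot_fock q v)) :: ('N, 'n, 'r) xa_poly"
  let ?r = "\<lambda>v. glz_xa g (rot_xa q (fock_to_xa v)) :: ('N, 'n, 'r) xa_poly"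
  interpret G: module_hom fock_scale fock_scale "glz_fock g"
    unfolding glz_fock_def by (rule fock_rep.fock_rec_hom [OF glz_rep [OF g]])
  interpret Q: module_hom fock_scale fock_scale "rot_fock q :: ('n, 'r) fock \<Rightarrow> _"
    unfolding rot_fock_def by (rule fock_rep.fock_rec_hom [OF rot_rep [OF q]])
  interpret G': module_hom xa_scale xa_scale "glz_xa g :: ('N, 'n, 'r) xa_poly \<Rightarrow> _"
    unfolding glz_xa_def by (rule xa_subst_hom)
  interpret Q': module_hom xa_scale xa_scale "rot_xa q :: ('N, 'n, 'r) xa_poly \<Rightarrow> _"
    unfolding rot_xa_def by (rule xa_subst_hom)
  show ?thesis
  proof (rule fock_N_hom_eqI [where f = ?l and g = ?r, OF _ _ _ v])
    show "module_hom fock_scale xa_scale ?l"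
      by unfold_locales (simp_all add: G.add Q.add G.scale Q.scale fock_to_xa.add fock_to_xa.scale)
    show "module_hom fock_scale xa_scale ?r"
      by unfold_locales (simp_all add: G'.add Q'.add G'.scale Q'.scale fock_to_xa.add
          fock_to_xa.scale)
  next
    fix w :: "('n \<times> nat) list" assume w: "length w = CARD('N)"
    show "?l (psi_word w) = ?r (psi_word w)"
      by (simp add: rot_fock_psi_word q G.scale fock_to_xa.scale fock_to_xa_glz_psi_word g w
          fock_to_xa_psi_word rot_xa_epsilon_poly G'.scale)
  qed
qed

subsection \<open>The action of \<open>gl\<^sub>n[z]\<close>\<close>

text \<open>By \<open>gl_fock_Psi\<close> the operator acts as a derivation on words, changing one
  letter at a time.\<close>

lemma gl_fock_psi_word:
  "gl_fock a b m (psi_word w)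
     = (\<Sum>k<length w. if fst (w ! k) = b then psi_word (w[k := (a, snd (w ! k) + m)]) else 0)"
proof (induction w)
  case Nil
  then show ?case by (simp add: psi_word_Nil gl_fock_vac)
next
  case (Cons x w)
  obtain c j where x: "x = (c, j)" by (cases x)
  have if_op: "fock_op y (if P then v else 0)
      = (if P then fock_op y v else 0)" for y P and v :: "('a, 'b) fock"
    by simp
  show ?case
    by (simp add: x psi_word_Cons gl_fock_Psi Cons.IH sum.lessThan_Suc_shift fock_op.sum if_op
        add.commute
        del: sum.lessThan_Suc cong: if_cong)
qed

text \<open>The derivation kills the entries of X, so it acts only on the leading factor, where A^b
  becomes A^a X^m.\<close>

lemma gl_xa_AX_row:
  "gl_xa a b m (AX_row x $ j :: ('N::finite, 'n::finite, 'r::comm_ring_1) xa_poly)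
     = (if fst x = b then AX_row (a, snd x + m) $ j else 0)"
proof -
  have add: "gl_xa a b m (sum f T) = (\<Sum>i\<in>T. gl_xa a b m (f i))"
    for f :: "'N \<Rightarrow> ('N, 'n, 'r) xa_poly" and T
    by (induction T rule: infinite_finite_induct)
        (simp_all add: gl_xa_add gl_xa_def [of _ _ _ 0] partial_A_def [of _ _ 0])
  have X: "gl_xa a b m (mat_pow Xmat k $ l $ j :: ('N, 'n, 'r) xa_poly) = 0" for k l j
  proof (induction k arbitrary: l j)
    case 0
    then show ?case
      by (simp add: mat_def gl_xa_def partial_A_const [of _ _ 1, simplified] partial_A_const [of _
          _ 0, simplified])
  next
    case (Suc k)
    then show ?case
      by (simp add: matrix_matrix_mult_def add gl_xa_mult) (simp add: gl_xa_def partial_A_Xmat)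
  qed
  have "gl_xa a b m (AX_row x $ j :: ('N, 'n, 'r) xa_poly)
      = (if fst x = b then ((Amat ** mat_pow Xmat m) ** mat_pow Xmat (snd x)) $ a $ j else 0)"
    by (simp add: AX_row_def matrix_matrix_mult_def [of _ "mat_pow Xmat
        (snd x)"] add gl_xa_mult X gl_xa_Amat)
  then show ?thesis
    by (simp add: AX_row_def mat_pow_add add.commute [of _ m] flip: matrix_mul_assoc)
qed

lemma fock_to_xa_gl:
  fixes v :: "('n::finite, 'r::comm_ring_1) fock"
  assumes v: "v \<in> fock_N CARD('N)"
  shows "fock_to_xa (gl_fock a b m v)
    = (gl_xa a b m (fock_to_xa v) :: ('N::{finite,linorder}, 'n, 'r) xa_poly)"
proof -
  let ?l = "\<lambda>v. fock_to_xa (gl_fock a b m v) :: ('N, 'n, 'r) xa_poly"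
  let ?r = "\<lambda>v. gl_xa a b m (fock_to_xa v) :: ('N, 'n, 'r) xa_poly"
  interpret G: module_hom fock_scale fock_scale "gl_fock a b m :: ('n, 'r) fock \<Rightarrow> _"
    by (rule gl_fock_hom)
  have scale: "gl_xa a b m (xa_scale c p) = xa_scale c (gl_xa a b m p)" for c and p
      :: "('N, 'n, 'r) xa_poly"
    by (simp add: xa_scale_def gl_xa_mult) (simp add: gl_xa_def partial_A_const)
  show ?thesis
  proof (rule fock_N_hom_eqI [where f = ?l and g = ?r, OF _ _ _ v])
    show "module_hom fock_scale xa_scale ?l"
      by unfold_locales (simp_all add: G.add G.scale fock_to_xa.add fock_to_xa.scale)
    show "module_hom fock_scale xa_scale ?r"
      by unfold_locales (simp_all add: scale gl_xa_add fock_to_xa.add fock_to_xa.scale)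
  next
    fix w :: "('n \<times> nat) list" assume w: "length w = CARD('N)"
    let ?w = "\<lambda>k. w[k := (a, snd (w ! k) + m)]"
    let ?M = "\<lambda>w. (\<chi> i. AX_row (w ! index_of i)) :: ((('N, 'n, 'r) xa_poly, 'N) vec, 'N) vec"
    have eps: "epsilon_poly w' = det (?M w')" if "length w' = CARD('N)" for w'
      using that by (simp add: epsilon_poly_row_det row_det_def)
    have "?l (psi_word w) = (\<Sum>k<CARD('N). if fst (w ! k) = b then det (?M (?w k)) else 0)"
      by (auto simp: gl_fock_psi_word fock_to_xa.sum w fock_to_xa_psi_word eps intro!: sum.cong)
    also have "\<dots> = (\<Sum>i\<in>UNIV. if fst (w ! index_of (i :: 'N))
        = b then det (?M (?w (index_of i))) else 0)"
      by (rule sum.reindex_bij_betw [OF bij_index_of, symmetric])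
    also have "\<dots> = (\<Sum>k\<in>UNIV. det (\<chi> i. if i = k then (\<chi> j. gl_xa a b m
        (?M w $ i $ j)) else ?M w $ i))"
    proof (intro sum.cong refl)
      fix k :: 'N
      show "(if fst (w ! index_of k) = b then det (?M (?w (index_of k))) else 0)
          = det (\<chi> i. if i = k then (\<chi> j. gl_xa a b m (?M w $ i $ j)) else ?M w $ i)"
      proof (cases "fst (w ! index_of k) = b")
        case True
        have "?M (?w (index_of k)) = (\<chi> i. if i
            = k then (\<chi> j. gl_xa a b m (?M w $ i $ j)) else ?M w $ i)"
          using True by (simp add: vec_eq_iff gl_xa_AX_row nth_list_update w)
        then show ?thesis using True by simp
      next
        case False
        \<comment> \<open>The zero row is written as \<open>0 *s 0\<close> so that
          \<open>det_row_mul\<close> extracts a factor 0.\<close>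
        have "(\<chi> i. if i = k then (\<chi> j. gl_xa a b m (?M w $ i $ j)) else ?M w $ i)
            = (\<chi> i. if i = k then 0 *s 0 else ?M w $ i)"
          using False by (simp add: vec_eq_iff gl_xa_AX_row)
        then show ?thesis using False by (simp only: det_row_mul) simp
      qed
    qed
    also have "\<dots> = gl_xa a b m (det (?M w))"
      by (rule det_derivation [symmetric]) (simp_all add: gl_xa_add gl_xa_mult)
    also have "\<dots> = ?r (psi_word w)"
      using w by (simp add: fock_to_xa_psi_word eps)
    finally show "?l (psi_word w) = ?r (psi_word w)" .
  qed
qed

subsection \<open>Extension of scalars\<close>

lemma complex_algebraD:
  assumes "complex_algebra h"
  shows "h 1 = 1" "h 0 = 0" "h (x + y) = h x + h y" "h (x * y) = h x * h y"
proof -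
  show add: "h (x + y) = h x + h y" and "h 1 = 1" "h (x * y) = h x * h y" for x y
    using assms by (auto simp: complex_algebra_def)
  from add [of 0 0] show "h 0 = 0" by simp
qed

context
  fixes h :: "complex \<Rightarrow> 'r::comm_ring_1"
  assumes h: "complex_algebra h"
begin

lemma lookup_map_h: "Poly_Mapping.lookup (Poly_Mapping.map h p) k = h (Poly_Mapping.lookup p k)"
  using complex_algebraD(2) [OF h] by transfer (auto simp: when_def)

lemma map_h_add: "Poly_Mapping.map h (p + q) = Poly_Mapping.map h p + Poly_Mapping.map h q"
  by (rule poly_mapping_eqI) (simp add: lookup_map_h lookup_add complex_algebraD [OF h])

lemma map_h_single: "Poly_Mapping.map h (Poly_Mapping.single k c) = Poly_Mapping.single k (h c)"
  by (rule poly_mapping_eqI) (simp add: lookup_map_h lookup_single when_def complex_algebraD [OF h])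

lemma map_h_0: "Poly_Mapping.map h 0 = 0"
  by (rule poly_mapping_eqI) (simp add: lookup_map_h complex_algebraD [OF h])

lemma map_h_sum: "Poly_Mapping.map h (sum f T) = (\<Sum>i\<in>T. Poly_Mapping.map h (f i))"
  by (induction T rule: infinite_finite_induct) (simp_all add: map_h_0 map_h_add)

lemma map_h_mult:
  fixes p q :: "('N::finite, 'n::finite, complex) xa_poly"
  shows "Poly_Mapping.map h (p * q) = Poly_Mapping.map h p * Poly_Mapping.map h q"
proof -
  have "Poly_Mapping.map h ((\<Sum>i\<in>S. Poly_Mapping.single i (f i))
      * (\<Sum>j\<in>T. Poly_Mapping.single j (g j)))
      = Poly_Mapping.map h (\<Sum>i\<in>S. Poly_Mapping.single i (f i))
        * Poly_Mapping.map h (\<Sum>j\<in>T. Poly_Mapping.single j (g j))"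
    for S T f and g :: "(('N, 'n) xa_var \<Rightarrow>\<^sub>0 nat) \<Rightarrow> complex"
    by (simp add: sum_product map_h_sum mult_single map_h_single complex_algebraD [OF h])
  from this [of "Poly_Mapping.lookup p" "Poly_Mapping.keys p" "Poly_Mapping.lookup q"
      "Poly_Mapping.keys q"]
  show ?thesis by (simp only: xa_poly_expand [symmetric])
qed

lemma map_h_1: "Poly_Mapping.map h (1 :: ('N::finite, 'n::finite, complex) xa_poly) = 1"
  unfolding single_one [symmetric] map_h_single by (simp add: complex_algebraD [OF h])

text \<open>The polynomial is built from the variables by ring operations with integer coefficients,
  which a ring homomorphism preserves.\<close>

lemma map_h_epsilon_poly:
  assumes "length w = CARD('N)"
  shows "Poly_Mapping.map h (epsilon_poly w)
    = (epsilon_poly w :: ('N::{finite,linorder}, 'n::finite, 'r) xa_poly)"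
proof -
  have X: "Poly_Mapping.map h (Xmat $ i $ j) = (Xmat $ i $ j :: ('N, 'n, 'r) xa_poly)" for i j
    by (simp add: Xmat_def map_h_single complex_algebraD [OF h])
  have A: "Poly_Mapping.map h (Amat $ a $ j) = (Amat $ a $ j :: ('N, 'n, 'r) xa_poly)" for a j
    by (simp add: Amat_def map_h_single complex_algebraD [OF h])
  have pow: "Poly_Mapping.map h (mat_pow Xmat m $ i $ j)
      = (mat_pow Xmat m $ i $ j :: ('N, 'n, 'r) xa_poly)" for m i j
    by (induction m arbitrary: j)
       (simp_all add: mat_def matrix_matrix_mult_def map_h_sum map_h_mult map_h_1 map_h_0 X)
  have "Poly_Mapping.map h (AX_row x $ j) = (AX_row x $ j :: ('N, 'n, 'r) xa_poly)" for x j
    by (simp add: AX_row_def matrix_matrix_mult_def map_h_sum map_h_mult pow A)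
  then show ?thesis
    using assms by (simp add: epsilon_poly_row_det row_det_hom map_h_add map_h_mult map_h_1
        comp_def)
qed

lemma fock_to_xa_base_change:
  "is_base_change h CARD('N) fock_to_xa
     (fock_to_xa :: ('n::finite, 'r) fock \<Rightarrow> ('N::{finite,linorder}, 'n, 'r) xa_poly)"
  unfolding is_base_change_def
proof (intro conjI ballI)
  show "linear_on_set fock_scale xa_scale (fock_N CARD('N))
      (fock_to_xa :: ('n, 'r) fock \<Rightarrow> ('N, 'n, 'r) xa_poly)"
    by (simp add: linear_on_set_def fock_to_xa.add fock_to_xa.scale)
next
  fix v :: "('n, complex) fock" assume v: "v \<in> fock_N CARD('N)"
  \<comment> \<open>Polynomials over \<open>'r\<close> are regarded as a complex module through
    \<open>h\<close>; both sides are then complex linear and can be compared on words.\<close>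
  let ?s = "\<lambda>c. xa_scale (h c) :: ('N, 'n, 'r) xa_poly \<Rightarrow> _"
  let ?l = "\<lambda>v :: ('n, complex) fock. fock_to_xa (fock_base h v) :: ('N, 'n, 'r) xa_poly"
  let ?r = "\<lambda>v :: ('n, complex) fock. Poly_Mapping.map h (fock_to_xa v) :: ('N, 'n, 'r) xa_poly"
  interpret S: module ?s
    by unfold_locales (simp_all add: complex_algebraD [OF h] xa.scale_right_distrib
        xa.scale_left_distrib)
  interpret B: module_hom fock_scale "\<lambda>c. fock_scale (h c)" "fock_base h :: _ \<Rightarrow> ('n, 'r) fock"
    unfolding fock_base_def by (rule fock_rep.fock_rec_hom [OF base_rep [OF h]])
  have scale: "Poly_Mapping.map h (xa_scale c p) = xa_scale (h c) (Poly_Mapping.map h p)"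
    for c and p :: "('N, 'n, complex) xa_poly"
    by (simp add: xa_scale_def map_h_mult xa_const_def map_h_single)
  show "?l v = ?r v"
  proof (rule fock_N_hom_eqI [where f = ?l and g = ?r, OF _ _ _ v])
    show "module_hom fock_scale ?s ?l"
      by unfold_locales (simp_all add: B.add B.scale fock_to_xa.add fock_to_xa.scale)
    show "module_hom fock_scale ?s ?r"
      by unfold_locales (simp_all add: map_h_add scale fock_to_xa.add fock_to_xa.scale)
  next
    fix w :: "('n \<times> nat) list" assume "length w = CARD('N)"
    then show "?l (psi_word w) = ?r (psi_word w)"
      by (simp add: fock_base_psi_word [OF h] fock_to_xa_psi_word map_h_epsilon_poly)
  qed
qed

end

section \<open>Semi-invariance\<close>

lemma matrix_inv_mult:
  assumes "invertible (g :: 'a::semiring_1 ^ 'N ^ 'N)"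
  shows "g ** matrix_inv g = mat 1" "matrix_inv g ** g = mat 1"
  using assms someI_ex [of "\<lambda>h. g ** h = mat 1 \<and> h ** g = mat 1"]
  unfolding invertible_def matrix_inv_def by auto

lemma matrix_inv_eqI:
  assumes "(g :: 'a::semiring_1 ^ 'N ^ 'N) ** h = mat 1" "h ** g = mat 1"
  shows "matrix_inv g = h"
proof -
  have "invertible g" using assms by (auto simp: invertible_def)
  then have "matrix_inv g = matrix_inv g ** (g ** h)"
    by (simp add: assms)
  also have "\<dots> = h"
    by (simp add: matrix_mul_assoc matrix_inv_mult \<open>invertible g\<close>)
  finally show ?thesis .
qed

lemma det_matrix_inv:
  assumes "invertible (g :: complex ^ 'N ^ 'N)"
  shows "det (matrix_inv g) = inverse (det g)"
proof -
  have "det g * det (matrix_inv g) = 1"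
    using matrix_inv_mult(1) [OF assms] by (metis det_I det_mul)
  then show ?thesis by (metis inverse_unique)
qed

lemma xa_const_sum: "xa_const (sum f T) = (\<Sum>i\<in>T. xa_const (f i))"
  by (induction T rule: infinite_finite_induct) (simp_all add: xa_const_add)

lemma const_mat_mult: "const_mat g ** const_mat h = const_mat (g ** h)"
  by (simp add: const_mat_def matrix_matrix_mult_def vec_eq_iff xa_const_sum xa_const_mult)

lemma const_mat_1: "const_mat (mat 1) = mat 1"
  by (simp add: const_mat_def mat_def vec_eq_iff)

lemma det_const_mat: "det (const_mat g) = xa_const (det g)"
  unfolding const_mat_def by (rule det_hom [symmetric]) (simp_all add: xa_const_add xa_const_mult)

text \<open>Powers of g X g^{-1} telescope and the inner g^{-1} g cancels against A g^{-1}, so every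
  row is multiplied on the right by g^{-1} and the determinant by det(g)^{-1}.\<close>

lemma epsilon_poly_semi_invariant:
  assumes w: "length w = CARD('N)"
  shows "(epsilon_poly w :: ('N::{finite,linorder}, 'n::finite, complex) xa_poly) \<in> semi_invariants"
  unfolding semi_invariants_def
proof (intro CollectI allI impI)
  fix g :: "((complex, 'N) vec, 'N) vec" assume g: "invertible g"
  let ?h = "const_mat (matrix_inv g) :: ((('N, 'n, complex) xa_poly, 'N) vec, 'N) vec"
  let ?Y = "const_mat g ** Xmat ** ?h"
  have inv: "?h ** const_mat g = mat 1" "const_mat g ** ?h = mat 1"
    by (simp_all add: const_mat_mult matrix_inv_mult g const_mat_1)
  have pow: "mat_pow ?Y m = const_mat g ** mat_pow Xmat m ** ?h" for m
  proof (induction m)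
    case (Suc m)
    have "mat_pow ?Y (Suc m) = const_mat g ** mat_pow Xmat m ** (?h ** const_mat g) ** Xmat ** ?h"
      by (simp add: Suc matrix_mul_assoc)
    then show ?case by (simp add: inv matrix_mul_assoc)
  qed (simp add: inv)
  have "(Amat ** ?h) ** mat_pow ?Y m = Amat ** (?h ** const_mat g) ** mat_pow Xmat m ** ?h" for m
    by (simp add: pow matrix_mul_assoc)
  then have row: "((Amat ** ?h) ** mat_pow ?Y (snd x)) $ fst x = AX_row x v* ?h" for x
    by (simp add: inv AX_row_def)
       (simp add: vec_eq_iff matrix_matrix_mult_def [of _ ?h] vector_matrix_mult_def mult.commute)
  show "xa_subst ?Y (Amat ** ?h) (epsilon_poly w) = xa_scale (inverse (det g)) (epsilon_poly w)"
    unfolding xa_subst_epsilon_poly [OF w] row row_det_mult [OF w]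
    by (simp add: epsilon_poly_row_det w det_const_mat det_matrix_inv g xa_scale_def mult.commute)
qed

lemma fock_to_xa_semi_invariant:
  fixes v :: "('n::finite, complex) fock"
  assumes "v \<in> fock_N CARD('N)"
  shows "(fock_to_xa v :: ('N::{finite,linorder}, 'n, complex) xa_poly) \<in> semi_invariants"
  using assms unfolding fock_N_def
proof (induction v rule: fock.span_induct_alt)
  case base
  then show ?case
    by (simp add: fock_to_xa.zero semi_invariants_def)
next
  case (step c x v)
  interpret S: module_hom xa_scale xa_scale "xa_subst Y B :: ('N, 'n, complex) xa_poly \<Rightarrow> _" for Y B
    by (rule xa_subst_hom)
  from step obtain w where "x = psi_word w" "length w = CARD('N)" by auto
  then have "fock_to_xa x \<in> (semi_invariants :: ('N, 'n, complex) xa_poly set)"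
    by (simp add: fock_to_xa_psi_word epsilon_poly_semi_invariant)
  with step.IH show ?case
    by (simp add: semi_invariants_def fock_to_xa.add fock_to_xa.scale S.add S.scale
        xa.scale_right_distrib mult.commute)
qed

lemma semi_invariants_diff:
  "p \<in> semi_invariants \<Longrightarrow> q \<in> semi_invariants \<Longrightarrow> p - q \<in> semi_invariants"
proof -
  interpret S: module_hom xa_scale xa_scale "xa_subst Y B :: ('a, 'b, complex) xa_poly \<Rightarrow> _" for Y B
    by (rule xa_subst_hom)
  assume "p \<in> semi_invariants" "q \<in> semi_invariants"
  then show ?thesis
    by (simp add: semi_invariants_def S.diff xa.scale_right_diff_distrib)
qed

section \<open>Restriction to diagonal matrices\<close>

lemma xa_subst_xa_subst:
  "xa_subst Y B (xa_subst Y' B' p)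
     = xa_subst (\<chi> i j. xa_subst Y B (Y' $ i $ j)) (\<chi> a i. xa_subst Y B (B' $ a $ i)) p"
  by (induction p rule: xa_induct)
     (simp_all add: xa_subst_const xa_subst_Xmat xa_subst_Amat xa_subst_add xa_subst_mult)

lemma lookup_single_sum:
  "Poly_Mapping.lookup (\<Sum>i\<in>T. Poly_Mapping.single (f i) (c i)) k = (\<Sum>i\<in>T. if f i
      = k then c i else 0)"
  by (simp add: lookup_sum lookup_single when_def)

lemma xa_scale_single: "xa_scale c (Poly_Mapping.single m d) = Poly_Mapping.single m (c * d)"
  by (simp add: xa_scale_def xa_const_def mult_single)

lemma lookup_xa_scale: "Poly_Mapping.lookup (xa_scale c p) m = c * Poly_Mapping.lookup p m"
proof -
  have "xa_scale c p = (\<Sum>m\<in>Poly_Mapping.keys p. Poly_Mapping.single m (c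
      * Poly_Mapping.lookup p m))"
    by (subst xa_poly_expand [of p]) (simp only: xa.scale_sum_right xa_scale_single)
  then show ?thesis by (simp add: lookup_single_sum sum.delta in_keys_iff)
qed

text \<open>Rescaling the variables is diagonal in the monomial basis. Weights 0 and 1 describe
  restriction to diagonal matrices, other weights the torus action.\<close>

lemma lookup_xa_subst_scaling:
  fixes p :: "('N::finite, 'n::finite, 'r::comm_ring_1) xa_poly"
  shows "Poly_Mapping.lookup (xa_subst (\<chi> i j. xa_const (y i j) * Xmat $ i $ j)
            (\<chi> a i. xa_const (b a i) * Amat $ a $ i) p) m
    = Poly_Mapping.lookup p m *
        (\<Prod>v\<in>UNIV. (case v of Inl (i, j) \<Rightarrow> y i j | Inr (a, i) \<Rightarrow> b a i) ^ Poly_Mapping.lookup m v)"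
proof -
  let ?s = "xa_subst (\<chi> i j. xa_const (y i j) * Xmat $ i $ j) (\<chi> a i. xa_const (b a i)
      * Amat $ a $ i)
    :: ('N, 'n, 'r) xa_poly \<Rightarrow> _"
  let ?wt = "\<lambda>v. case v of Inl (i, j) \<Rightarrow> y i j | Inr (a, i) \<Rightarrow> b a i"
  let ?W = "\<lambda>m. \<Prod>v\<in>UNIV. ?wt v ^ Poly_Mapping.lookup m v"
  have prod: "xa_const (prod f T) = (\<Prod>v\<in>T. xa_const (f v))" for f :: "('N, 'n) xa_var \<Rightarrow> 'r" and T
    by (induction T rule: infinite_finite_induct) (simp_all add: xa_const_mult)
  have single: "?s (Poly_Mapping.single m c) = Poly_Mapping.single m (c * ?W m)" for m c
  proof -
    have "(case v of Inl (i, j) \<Rightarrow> (\<chi> i j. xa_const (y i j) * Xmat $ i $ j) $ i $ j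
          | Inr (a, i) \<Rightarrow> (\<chi> a i. xa_const (b a i) * Amat $ a $ i) $ a $ i)
        = xa_const (?wt v) * Poly_Mapping.single (Poly_Mapping.single v 1) 1" for v
      by (auto simp: Xmat_def Amat_def split: sum.split)
    then have "?s (Poly_Mapping.single m c) = xa_const (c * ?W m)
        * (\<Prod>v\<in>UNIV. Poly_Mapping.single (Poly_Mapping.single v 1) 1 ^ Poly_Mapping.lookup m v)"
      by (simp add: xa_subst_single power_mult_distrib prod.distrib prod xa_const_power
          xa_const_mult mult.assoc)
    then show ?thesis by (simp only: xa_monomial [symmetric])
  qed
  have "?s p = ?s (\<Sum>m\<in>Poly_Mapping.keys p. Poly_Mapping.single m (Poly_Mapping.lookup p m))"
    using xa_poly_expand [of p] by simp
  also have "\<dots> = (\<Sum>m\<in>Poly_Mapping.keys p. Poly_Mapping.single m (Poly_Mapping.lookup p m * ?W m))"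
    by (simp only: xa_subst_sum single)
  finally show ?thesis
    by (simp add: lookup_single_sum sum.delta in_keys_iff)
qed

definition Xdiag :: "('N::finite, 'n::finite, 'r::comm_ring_1) xa_poly ^ 'N ^ 'N" where
  "Xdiag = (\<chi> i j. if i = j then Xmat $ i $ i else 0)"

text \<open>The restriction stays in the same polynomial ring, with the off-diagonal variables set
  to 0, so that all substitution lemmas still apply.\<close>

definition diag_restrict :: "('N::finite, 'n::finite, 'r::comm_ring_1) xa_poly \<Rightarrow>
    ('N, 'n, 'r) xa_poly" where
  "diag_restrict = xa_subst Xdiag Amat"

interpretation diag_restrict: module_hom xa_scale xa_scale diag_restrict
  unfolding diag_restrict_def by (rule xa_subst_hom)

text \<open>The monomial \<open>\<Prod>\<^sub>i A^{a\<^sub>i}_i (X^i_i)^{m\<^sub>i}\<close>, where \<open>u i = (a\<^sub>i, m\<^sub>i)\<close>.\<close>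

definition diag_monom :: "('N::finite \<Rightarrow> 'n \<times> nat) \<Rightarrow> ('N, 'n) xa_var \<Rightarrow>\<^sub>0 nat" where
  "diag_monom u = (\<Sum>i\<in>UNIV. Poly_Mapping.single (Inr (fst (u i), i)) 1
     + Poly_Mapping.single (Inl (i, i)) (snd (u i)))"

lemma lookup_diag_monom:
  "Poly_Mapping.lookup (diag_monom u) (Inr (a, i)) = (if fst (u i) = a then 1 else 0)"
  "Poly_Mapping.lookup (diag_monom u) (Inl (i, j)) = (if i = j then snd (u i) else 0)"
proof -
  have "Poly_Mapping.lookup (diag_monom u) (Inr (a, i))
      = (\<Sum>j\<in>UNIV. if j = i then (if fst (u j) = a then 1 else 0) else 0)"
    unfolding diag_monom_def lookup_sum by (intro sum.cong)
        (auto simp: lookup_add lookup_single when_def)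
  then show "Poly_Mapping.lookup (diag_monom u) (Inr (a, i)) = (if fst (u i) = a then 1 else 0)"
    by simp
  have "Poly_Mapping.lookup (diag_monom u) (Inl (i, j))
      = (\<Sum>k\<in>UNIV. if k = i then (if k = j then snd (u k) else 0) else 0)"
    unfolding diag_monom_def lookup_sum by (intro sum.cong)
        (auto simp: lookup_add lookup_single when_def)
  then show "Poly_Mapping.lookup (diag_monom u) (Inl (i, j)) = (if i = j then snd (u i) else 0)"
    by simp
qed

lemma diag_monom_eq_iff: "diag_monom u = diag_monom u' \<longleftrightarrow> u = u'"
proof
  assume eq: "diag_monom u = diag_monom u'"
  show "u = u'"
  proof
    fix i
    have "fst (u i) = fst (u' i)"
      using arg_cong [OF eq, of "\<lambda>m. Poly_Mapping.lookup m (Inr (fst (u i), i))"]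
      by (simp add: lookup_diag_monom split: if_splits)
    moreover have "snd (u i) = snd (u' i)"
      using arg_cong [OF eq, of "\<lambda>m. Poly_Mapping.lookup m (Inl (i, i))"]
      by (simp add: lookup_diag_monom)
    ultimately show "u i = u' i" by (rule prod_eqI)
  qed
qed simp

lemma prod_diag_monom:
  fixes u :: "'N::finite \<Rightarrow> 'n::finite \<times> nat"
  shows "(\<Prod>i\<in>UNIV. Amat $ fst (u i) $ p i * Xmat $ p i $ p i ^ snd (u i))
    = (Poly_Mapping.single (\<Sum>i\<in>UNIV. Poly_Mapping.single (Inr (fst (u i), p i)) 1
        + Poly_Mapping.single (Inl (p i, p i)) (snd (u i))) 1 :: ('N, 'n, 'r::comm_ring_1) xa_poly)"
proof -
  have pow: "Poly_Mapping.single (Poly_Mapping.single v (Suc 0)) (1 :: 'r) ^ k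
      = Poly_Mapping.single (Poly_Mapping.single v k) 1" for v :: "('N, 'n) xa_var" and k :: nat
    by (induction k) (auto simp: mult_single single_add [symmetric])
  have "(\<Prod>i\<in>T. Amat $ fst (u i) $ p i * Xmat $ p i $ p i ^ snd (u i))
    = (Poly_Mapping.single (\<Sum>i\<in>T. Poly_Mapping.single (Inr (fst (u i), p i)) 1
        + Poly_Mapping.single (Inl (p i, p i)) (snd (u i))) 1
            :: ('N, 'n, 'r) xa_poly)" if "finite T" for T
    using that
    by (induction T) (simp_all add: Amat_def Xmat_def pow mult_single)
  then show ?thesis by simp
qed

lemma prod_diag_monom_permuted:
  fixes u :: "'N::finite \<Rightarrow> 'n::finite \<times> nat"
  assumes "p permutes UNIV"
  shows "(\<Prod>i\<in>UNIV. Amat $ fst (u i) $ p i * Xmat $ p i $ p i ^ snd (u i))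
    = (Poly_Mapping.single (diag_monom (u \<circ> inv p)) 1 :: ('N, 'n, 'r::comm_ring_1) xa_poly)"
proof -
  have bij: "bij_betw p UNIV UNIV" using permutes_bij [OF assms] .
  have "diag_monom (u \<circ> inv p) = (\<Sum>i\<in>UNIV. Poly_Mapping.single (Inr (fst (u i), p i)) 1
        + Poly_Mapping.single (Inl (p i, p i)) (snd (u i)))"
    unfolding diag_monom_def
    by (subst sum.reindex_bij_betw [OF bij, symmetric]) (simp add: permutes_inverses [OF assms])
  then show ?thesis by (simp add: prod_diag_monom)
qed

lemma mat_pow_Xdiag:
  "mat_pow Xdiag m = (\<chi> i j. if i = j then (Xmat
      :: ('N::finite, 'n::finite, 'r::comm_ring_1) xa_poly ^ 'N ^ 'N) $ i $ i ^ m else 0)"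
proof (induction m)
  case (Suc m)
  have "(mat_pow Xdiag m ** Xdiag :: ('N, 'n, 'r) xa_poly ^ 'N ^ 'N) $ i $ j
      = (\<Sum>k\<in>UNIV. if k = i then (if k = j then Xmat $ k $ k ^ m * Xmat $ k $ k else 0) else 0)"
          for i j
    unfolding matrix_matrix_mult_def Suc vec_lambda_beta by (intro sum.cong) (auto simp: Xdiag_def)
  then show ?case by (simp add: vec_eq_iff mult.commute)
qed (simp add: vec_eq_iff mat_def)

text \<open>For diagonal X the row of (a, m) has j-th entry A^a_j x_j^m, so each Leibniz term is a
  single monomial. Passing from p to its inverse preserves the sign.\<close>

lemma diag_restrict_epsilon_poly:
  fixes w :: "('n::finite \<times> nat) list"
  assumes w: "length w = CARD('N::{finite,linorder})"
  shows "diag_restrict (epsilon_poly w) = ((\<Sum>p\<in>{p. p permutes UNIV}.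
    Poly_Mapping.single (diag_monom ((\<lambda>i :: 'N. w ! index_of i) \<circ> p)) (of_int (sign p)))
      :: ('N, 'n, 'r::comm_ring_1) xa_poly)"
proof -
  let ?u = "\<lambda>i :: 'N. w ! index_of i"
  have row: "((Amat ** mat_pow Xdiag (snd x)) $ fst x :: (('N, 'n, 'r) xa_poly, 'N) vec) $ j
      = Amat $ fst x $ j * Xmat $ j $ j ^ snd x" for x j
    by (simp add: mat_pow_Xdiag matrix_matrix_mult_def if_distrib [of "\<lambda>x. _ * x"] cong: if_cong)
  have single: "of_int k * Poly_Mapping.single m 1
      = (Poly_Mapping.single m (of_int k) :: ('N, 'n, 'r) xa_poly)"
    for k m
    unfolding xa_const_of_int [symmetric] xa_const_def mult_single by simp
  have "diag_restrict (epsilon_poly w)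
      = ((\<Sum>p\<in>{p. p permutes UNIV}. of_int (sign p) *
          (\<Prod>i\<in>UNIV. Amat $ fst (?u i) $ p i * Xmat $ p i $ p i ^ snd (?u i)))
              :: ('N, 'n, 'r) xa_poly)"
    unfolding diag_restrict_def xa_subst_epsilon_poly [OF w] row_det_def det_def
    by (simp add: w row)
  also have "\<dots> = (\<Sum>p\<in>{p. p permutes UNIV}. Poly_Mapping.single (diag_monom (?u \<circ> inv p)) (of_int
      (sign p)))"
    by (intro sum.cong refl) (simp add: prod_diag_monom_permuted single)
  also have "\<dots> = (\<Sum>p\<in>{p. p permutes UNIV}. Poly_Mapping.single (diag_monom (?u \<circ> p)) (of_int
      (sign p)))"
    by (subst sum_permutations_inverse)
       (intro sum.cong refl, simp add: permutes_inv_inv sign_inverse permutes_imp_permutation)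
  finally show ?thesis .
qed

section \<open>Injectivity\<close>

lemma coords_fock_N:
  assumes "v \<in> fock_N N" "coords v S \<noteq> 0"
  shows "card S = N"
proof (rule ccontr)
  assume S: "card S \<noteq> N"
  have "coords (psi_word w :: ('a, 'b) fock) S = 0" if "length w = N" for w
  proof -
    have "coords (psi_word (map mode (map mode_index w)) :: ('a, 'b) fock) S = 0"
      unfolding coords_psi_word using S that
      by (auto simp: levi_civita_def distinct_card simp del: set_map)
    then show ?thesis by (simp only: map_mode_index)
  qed
  with assms(1) have "coords v S = 0"
    unfolding fock_N_def
  proof (induction v rule: fock.span_induct_alt)
    case base
    then show ?case using coords_scale [of 0 0 S] by simp
  qed (auto simp: coords_add coords_scale)
  with assms(2) show False by simp
qed

text \<open>The coordinate at \<open>T\<close> is the coefficient of the monomial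
  \<open>diag_monom (u T)\<close> in the restriction, where \<open>u T\<close> lists the modes of
  \<open>T\<close> in increasing order of index.\<close>

lemma fock_to_xa_inj:
  fixes v :: "('n::finite, complex) fock"
  assumes v: "v \<in> fock_N CARD('N)"
    and 0: "fock_to_xa v = (0 :: ('N::{finite,linorder}, 'n, complex) xa_poly)"
  shows "v = 0"
proof -
  let ?K = "{S. coords v S \<noteq> 0}"
  define u :: "nat set \<Rightarrow> 'N \<Rightarrow> 'n \<times> nat" where
    "u S i = mode (sorted_list_of_set S ! index_of i)" for S i
  have card: "card S = CARD('N)" "finite S" if "S \<in> ?K" for S
    using coords_fock_N [OF v] that card.infinite [of S] by fastforce+
  have u: "u S = (\<lambda>i. map mode (sorted_list_of_set S) ! index_of i)" if "S \<in> ?K" for S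
    using card [OF that] by (simp add: u_def fun_eq_iff)
  have range_u: "range (u S) = mode ` S" if "S \<in> ?K" for S
  proof -
    have "range (\<lambda>i :: 'N. sorted_list_of_set S ! index_of i)
        = (!) (sorted_list_of_set S) ` {..<CARD('N)}"
      using bij_index_of [where 'N = 'N] by (simp add: bij_betw_def flip: image_image)
    also have "\<dots> = S"
      using card [OF that] by (metis atLeast0LessThan length_sorted_list_of_set list.set_map
          map_nth set_sorted_list_of_set set_upt)
    finally show ?thesis unfolding u_def by (metis (no_types) image_image)
  qed
  have inj_u: "inj (u S)" if "S \<in> ?K" for S
    using card [OF that] by (auto simp: inj_def u_def nth_eq_iff_index_eq)
  have coeff: "Poly_Mapping.lookup (diag_restrict (epsilon_poly (map mode (sorted_list_of_set S)))
        :: ('N, 'n, complex) xa_poly) (diag_monom (u T)) = (if S = T then 1 else 0)"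
    if S: "S \<in> ?K" and T: "T \<in> ?K" for S T
  proof -
    \<comment> \<open>The range of the function recovers the set of modes; after that, injectivity
      of \<open>u S\<close> forces the permutation to be the identity.\<close>
    have "u S \<circ> p = u T \<longleftrightarrow> S = T \<and> p = id" if p: "p permutes UNIV" for p
    proof
      assume eq: "u S \<circ> p = u T"
      then have "range (u T) = range (u S)"
        using permutes_surj [OF p] by (metis image_comp)
      then have "(mode ` S :: ('n \<times> nat) set)
          = mode ` T" using range_u [OF S] range_u [OF T] by simp
      then have "S = T" by (metis (no_types, lifting) image_iff mode_eq_iff subsetI subset_antisym)
      moreover from this have "p = id"
        using eq inj_u [OF S] by (auto simp: fun_eq_iff inj_def)
      ultimately show "S = T \<and> p = id" by simp
    qed auto
    then have "(\<Sum>p\<in>{p. p permutes UNIV}. if diag_monom (u S \<circ> p)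
        = diag_monom (u T) then complex_of_int (sign p) else 0)
        = (\<Sum>p\<in>{p :: 'N \<Rightarrow> 'N. p permutes UNIV}. if p = id then (if S = T then 1 else 0) else 0)"
      by (intro sum.cong refl) (auto simp: diag_monom_eq_iff sign_id)
    moreover have "length (map mode (sorted_list_of_set S) :: ('n \<times> nat) list) = CARD('N)"
      using card [OF S] by simp
    ultimately show ?thesis
      unfolding diag_restrict_epsilon_poly [OF \<open>length _ = _\<close>] lookup_single_sum u [OF S, symmetric]
      by (simp add: permutes_id)
  qed
  have "coords v T = 0" if T: "T \<in> ?K" for T
  proof -
    have "fock_to_xa v = (\<Sum>S\<in>?K. xa_scale (coords v S) (epsilon_poly (map mode
        (sorted_list_of_set S)))
        :: ('N, 'n, complex) xa_poly)"
      unfolding fock_to_xa_def coord_sum_def by (intro sum.cong refl) (use card(1) in simp)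
    then have "0 = diag_restrict (\<Sum>S\<in>?K. xa_scale (coords v S) (epsilon_poly (map mode
        (sorted_list_of_set S)))
        :: ('N, 'n, complex) xa_poly)"
      using 0 by (simp add: diag_restrict.zero)
    then have "0 = Poly_Mapping.lookup (\<Sum>S\<in>?K. xa_scale (coords v S)
        (diag_restrict (epsilon_poly (map mode (sorted_list_of_set S))))
            :: ('N, 'n, complex) xa_poly) (diag_monom (u T))"
      by (metis (no_types, lifting) diag_restrict.scale diag_restrict.sum lookup_zero sum.cong)
    also have "\<dots> = (\<Sum>S\<in>?K. coords v S * (if S = T then 1 else 0))"
      using coeff [OF _ T] by (simp add: lookup_sum lookup_xa_scale)
    also have "\<dots> = coords v T"
      using T finite_coords [of v] by (simp add: if_distrib [of "\<lambda>x. _ * x"] cong: if_cong)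
    finally show ?thesis by simp
  qed
  then have "?K = {}" by auto
  then show ?thesis
    using coord_sum_psi [OF v] by (simp add: coord_sum_def)
qed

section \<open>The restriction of a semi-invariant\<close>

lemma Xdiag_scaling: "Xdiag = (\<chi> i j. xa_const (if i = j then 1 else 0) * Xmat $ i $ j)"
  by (simp add: Xdiag_def vec_eq_iff)

text \<open>Off-diagonal variables have weight 0, so a monomial containing one is killed, while the
  others survive by \<open>0 ^ 0 = 1\<close>.\<close>

lemma lookup_diag_restrict:
  fixes p :: "('N::finite, 'n::finite, 'r::comm_ring_1) xa_poly"
  shows "Poly_Mapping.lookup (diag_restrict p) m
     = (if \<forall>i j. i \<noteq> j \<longrightarrow> Poly_Mapping.lookup m (Inl (i, j))
         = 0 then Poly_Mapping.lookup p m else 0)"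
proof -
  have "diag_restrict p = xa_subst (\<chi> i j. xa_const (if i = j then 1 else 0) * Xmat $ i $ j)
      (\<chi> a i. xa_const 1 * Amat $ a $ i) p"
    unfolding diag_restrict_def by (simp add: Xdiag_scaling)
  then have *: "Poly_Mapping.lookup (diag_restrict p) m = Poly_Mapping.lookup p m *
      (\<Prod>v\<in>UNIV. (case v of Inl (i, j) \<Rightarrow> if i = j then 1 else 0 | Inr
          (a, i) \<Rightarrow> 1) ^ Poly_Mapping.lookup m v)"
    by (simp only: lookup_xa_subst_scaling)
  show ?thesis
  proof (cases "\<forall>i j. i \<noteq> j \<longrightarrow> Poly_Mapping.lookup m (Inl (i, j)) = 0")
    case True
    then have "(case v of Inl (i, j) \<Rightarrow> if i = j then 1 else 0 | Inr
        (a, i) \<Rightarrow> 1) ^ Poly_Mapping.lookup m v = (1 :: 'r)"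
      for v by (auto split: sum.split)
    then show ?thesis using True by (simp add: *)
  next
    case False
    then obtain i j where ij: "i \<noteq> j" "Poly_Mapping.lookup m (Inl (i, j)) \<noteq> 0" by blast
    then have "(\<Prod>v\<in>UNIV. (case v of Inl (i, j) \<Rightarrow> if i = j then 1 else 0 | Inr (a, i) \<Rightarrow> 1)
        ^ Poly_Mapping.lookup m v) = (0 :: 'r)"
      by (intro prod_zero bexI [of _ "Inl (i, j)"]) (auto simp: power_0_left)
    then show ?thesis using False by (simp only: * mult_zero_right if_False)
  qed
qed

lemma diag_restrict_off_diagonal:
  assumes "Poly_Mapping.lookup (diag_restrict p) m \<noteq> 0" "i \<noteq> j"
  shows "Poly_Mapping.lookup m (Inl (i, j)) = 0"
  using assms unfolding lookup_diag_restrict by presburger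

lemma xa_subst_const_mat: "xa_subst Y B (const_mat g $ i $ j) = const_mat g $ i $ j"
  by (simp add: const_mat_def xa_subst_const)

text \<open>Semi-invariance is specialised at diagonal X; the entries of g are constants and
  unaffected.\<close>

lemma semi_invariant_diag:
  fixes g :: "complex ^ 'N ^ 'N"
  assumes "p \<in> semi_invariants" "invertible g"
  shows "xa_subst (const_mat g ** Xdiag ** const_mat (matrix_inv g)) (Amat ** const_mat
      (matrix_inv g)) p
    = xa_scale (inverse (det g)) (diag_restrict p)"
proof -
  let ?h = "const_mat (matrix_inv g) :: (('N, 'a, complex) xa_poly, 'N) vec ^ 'N"
  have "xa_subst Xdiag Amat ((const_mat g ** Xmat ** ?h) $ i $ j)
      = (const_mat g ** Xdiag ** ?h) $ i $ j" for i j
    unfolding xa_subst_matrix_mult xa_subst_const_mat xa_subst_Xmat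
    by (simp add: matrix_matrix_mult_def)
  moreover have "xa_subst Xdiag Amat ((Amat ** ?h) $ a $ i) = (Amat ** ?h) $ a $ i" for a i
    unfolding xa_subst_matrix_mult xa_subst_const_mat xa_subst_Amat
    by (simp add: matrix_matrix_mult_def)
  ultimately have "xa_subst (const_mat g ** Xdiag ** ?h) (Amat ** ?h) p
      = diag_restrict (xa_subst (const_mat g ** Xmat ** ?h) (Amat ** ?h) p)"
    by (simp add: diag_restrict_def xa_subst_xa_subst)
  also have "\<dots> = xa_scale (inverse (det g)) (diag_restrict p)"
    using assms by (simp add: semi_invariants_def diag_restrict.scale)
  finally show ?thesis .
qed

section \<open>The diagonal torus: degree one in each column of A\<close>

lemma diag_mult:
  fixes c d :: "'N::finite \<Rightarrow> 'a::comm_ring_1"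
  shows "(\<chi> i j. if i = j then c i else 0) ** (\<chi> i j. if i = j then d i else 0)
    = (\<chi> i j. if i = j then c i * d i else 0)"
proof -
  have "(\<Sum>l\<in>UNIV. (if i = l then c i else 0) * (if l = j then d l else 0))
      = (\<Sum>l\<in>UNIV. if i = l then (if l = j then c l * d l else 0) else 0)" for i j
    by (intro sum.cong) auto
  then show ?thesis by (simp add: vec_eq_iff matrix_matrix_mult_def)
qed

text \<open>Take g diagonal with k-th entry 1/2 and all others 1. It commutes with diagonal
  matrices, doubles column k of A through g^{-1}, and has det(g)^{-1} = 2. A monomial of degree d in
  that column therefore satisfies 2^d = 2.\<close>

lemma diag_restrict_multilinear:
  fixes p :: "('N::finite, 'n::finite, complex) xa_poly"
  assumes p: "p \<in> semi_invariants" and m: "Poly_Mapping.lookup (diag_restrict p) m \<noteq> 0"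
  shows "(\<Sum>a\<in>UNIV. Poly_Mapping.lookup m (Inr (a, k))) = 1"
proof -
  define s where "s = (\<lambda>i. if i = k then 2 else 1 :: complex)"
  define g :: "complex ^ 'N ^ 'N" where "g = (\<chi> i j. if i = j then 1 / s i else 0)"
  define g' :: "complex ^ 'N ^ 'N" where "g' = (\<chi> i j. if i = j then s i else 0)"
  have s: "s i \<noteq> 0" for i by (simp add: s_def)
  have inv: "g ** g' = mat 1" "g' ** g = mat 1"
    unfolding g_def g'_def diag_mult by (simp_all add: s mat_def vec_eq_iff)
  then have g: "invertible g" "matrix_inv g = g'"
    by (auto simp: invertible_def intro: matrix_inv_eqI)
  have cg: "const_mat g = (\<chi> i j. if i = j then xa_const (1 / s i) else 0)"
    and cg': "const_mat g' = (\<chi> i j. if i = j then xa_const (s i) else 0)"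
    by (simp_all add: const_mat_def g_def g'_def vec_eq_iff)
  have X: "const_mat g ** Xdiag ** const_mat g' = (Xdiag :: ('N, 'n, complex) xa_poly ^ 'N ^ 'N)"
  proof -
    have "xa_const (1 / s i) * x * xa_const (s i) = x * xa_const (1 / s i * s i)"
      for i and x :: "('N, 'n, complex) xa_poly"
      by (simp only: xa_const_mult mult_ac)
    then have "xa_const (1 / s i) * x * xa_const (s i)
        = x" for i and x :: "('N, 'n, complex) xa_poly"
      using s [of i] by simp
    then show ?thesis unfolding cg cg' Xdiag_def diag_mult by (simp add: vec_eq_iff)
  qed
  have A: "Amat ** const_mat g' = ((\<chi> a i. xa_const (s i) * Amat $ a $ i)
      :: ('N, 'n, complex) xa_poly ^ 'N ^ 'n)"
  proof -
    have "(\<Sum>l\<in>UNIV. (Amat :: ('N, 'n, complex) xa_poly ^ 'N ^ 'n) $ a $ l * (if l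
        = i then xa_const (s l) else 0))
        = (\<Sum>l\<in>UNIV. if l = i then xa_const (s l) * Amat $ a $ l else 0)" for a i
      by (intro sum.cong) (auto simp: mult.commute)
    then show ?thesis by (simp add: vec_eq_iff matrix_matrix_mult_def cg')
  qed
  have "det g' = 2"
  proof -
    have "det g' = (\<Prod>i\<in>UNIV. s i)"
      by (subst det_diagonal) (simp_all add: g'_def)
    then show ?thesis by (simp add: s_def)
  qed
  then have "inverse (det g) = 2"
    using det_matrix_inv [OF g(1)] by (simp add: g(2))
  then have "xa_subst Xdiag (\<chi> a i. xa_const (s i) * Amat $ a $ i) p = xa_scale 2 (diag_restrict p)"
    using semi_invariant_diag [OF p g(1)] by (simp add: g(2) X A)
  then have weight: "Poly_Mapping.lookup p m * (\<Prod>v\<in>UNIV. (case v of Inl (i, j) \<Rightarrow> if i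
      = j then 1 else 0
      | Inr (a, i) \<Rightarrow> s i) ^ Poly_Mapping.lookup m v) = 2 * Poly_Mapping.lookup (diag_restrict p) m"
    unfolding Xdiag_scaling lookup_xa_subst_scaling [symmetric] lookup_xa_scale [symmetric] by simp
  have eq: "Poly_Mapping.lookup (diag_restrict p) m = Poly_Mapping.lookup p m"
    using m unfolding lookup_diag_restrict by presburger
  define e where "e v = (case v of Inl (i, j) \<Rightarrow> 0
    | Inr (a, i) \<Rightarrow> if i = k then Poly_Mapping.lookup m v else 0)" for v
  have pow: "(case v of Inl (i, j) \<Rightarrow> if i = j then 1 else 0 | Inr
      (a, i) \<Rightarrow> s i) ^ Poly_Mapping.lookup m v = 2 ^ e v"
    for v
    using diag_restrict_off_diagonal [OF m] by (auto simp: e_def s_def split: sum.split)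
  have "(2 :: complex) ^ (\<Sum>v\<in>UNIV. e v) = 2"
    using weight m unfolding pow eq by (simp add: power_sum)
  \<comment> \<open>The exponents are compared over the reals, where powers of 2 are strictly
    monotone.\<close>
  then have "complex_of_real (2 ^ (\<Sum>v\<in>UNIV. e v)) = of_real (2 ^ 1)" by simp
  then have "(2 :: real) ^ (\<Sum>v\<in>UNIV. e v) = 2 ^ 1" by (simp only: of_real_eq_iff)
  then have "(\<Sum>v\<in>UNIV. e v) = 1" by (simp only: power_inject_exp)
  moreover have "(\<Sum>v\<in>UNIV. e v) = (\<Sum>v\<in>range (\<lambda>a. Inr (a, k)). e v)"
    by (rule sum.mono_neutral_right) (auto simp: e_def split: sum.split)
  moreover have "\<dots> = (\<Sum>a\<in>UNIV. Poly_Mapping.lookup m (Inr (a, k)))"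
    by (subst sum.reindex) (auto simp: inj_on_def e_def)
  ultimately show ?thesis by simp
qed

lemma diag_restrict_monom:
  fixes p :: "('N::finite, 'n::finite, complex) xa_poly"
  assumes p: "p \<in> semi_invariants" and m: "Poly_Mapping.lookup (diag_restrict p) m \<noteq> 0"
  shows "\<exists>u. m = diag_monom u"
proof -
  have "\<exists>a. \<forall>b. Poly_Mapping.lookup m (Inr (b, i)) = (if a = b then 1 else 0)" for i
  proof -
    obtain a where "Poly_Mapping.lookup m (Inr (a, i)) = 1"
        "\<forall>b. a \<noteq> b \<longrightarrow> Poly_Mapping.lookup m (Inr (b, i)) = 0"
      using diag_restrict_multilinear [OF p m, of i, unfolded sum_eq_1_iff [OF
          finite_class.finite_UNIV]]
      by blast
    then show ?thesis by (intro exI [of _ a]) auto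
  qed
  then obtain a where a: "\<And>i b. Poly_Mapping.lookup m (Inr (b, i)) = (if a i = b then 1 else 0)"
    by metis
  have off: "Poly_Mapping.lookup m (Inl (i, j)) = 0" if "i \<noteq> j" for i j
    using diag_restrict_off_diagonal [OF m that] .
  have "m = diag_monom (\<lambda>i. (a i, Poly_Mapping.lookup m (Inl (i, i))))"
  proof (rule poly_mapping_eqI)
    fix v
    show "Poly_Mapping.lookup m v
        = Poly_Mapping.lookup (diag_monom (\<lambda>i. (a i, Poly_Mapping.lookup m (Inl (i, i))))) v"
      by (cases v) (auto simp: lookup_diag_monom a off)
  qed
  then show ?thesis by blast
qed

section \<open>Permutation matrices: antisymmetry\<close>

lemma permutation_matrix_left:
  "(\<chi> i. (mat 1 :: 'a::comm_ring_1 ^ 'N ^ 'N) $ \<pi> i) ** M = (\<chi> i. M $ \<pi> i)"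
  by (simp add: vec_eq_iff matrix_matrix_mult_def mat_def if_distrib [of "\<lambda>x. x * _"] cong: if_cong)

lemma permutation_matrix_right:
  "M ** transpose (\<chi> i. (mat 1 :: 'a::comm_ring_1 ^ 'N ^ 'N) $ \<pi> i) = (\<chi> i j. M $ i $ \<pi> j)"
  by (simp add: vec_eq_iff matrix_matrix_mult_def mat_def transpose_def if_distrib [of "\<lambda>x. _
      * x"] cong: if_cong)

text \<open>Conjugation by a permutation matrix permutes the diagonal entries and keeps the matrix
  diagonal. Its determinant is the sign, which is its own inverse.\<close>

lemma diag_restrict_permute:
  fixes p :: "('N::finite, 'n::finite, complex) xa_poly"
  assumes p: "p \<in> semi_invariants" and \<pi>: "\<pi> permutes UNIV"
  shows "xa_subst (\<chi> i j. Xmat $ \<pi> i $ \<pi> j) (\<chi> a i. Amat $ a $ \<pi> i) (diag_restrict p)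
    = xa_scale (of_int (sign \<pi>)) (diag_restrict p)"
proof -
  define g :: "complex ^ 'N ^ 'N" where "g = (\<chi> i. mat 1 $ \<pi> i)"
  have inj: "\<pi> i = \<pi> j \<longleftrightarrow> i = j" for i j
    using permutes_inj [OF \<pi>] by (auto simp: inj_def)
  have gt: "g ** transpose g = mat 1"
    unfolding g_def permutation_matrix_right by (simp add: mat_def vec_eq_iff inj)
  then have tg: "transpose g ** g = mat 1" by (rule matrix_left_right_inverse1)
  have g: "invertible g" "matrix_inv g = transpose g"
    using gt tg by (auto simp: invertible_def intro: matrix_inv_eqI)
  have det: "det g = of_int (sign \<pi>)"
    unfolding g_def by (simp add: det_permute_rows [OF \<pi>])
  have cg: "const_mat g = (\<chi> i. mat 1 $ \<pi> i)"
    "const_mat (transpose g) = transpose (\<chi> i. mat 1 $ \<pi> i)"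
    by (auto simp: const_mat_def g_def vec_eq_iff mat_def transpose_def)
  have "const_mat g ** Xdiag ** const_mat (transpose g)
      = (\<chi> i j. if i = j then Xmat $ \<pi> i $ \<pi> i else (0 :: ('N, 'n, complex) xa_poly))"
    unfolding cg permutation_matrix_left permutation_matrix_right
        by (simp add: vec_eq_iff Xdiag_def inj)
  moreover have "Amat ** const_mat (transpose g)
      = ((\<chi> a i. Amat $ a $ \<pi> i) :: ('N, 'n, complex) xa_poly ^ 'N ^ 'n)"
    unfolding cg permutation_matrix_right ..
  moreover have "xa_subst (\<chi> i j. Xmat $ \<pi> i $ \<pi> j) (\<chi> a i. Amat $ a $ \<pi> i) (diag_restrict p)
      = xa_subst (\<chi> i j. if i = j then Xmat $ \<pi> i $ \<pi> i else 0) (\<chi> a i. Amat $ a $ \<pi> i) p"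
    unfolding diag_restrict_def xa_subst_xa_subst
    by (rule arg_cong2 [where f = "\<lambda>Y B. xa_subst Y B p"])
       (auto simp: vec_eq_iff Xdiag_def xa_subst_Xmat xa_subst_Amat)
  ultimately show ?thesis
    using semi_invariant_diag [OF p g(1)] by (simp add: g(2) det sign_def split: if_splits)
qed

lemma xa_subst_prod: "xa_subst Y B (prod f T) = (\<Prod>i\<in>T. xa_subst Y B (f i))"
  by (induction T rule: infinite_finite_induct) (simp_all add: xa_subst_mult)

lemma xa_subst_power: "xa_subst Y B (p ^ k) = xa_subst Y B p ^ k"
  by (induction k) (simp_all add: xa_subst_mult)

lemma xa_subst_permute_diag_monom:
  fixes u :: "'N::finite \<Rightarrow> 'n::finite \<times> nat"
  assumes \<pi>: "\<pi> permutes UNIV"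
  shows "xa_subst (\<chi> i j. Xmat $ \<pi> i $ \<pi> j) (\<chi> a i. Amat $ a $ \<pi> i)
      (Poly_Mapping.single (diag_monom u) c :: ('N, 'n, 'r::comm_ring_1) xa_poly)
    = Poly_Mapping.single (diag_monom (u \<circ> inv \<pi>)) c"
proof -
  let ?s = "xa_subst (\<chi> i j. Xmat $ \<pi> i $ \<pi> j) (\<chi> a i. Amat $ a $ \<pi> i) :: ('N, 'n, 'r) xa_poly \<Rightarrow> _"
  interpret S: module_hom xa_scale xa_scale ?s by (rule xa_subst_hom)
  have single: "Poly_Mapping.single m c = xa_scale c (Poly_Mapping.single m 1
      :: ('N, 'n, 'r) xa_poly)" for m
    by (simp add: xa_scale_single)
  have "Poly_Mapping.single (diag_monom u) 1
      = (\<Prod>i\<in>UNIV. Amat $ fst (u i) $ i * Xmat $ i $ i ^ snd (u i) :: ('N, 'n, 'r) xa_poly)"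
    using prod_diag_monom_permuted [OF permutes_id, of u, where 'r = 'r] by (simp add: inv_id)
  then have "?s (Poly_Mapping.single (diag_monom u) 1)
      = (\<Prod>i\<in>UNIV. Amat $ fst (u i) $ \<pi> i * Xmat $ \<pi> i $ \<pi> i ^ snd (u i))"
    by (simp add: xa_subst_prod xa_subst_mult xa_subst_power xa_subst_Xmat xa_subst_Amat)
  also have "\<dots> = Poly_Mapping.single (diag_monom (u \<circ> inv \<pi>)) 1"
    by (rule prod_diag_monom_permuted [OF \<pi>])
  finally show ?thesis by (subst (1 2) single) (simp only: S.scale)
qed

text \<open>By antisymmetry the restriction equals each of its signed permuted copies. Summed over
  all permutations, the copies of each monomial form the restricted image of a word.\<close>

lemma diag_restrict_surj:
  fixes p :: "('N::{finite,linorder}, 'n::finite, complex) xa_poly"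
  assumes p: "p \<in> semi_invariants"
  shows "\<exists>v\<in>fock_N CARD('N). diag_restrict (fock_to_xa v) = diag_restrict p"
proof -
  let ?q = "diag_restrict p"
  let ?P = "{\<pi> :: 'N \<Rightarrow> 'N. \<pi> permutes UNIV}"
  let ?K = "Poly_Mapping.keys ?q"
  have "\<forall>m\<in>?K. \<exists>u. m = diag_monom u"
    using diag_restrict_monom [OF p] by (auto simp: in_keys_iff)
  then obtain u where u: "\<And>m. m \<in> ?K \<Longrightarrow> m = diag_monom (u m)" by metis
  define c where "c = Poly_Mapping.lookup ?q"
  define w where "w m = map (u m) (sorted_list_of_set UNIV)" for m
  have len: "length (w m) = CARD('N)" for m by (simp add: w_def)
  have nth_w: "(\<lambda>i. w m ! index_of i) = u m" for m
    by (simp add: w_def nth_sorted_UNIV)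
  have q: "?q = (\<Sum>m\<in>?K. Poly_Mapping.single (diag_monom (u m)) (c m))"
    by (subst xa_poly_expand) (intro sum.cong refl, simp add: c_def flip: u)
  have fin: "finite ?P" by (simp add: finite_permutations)
  have "id \<in> ?P" by (simp add: permutes_id)
  then have "card ?P \<noteq> 0" using fin by (metis card_0_eq empty_iff)
  then have card: "complex_of_nat (card ?P) \<noteq> 0" by (simp only: of_nat_eq_0_iff not_False_eq_True)
  have sign: "of_int (sign \<pi>) * (of_int (sign \<pi>) * x) = (x :: complex)" for \<pi> :: "'N \<Rightarrow> 'N" and x
    by (simp add: sign_def)
  have average: "?q = (\<Sum>m\<in>?K. Poly_Mapping.single (diag_monom (u m \<circ> inv \<pi>)) (of_int (sign \<pi>)
      * c m))"
    if \<pi>: "\<pi> permutes UNIV" for \<pi>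
  proof -
    have "?q = xa_scale (of_int (sign \<pi>)) (xa_scale (of_int (sign \<pi>)) ?q)"
      using sign [of \<pi> 1] by simp
    also have "\<dots> = xa_scale (of_int (sign \<pi>))
        (xa_subst (\<chi> i j. Xmat $ \<pi> i $ \<pi> j) (\<chi> a i. Amat $ a $ \<pi> i) ?q)"
      by (simp only: diag_restrict_permute [OF p \<pi>])
    also have "\<dots> = (\<Sum>m\<in>?K. Poly_Mapping.single (diag_monom (u m \<circ> inv \<pi>)) (of_int (sign \<pi>) * c m))"
      by (subst q) (simp only: xa_subst_sum xa_subst_permute_diag_monom [OF \<pi>] xa.scale_sum_right
          xa_scale_single)
    finally show ?thesis .
  qed
  \<comment> \<open>\<open>card ?P\<close> is N!, the number of copies of the restriction produced
    by the determinants.\<close>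
  define v :: "('n, complex) fock" where
    "v = (\<Sum>m\<in>?K. fock_scale (c m / of_nat (card ?P)) (psi_word (w m)))"
  have "v \<in> fock_N CARD('N)"
    unfolding v_def fock_N_def
    by (intro fock.span_sum fock.span_scale fock.span_base) (use len in blast)
  moreover have "diag_restrict (fock_to_xa v) = ?q"
  proof -
    have "xa_scale (of_nat (card ?P)) (diag_restrict (fock_to_xa v) :: ('N, 'n, complex) xa_poly)
        = (\<Sum>m\<in>?K. xa_scale (c m) (diag_restrict (epsilon_poly (w m))))"
      using card
      by (simp add: v_def fock_to_xa.sum fock_to_xa.scale diag_restrict.sum diag_restrict.scale
          fock_to_xa_psi_word len xa.scale_sum_right)
    also have "\<dots> = (\<Sum>m\<in>?K. \<Sum>\<pi>\<in>?P. Poly_Mapping.single (diag_monom (u m \<circ> \<pi>)) (of_int (sign \<pi>)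
        * c m))"
      by (simp add: diag_restrict_epsilon_poly len nth_w xa.scale_sum_right xa_scale_single
          mult.commute)
    also have "\<dots> = (\<Sum>\<pi>\<in>?P. \<Sum>m\<in>?K. Poly_Mapping.single (diag_monom (u m \<circ> \<pi>)) (of_int (sign \<pi>)
        * c m))"
      by (rule sum.swap)
    also have "\<dots> = (\<Sum>\<pi>\<in>?P. \<Sum>m\<in>?K. Poly_Mapping.single (diag_monom (u m \<circ> inv \<pi>)) (of_int (sign \<pi>)
        * c m))"
      by (subst sum_permutations_inverse)
         (intro sum.cong refl, simp add: sign_inverse permutes_imp_permutation)
    also have "\<dots> = (\<Sum>\<pi>\<in>?P. ?q)"
      by (intro sum.cong refl average [symmetric]) simp
    also have "\<dots> = xa_scale (of_nat (card ?P)) ?q"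
      by (simp add: xa.scale_sum_left [symmetric, where f = "\<lambda>_. 1", simplified] xa_scale_def)
    finally have "xa_scale (1 / of_nat (card ?P)) (xa_scale (of_nat (card ?P)) (diag_restrict
        (fock_to_xa v)))
        = xa_scale (1 / of_nat (card ?P)) (xa_scale (of_nat (card ?P)) ?q)"
      by (rule arg_cong)
    moreover have "xa_scale (1 / k) (xa_scale k x) = x" if "k \<noteq> 0"
      for k and x :: "('N, 'n, complex) xa_poly"
      using that by simp
    ultimately show ?thesis using card by (simp only: not_False_eq_True)
  qed
  ultimately show ?thesis by blast
qed

section \<open>Density of the diagonalisable matrices\<close>

text \<open>With all variables but one fixed, a one-variable polynomial has infinitely many roots,
  so its coefficients vanish; then induction. The conclusion concerns a sum because several indices
  may share their exponents on the variables treated so far.\<close>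

lemma vanishing_coefficients:
  fixes e :: "'m \<Rightarrow> 'v \<Rightarrow> nat" and c :: "'m \<Rightarrow> 'a::idom"
  assumes "finite V" "finite K" and T: "\<And>v. infinite (T v)"
    and "\<And>x. (\<And>v. x v \<in> T v) \<Longrightarrow> (\<Sum>m\<in>K. c m * (\<Prod>v\<in>V. x v ^ e m v)) = 0"
    and "m0 \<in> K"
  shows "(\<Sum>m\<in>{m \<in> K. \<forall>v\<in>V. e m v = e m0 v}. c m) = 0"
  using assms(1,2,4,5)
proof (induction V arbitrary: K)
  case empty
  have "\<exists>t. t \<in> T v" for v using infinite_imp_nonempty [OF T] by blast
  then obtain x where "\<And>v. x v \<in> T v" by metis
  then show ?case using empty(2) [of x] by simp
next
  case (insert v V)
  let ?K = "{m \<in> K. e m v = e m0 v}"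
  have "(\<Sum>m\<in>?K. c m * (\<Prod>v\<in>V. x v ^ e m v)) = 0" if x: "\<And>v. x v \<in> T v" for x
  proof -
    define q where "q = (\<Sum>m\<in>K. monom (c m * (\<Prod>v\<in>V. x v ^ e m v)) (e m v))"
    have "poly q t = 0" if "t \<in> T v" for t
    proof -
      \<comment> \<open>The product binds \<open>v\<close>, so \<open>v'\<close> names the variable
        of the induction step.\<close>
      have "(\<Prod>v\<in>V. (x(v' := t)) v ^ e m v) = (\<Prod>v\<in>V. x v ^ e m v)" if "v' = v" for m v'
        using insert.hyps(2) that by (intro prod.cong) auto
      then have "(\<Sum>m\<in>K. c m * (\<Prod>v\<in>V. x v ^ e m v) * t ^ e m v)
          = (\<Sum>m\<in>K. c m * (\<Prod>w\<in>insert v V. (x(v := t)) w ^ e m w))"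
        using insert.hyps by (intro sum.cong) (auto simp: mult_ac)
      also have "\<dots> = 0" using x that by (intro insert.prems(2)) auto
      finally show ?thesis by (simp add: q_def poly_sum poly_monom)
    qed
    then have "T v \<subseteq> {t. poly q t = 0}" by auto
    with T [of v] have "q = 0" by (metis finite_subset poly_roots_finite)
    then have "coeff q (e m0 v) = 0" by simp
    moreover have "coeff q (e m0 v) = (\<Sum>m\<in>?K. c m * (\<Prod>v\<in>V. x v ^ e m v))"
      using insert.prems(1) by (simp add: q_def coeff_sum coeff_monom sum.inter_filter [symmetric])
    ultimately show ?thesis by simp
  qed
  then have "(\<Sum>m\<in>{m \<in> ?K. \<forall>v\<in>V. e m v = e m0 v}. c m) = 0"
    using insert.prems by (intro insert.IH) auto
  moreover have "{m \<in> ?K. \<forall>v\<in>V. e m v = e m0 v} = {m \<in> K. \<forall>v\<in>insert v V. e m v = e m0 v}"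
    by auto
  ultimately show ?case by simp
qed

definition const_rect :: "'r::comm_ring_1 ^ 'N ^ 'n \<Rightarrow> ('N, 'n, 'r) xa_poly ^ 'N ^ 'n" where
  "const_rect B = (\<chi> a i. xa_const (B $ a $ i))"

text \<open>Evaluation at a point is expressed as substitution of constants, so that it composes
  with the other substitutions.\<close>

lemma xa_subst_eval:
  fixes p :: "('N::finite, 'n::finite, 'r::comm_ring_1) xa_poly"
  shows "xa_subst (const_mat Y) (const_rect B) p
      = xa_const (\<Sum>m\<in>Poly_Mapping.keys p. Poly_Mapping.lookup p m *
     (\<Prod>v\<in>UNIV. (case v of Inl (i, j) \<Rightarrow> Y $ i $ j | Inr
         (a, i) \<Rightarrow> B $ a $ i) ^ Poly_Mapping.lookup m v))"
proof -
  have prod: "xa_const (prod f S) = (\<Prod>v\<in>S. xa_const (f v))" for f :: "('N, 'n) xa_var \<Rightarrow> 'r" and S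
    by (induction S rule: infinite_finite_induct) (simp_all add: xa_const_mult)
  have "(case v of Inl (i, j) \<Rightarrow> const_mat Y $ i $ j | Inr (a, i) \<Rightarrow> const_rect B $ a $ i)
      = xa_const (case v of Inl (i, j) \<Rightarrow> Y $ i $ j | Inr (a, i) \<Rightarrow> B $ a $ i)" for v
    by (auto simp: const_mat_def const_rect_def split: sum.split)
  then show ?thesis
    unfolding xa_subst_def by (simp add: xa_const_sum xa_const_mult prod xa_const_power)
qed

lemma xa_const_eq_0_iff: "xa_const c = 0 \<longleftrightarrow> c = 0"
  using arg_cong [of "xa_const c" 0 "\<lambda>p. Poly_Mapping.lookup p 0"] by (auto simp: xa_const_def)

lemma xa_poly_eq_0:
  fixes p :: "('N::finite, 'n::finite, 'r::idom) xa_poly"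
  assumes T: "\<And>i j. infinite (T i j)"
    and 0: "\<And>Y B. (\<And>i j. Y $ i $ j \<in> T i j) \<Longrightarrow> xa_subst (const_mat Y) (const_rect B) p = 0"
  shows "p = 0"
proof (rule ccontr)
  assume "p \<noteq> 0"
  then have "Poly_Mapping.keys p \<noteq> {}" by simp
  then obtain m0 where m0: "m0 \<in> Poly_Mapping.keys p" by blast
  \<comment> \<open>The entries of A range over the whole ring, which is infinite because it
    contains an infinite set.\<close>
  obtain i0 j0 where "infinite (T i0 j0)" using T by blast
  then have UNIV: "infinite (UNIV :: 'r set)" by (metis finite_subset subset_UNIV)
  let ?T = "\<lambda>v :: ('N, 'n) xa_var. case v of Inl (i, j) \<Rightarrow> T i j | Inr _ \<Rightarrow> UNIV"
  have "(\<Sum>m\<in>Poly_Mapping.keys p. Poly_Mapping.lookup p m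
      * (\<Prod>v\<in>UNIV. x v ^ Poly_Mapping.lookup m v)) = 0"
    if x: "\<And>v. x v \<in> ?T v" for x
  proof -
    have "(case v of Inl (i, j) \<Rightarrow> (\<chi> i j. x (Inl (i, j))) $ i $ j | Inr (a, i) \<Rightarrow> (\<chi> a i. x (Inr
        (a, i))) $ a $ i) = x v"
      for v by (auto split: sum.split)
    moreover have "x (Inl (i, j)) \<in> T i j" for i j using x [of "Inl (i, j)"] by simp
    ultimately have "xa_const (\<Sum>m\<in>Poly_Mapping.keys p. Poly_Mapping.lookup p m
        * (\<Prod>v\<in>UNIV. x v ^ Poly_Mapping.lookup m v))
        = (0 :: ('N, 'n, 'r) xa_poly)"
      using 0 [of "\<chi> i j. x (Inl (i, j))" "\<chi> a i. x (Inr (a, i))"] by (simp add: xa_subst_eval)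
    then show ?thesis
      by (simp only: xa_const_eq_0_iff)
  qed
  note vanish = this
  have "infinite (?T v)" for v using T UNIV by (auto split: sum.split)
  then have "(\<Sum>m\<in>{m \<in> Poly_Mapping.keys p. \<forall>v\<in>UNIV. Poly_Mapping.lookup m v
      = Poly_Mapping.lookup m0 v}.
      Poly_Mapping.lookup p m) = 0"
    using vanish m0 by (rule vanishing_coefficients [OF finite_class.finite_UNIV finite_keys])
  moreover have "{m \<in> Poly_Mapping.keys p. \<forall>v\<in>UNIV. Poly_Mapping.lookup m v
      = Poly_Mapping.lookup m0 v} = {m0}"
    using m0 by (auto intro: poly_mapping_eqI)
  ultimately show False using m0 by (simp add: in_keys_iff)
qed

section \<open>Diagonalisation by distinct eigenvalues\<close>

text \<open>Applying X - l_k removes the k-th term and multiplies the others by the nonzero numbers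
  l_j - l_k.\<close>

lemma eigenvectors_independent:
  fixes X :: "'a::field ^ 'N ^ 'N"
  assumes "finite S" and eigen: "\<And>k. X *v v k = l k *s v k" "\<And>k. v k \<noteq> 0" and "inj l"
    and "(\<Sum>k\<in>S. c k *s v k) = 0" "j \<in> S"
  shows "c j = 0"
  using assms(1,5,6)
proof (induction S arbitrary: c j)
  case (insert k S)
  have "0 = X *v (\<Sum>j\<in>insert k S. c j *s v j) - l k *s (\<Sum>j\<in>insert k S. c j *s v j)"
    by (simp only: insert.prems(1) matrix_vector_mult_0_right vector_smult_rzero diff_self)
  also have "\<dots> = (\<Sum>j\<in>insert k S. (c j * (l j - l k)) *s v j)"
    by (simp add: vec.linear_sum [OF matrix_vector_mul_linear_gen] matrix_vector_mult_scaleR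
        vector_scalar_commute eigen sum_cmul [symmetric] sum_subtractf [symmetric] del: sum.insert)
       (simp add: vec_eq_iff algebra_simps)
  also have "\<dots> = (\<Sum>j\<in>S. (c j * (l j - l k)) *s v j)"
    using insert.hyps by simp
  finally have "c j * (l j - l k) = 0" if "j \<in> S" for j
    using that by (intro insert.IH) auto
  then have S: "c j = 0" if "j \<in> S" for j
    using that insert.hyps(2) \<open>inj l\<close> by (fastforce simp: inj_def)
  then have "c k *s v k = 0" using insert.prems(1) insert.hyps by simp
  then have "c k = 0" using eigen(2) [of k] by (simp add: vector_mul_eq_0)
  then show ?case using S insert.prems(2) by auto
qed simp

lemma matrix_vector_mult_columns:
  "(\<chi> i k. v k $ i) *v (c :: 'a::comm_semiring_1 ^ 'N) = (\<Sum>k\<in>UNIV. c $ k *s v k)"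
  by (simp add: vec_eq_iff matrix_vector_mult_def mult.commute)

lemma diagonalisable_of_distinct_eigenvalues:
  fixes X :: "'a::field ^ 'N ^ 'N"
  assumes "inj l" "\<And>k. det (X - mat (l k)) = 0"
  shows "\<exists>P. det P \<noteq> 0 \<and> X ** P = P ** (\<chi> i j. if i = j then l i else 0)"
proof -
  have "\<exists>v. v \<noteq> 0 \<and> X *v v = l k *s v" for k
  proof -
    have "\<not> invertible (X - mat (l k))" using assms(2) by (simp add: invertible_det_nz)
    then obtain v where "v \<noteq> 0" "(X - mat (l k)) *v v = 0"
      unfolding invertible_left_inverse matrix_left_invertible_ker by blast
    moreover have "mat (l k) *v v = l k *s v"
      by (simp add: vec_eq_iff matrix_vector_mult_def mat_def if_distrib [of "\<lambda>x. x
          * _"] cong: if_cong)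
    ultimately show ?thesis by (auto simp: matrix_vector_mult_diff_rdistrib)
  qed
  then obtain v where v: "\<And>k. v k \<noteq> 0" "\<And>k. X *v v k = l k *s v k" by metis
  define P where "P = (\<chi> i k. v k $ i)"
  have "c = 0" if "P *v c = 0" for c
  proof -
    have "c $ k = 0" for k
      using eigenvectors_independent [OF finite_class.finite_UNIV v(2) v(1) assms(1), of "\<lambda>k. c $
          k" k] that
      by (simp add: P_def matrix_vector_mult_columns)
    then show ?thesis by (simp add: vec_eq_iff)
  qed
  then have "det P \<noteq> 0"
    using matrix_left_invertible_ker [of P] by
        (simp add: invertible_left_inverse flip: invertible_det_nz)
  moreover have "X ** P = P ** (\<chi> i j. if i = j then l i else 0)"
  proof -
    have "(X ** P) $ i $ j = (X *v v j) $ i" for i j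
      by (simp add: P_def matrix_matrix_mult_def matrix_vector_mult_def)
    moreover have "(P ** (\<chi> i j. if i = j then l i else 0)) $ i $ j = l j * v j $ i" for i j
      by (simp add: P_def matrix_matrix_mult_def if_distrib [of "\<lambda>x. _ * x"] cong: if_cong)
    ultimately show ?thesis by (simp add: vec_eq_iff v(2))
  qed
  ultimately show ?thesis by blast
qed

text \<open>
  The characteristic polynomial of the diagonal matrix \<open>E\<close> with entries \<open>0, 1, \<dots>, N - 1\<close> changes
  sign on each interval \<open>[k - 1/2, k + 1/2]\<close>. This persists in a neighbourhood of \<open>E\<close>, where all
  real matrices therefore have \<open>N\<close> distinct real eigenvalues.
\<close>

lemma real_box_diagonalisable:
  obtains U :: "'N::{finite,linorder} \<Rightarrow> 'N \<Rightarrow> real set" where "\<And>i j. infinite (U i j)"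
    and "\<And>X :: ((real, 'N) vec, 'N) vec. (\<And>i j. X $ i $ j \<in> U i j) \<Longrightarrow>
           \<exists>P d. det P \<noteq> 0 \<and> X ** P = P ** (\<chi> i j. if i = j then d i else 0)"
proof -
  define e where "e k = real (index_of (k :: 'N))" for k
  define E :: "((real, 'N) vec, 'N) vec" where "E = (\<chi> i j. if i = j then e i else 0)"
  define W :: "((real, 'N) vec, 'N) vec set" where
    "W = (\<Inter>k. {X. det (X - mat (e k - 1/2)) * det (X - mat (e k + 1/2)) < 0})"
  have "continuous_on UNIV (\<lambda>X :: ((real, 'N) vec, 'N) vec. det (X - mat t))" for t
    unfolding det_def by (intro continuous_intros)
  then have "open W"
    unfolding W_def by (intro open_INT ballI open_Collect_less continuous_intros) auto
  have "E \<in> W"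
  proof -
    have det: "det (E - mat t) = (\<Prod>i\<in>UNIV. e i - t)" for t
      by (subst det_diagonal) (auto simp: E_def mat_def)
    have "det (E - mat (e k - 1/2)) * det (E - mat (e k + 1/2)) < 0" for k
    proof -
      \<comment> \<open>The factors pair up as differences of squares. The one for i = k is -1/4 and
        the others are at least 3/4.\<close>
      have "det (E - mat (e k - 1/2)) * det (E - mat (e k + 1/2)) = (\<Prod>i\<in>UNIV. (e i - e k)^2 - 1/4)"
        unfolding det prod.distrib [symmetric]
        by (intro prod.cong refl) (simp add: power2_eq_square algebra_simps)
      also have "\<dots> = - (1/4) * (\<Prod>i\<in>UNIV - {k}. (e i - e k)^2 - 1/4)"
        by (subst prod.remove [of _ k]) auto
      finally have eq: "det (E - mat (e k - 1/2)) * det (E - mat (e k + 1/2))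
          = - (1/4) * (\<Prod>i\<in>UNIV - {k}. (e i - e k)^2 - 1/4)" .
      have "(\<Prod>i\<in>UNIV - {k}. (e i - e k)^2 - 1/4) > 0"
      proof (rule prod_pos)
        fix i assume "i \<in> UNIV - {k}"
        then have "index_of i \<noteq> index_of k" by simp
        then have "\<bar>e i - e k\<bar> \<ge> 1" unfolding e_def by linarith
        then have "(e i - e k)^2 \<ge> 1" by (metis abs_le_square_iff abs_one one_power2)
        then show "(e i - e k)^2 - 1/4 > 0" by simp
      qed
      then show ?thesis unfolding eq by simp
    qed
    then show ?thesis by (simp add: W_def)
  qed
  \<comment> \<open>A matrix is a vector of rows, so unfolding the product topology twice gives a
    box of entries inside \<open>W\<close>.\<close>
  obtain A where A: "\<And>i. open (A i)" "\<And>i. E $ i \<in> A i" "\<And>X. (\<And>i. X $ i \<in> A i) \<Longrightarrow> X \<in> W"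
    using \<open>open W\<close> \<open>E \<in> W\<close> unfolding open_vec_def by metis
  have "\<exists>B. (\<forall>j. open (B j) \<and> E $ i $ j \<in> B j) \<and> (\<forall>x. (\<forall>j. x $ j \<in> B j) \<longrightarrow> x \<in> A i)" for i
    using A(1,2) [of i] unfolding open_vec_def by blast
  then obtain U where U: "\<And>i j. open (U i j)" "\<And>i j. E $ i $ j \<in> U i j"
      "\<And>i x. (\<And>j. x $ j \<in> U i j) \<Longrightarrow> x \<in> A i"
    by metis
  show ?thesis
  proof
    show "infinite (U i j)" for i j
    proof -
      obtain r where r: "r > 0" "ball (E $ i $ j) r \<subseteq> U i j"
        using U(1,2) openE by blast
      then have "infinite (ball (E $ i $ j) r)"
        unfolding ball_eq_greaterThanLessThan by (intro infinite_Ioo) simp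
      then show ?thesis using r(2) finite_subset by blast
    qed
  next
    fix X :: "((real, 'N) vec, 'N) vec" assume "\<And>i j. X $ i $ j \<in> U i j"
    then have X: "det (X - mat (e k - 1/2)) * det (X - mat (e k + 1/2)) < 0" for k
      using A(3) [of X] U(3) by (auto simp: W_def)
    let ?f = "\<lambda>t. det (X - mat t)"
    have "X - mat t = (\<chi> i j. X $ i $ j - t * (if i = j then 1 else 0))" for t
      by (simp add: vec_eq_iff mat_def)
    then have cont: "continuous_on S ?f" for S
      unfolding det_def by (simp only: vec_lambda_beta) (intro continuous_intros)
    have "\<exists>t. \<bar>t - e k\<bar> < 1/2 \<and> ?f t = 0" for k
    proof -
      have "\<exists>t. e k - 1/2 \<le> t \<and> t \<le> e k + 1/2 \<and> ?f t = 0"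
        using X [of k] IVT' [of ?f "e k - 1/2" 0 "e k + 1/2"] IVT2' [of ?f "e k
            + 1/2" 0 "e k - 1/2"] cont
        by (auto simp: mult_less_0_iff)
      then obtain t where t: "e k - 1/2 \<le> t" "t \<le> e k + 1/2" "?f t = 0" by blast
      \<comment> \<open>Neighbouring closed intervals share an endpoint, so distinctness of the
        eigenvalues requires roots in the interior.\<close>
      moreover have "t \<noteq> e k - 1/2" "t \<noteq> e k + 1/2" using X [of k] t(3) by auto
      ultimately have "e k - 1/2 < t" "t < e k + 1/2"
          by (simp_all only: order.strict_iff_order) auto
      then have "\<bar>t - e k\<bar> < 1/2" by linarith
      then show ?thesis using t(3) by blast
    qed
    then obtain l where l: "\<And>k. \<bar>l k - e k\<bar> < 1/2" "\<And>k. ?f (l k) = 0" by metis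
    have "inj l"
    proof (rule injI)
      fix i k assume "l i = l k"
      then have "\<bar>e i - e k\<bar> < 1" using l(1) [of i] l(1) [of k] by linarith
      then have "index_of i = index_of k" unfolding e_def by linarith
      then show "i = k" by simp
    qed
    then show "\<exists>P d. det P \<noteq> 0 \<and> X ** P = P ** (\<chi> i j. if i = j then d i else 0)"
      using diagonalisable_of_distinct_eigenvalues [of l X] l(2) by blast
  qed
qed

section \<open>Semi-invariants with vanishing restriction\<close>

text \<open>Semi-invariance under P relates the value at (Y, B) = (P D P^{-1}, (B P) P^{-1}) to the
  value at (D, B P), where D is diagonal and the restriction vanishes.\<close>

lemma semi_invariant_eval_diagonalisable:
  fixes p :: "('N::finite, 'n::finite, complex) xa_poly"
  assumes p: "p \<in> semi_invariants" "diag_restrict p = 0"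
    and P: "invertible (P :: complex ^ 'N ^ 'N)" "Y ** P = P ** (\<chi> i j. if i = j then d i else 0)"
  shows "xa_subst (const_mat (Y :: complex ^ 'N ^ 'N)) (const_rect B) p = 0"
proof -
  let ?D = "(\<chi> i j. if i = j then d i else 0) :: complex ^ 'N ^ 'N"
  let ?s = "xa_subst (const_mat ?D) (const_rect (B ** P)) :: ('N, 'n, complex) xa_poly \<Rightarrow> _"
  let ?Y = "const_mat P ** Xmat ** const_mat (matrix_inv P) :: ('N, 'n, complex) xa_poly ^ 'N ^ 'N"
  let ?B = "Amat ** const_mat (matrix_inv P) :: ('N, 'n, complex) xa_poly ^ 'N ^ 'n"
  interpret S: module_hom xa_scale xa_scale ?s by (rule xa_subst_hom)
  have mult: "const_rect M ** const_mat M' = (const_rect (M ** M')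
      :: ('N, 'n, complex) xa_poly ^ 'N ^ 'n)" for M M'
    by (simp add: const_mat_def const_rect_def matrix_matrix_mult_def vec_eq_iff xa_const_sum
        xa_const_mult)
  have Y: "P ** ?D ** matrix_inv P = Y"
    using P by (simp add: matrix_inv_mult flip: P(2) matrix_mul_assoc)
  have "(\<chi> i j. ?s (?Y $ i $ j)) = const_mat P ** const_mat ?D ** const_mat (matrix_inv P)"
    unfolding vec_eq_iff vec_lambda_beta xa_subst_matrix_mult xa_subst_const_mat xa_subst_Xmat
    by (simp add: matrix_matrix_mult_def)
  also have "\<dots> = const_mat Y" by (simp add: const_mat_mult Y)
  finally have 1: "(\<chi> i j. ?s (?Y $ i $ j)) = const_mat Y" .
  have "(\<chi> a i. ?s (?B $ a $ i)) = const_rect (B ** P) ** const_mat (matrix_inv P)"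
    unfolding vec_eq_iff vec_lambda_beta xa_subst_matrix_mult xa_subst_const_mat xa_subst_Amat
    by (simp add: matrix_matrix_mult_def)
  also have "\<dots> = const_rect B"
    by (simp add: mult matrix_inv_mult P(1) flip: matrix_mul_assoc)
  finally have 2: "(\<chi> a i. ?s (?B $ a $ i)) = const_rect B" .
  have "?s (diag_restrict p) = ?s p"
    unfolding diag_restrict_def xa_subst_xa_subst
    by (rule arg_cong2 [where f = "\<lambda>Y B. xa_subst Y B p"])
       (auto simp: vec_eq_iff Xdiag_def xa_subst_Xmat xa_subst_Amat const_mat_def)
  then have "?s p = 0" using p(2) by simp
  then have "?s (xa_subst ?Y ?B p) = 0"
    using p(1) P(1) by (simp add: semi_invariants_def S.scale)
  then show ?thesis by (simp add: xa_subst_xa_subst 1 2)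
qed

text \<open>Real matrices suffice: each entry still ranges over an infinite set of complex numbers,
  which is all that \<open>xa_poly_eq_0\<close> asks for.\<close>

lemma semi_invariant_eq_0:
  fixes p :: "('N::{finite,linorder}, 'n::finite, complex) xa_poly"
  assumes p: "p \<in> semi_invariants" "diag_restrict p = 0"
  shows "p = 0"
proof -
  obtain U :: "'N \<Rightarrow> 'N \<Rightarrow> real set" where U: "\<And>i j. infinite (U i j)"
    and diag: "\<And>X :: ((real, 'N) vec, 'N) vec. (\<And>i j. X $ i $ j \<in> U i j) \<Longrightarrow>
           \<exists>P d. det P \<noteq> 0 \<and> X ** P = P ** (\<chi> i j. if i = j then d i else 0)"
    by (rule real_box_diagonalisable) blast
  let ?c = "\<lambda>M :: ((real, 'N) vec, 'N) vec. (\<chi> i j. complex_of_real (M $ i $ j))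
      :: ((complex, 'N) vec, 'N) vec"
  have mult: "?c (M ** M') = ?c M ** ?c M'" for M M'
    by (simp add: vec_eq_iff matrix_matrix_mult_def)
  show ?thesis
  proof (rule xa_poly_eq_0)
    show "infinite (complex_of_real ` U i j)" for i j
      using U by (simp add: finite_image_iff inj_on_def)
  next
    fix Y :: "((complex, 'N) vec, 'N) vec" and B :: "((complex, 'N) vec, 'n) vec"
    assume "\<And>i j. Y $ i $ j \<in> complex_of_real ` U i j"
    then have "\<forall>i j. \<exists>x. x \<in> U i j \<and> Y $ i $ j = of_real x" by blast
    then obtain x where x: "\<And>i j. x i j \<in> U i j" "\<And>i j. Y $ i $ j = of_real (x i j)" by metis
    then obtain P d where P: "det P \<noteq> 0" "(\<chi> i j. x i j) ** P = P ** (\<chi> i j. if i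
        = j then d i else 0)"
      using diag [of "\<chi> i j. x i j"] by auto
    have Y: "Y = ?c (\<chi> i j. x i j)" by (simp add: vec_eq_iff x(2))
    have "Y ** ?c P = ?c P ** ?c (\<chi> i j. if i = j then d i else 0)"
      unfolding Y by (simp only: P(2) flip: mult)
    also have "?c (\<chi> i j. if i = j then d i else 0) = (\<chi> i j. if i = j then of_real (d i) else 0)"
      by (simp add: vec_eq_iff)
    finally have *: "Y ** ?c P = ?c P ** (\<chi> i j. if i = j then of_real (d i) else 0)" .
    have "det (?c P) = of_real (det P)"
      by (rule det_hom [symmetric]) simp_all
    then have "invertible (?c P)" using P(1) by (simp add: invertible_det_nz)
    then show "xa_subst (const_mat Y) (const_rect B) p = 0"
      using p * by (intro semi_invariant_eval_diagonalisable)
  qed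
qed

theorem proposition4p8:
  fixes h :: "complex \<Rightarrow> 'r::comm_ring_1"
  assumes "complex_algebra h"
  shows "\<exists>f :: ('n::finite, complex) fock \<Rightarrow> ('N::{finite,linorder}, 'n, complex) xa_poly.
    linear_on_set fock_scale xa_scale (fock_N CARD('N)) f \<and>
    (\<forall>w. length w = CARD('N) \<longrightarrow> f (psi_word w) = epsilon_poly w) \<and>
    bij_betw f (fock_N CARD('N)) semi_invariants \<and>
    (\<forall>a b m. \<forall>v\<in>fock_N CARD('N). f (gl_fock a b m v) = gl_xa a b m (f v)) \<and>
    (\<exists>fR :: ('n, 'r) fock \<Rightarrow> ('N, 'n, 'r) xa_poly.
      is_base_change h CARD('N) f fR \<and>
      (\<forall>(g :: 'r poly ^ 'n ^ 'n) q. invertible g \<and> q dvd 1 \<longrightarrow>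
        (\<forall>v\<in>fock_N CARD('N).
          fR (glz_fock g (rot_fock q v)) = glz_xa g (rot_xa q (fR v)))))"
proof (intro exI conjI allI ballI impI)
  let ?f = "fock_to_xa :: ('n, complex) fock \<Rightarrow> ('N, 'n, complex) xa_poly"
  let ?F = "fock_N CARD('N) :: ('n, complex) fock set"
  show "linear_on_set fock_scale xa_scale ?F ?f"
    by (simp add: linear_on_set_def fock_to_xa.add fock_to_xa.scale)
  show "?f (psi_word w) = epsilon_poly w" if "length w = CARD('N)" for w
    using that by (rule fock_to_xa_psi_word)
  show "?f (gl_fock a b m v) = gl_xa a b m (?f v)" if "v \<in> ?F" for a b m v
    using that by (rule fock_to_xa_gl)
  show "is_base_change h CARD('N) ?f (fock_to_xa :: ('n, 'r) fock \<Rightarrow> ('N, 'n, 'r) xa_poly)"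
    using assms by (rule fock_to_xa_base_change)
  show "fock_to_xa (glz_fock g (rot_fock q v))
      = (glz_xa g (rot_xa q (fock_to_xa v)) :: ('N, 'n, 'r) xa_poly)"
    if "invertible g \<and> q dvd 1" "v \<in> fock_N CARD('N)" for g q v
    using that by (intro fock_to_xa_glz_rot) auto
  show "bij_betw ?f ?F semi_invariants"
  proof (rule bij_betwI')
    show "?f v \<in> semi_invariants" if "v \<in> ?F" for v
      using that by (rule fock_to_xa_semi_invariant)
  next
    fix v w assume "v \<in> ?F" "w \<in> ?F"
    then have "v - w \<in> ?F" unfolding fock_N_def by (rule fock.span_diff)
    then show "?f v = ?f w \<longleftrightarrow> v = w"
      using fock_to_xa_inj [of "v - w", where 'N = 'N] by (auto simp: fock_to_xa.diff)
  next
    fix p :: "('N, 'n, complex) xa_poly" assume p: "p \<in> semi_invariants"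
    then obtain v where v: "v \<in> ?F" "diag_restrict (?f v) = diag_restrict p"
      using diag_restrict_surj by blast
    \<comment> \<open>Equality of the restrictions becomes equality of the polynomials because the
      difference is again a semi-invariant.\<close>
    then have "p - ?f v \<in> semi_invariants" "diag_restrict (p - ?f v) = 0"
      using p by (simp_all add: semi_invariants_diff fock_to_xa_semi_invariant diag_restrict.diff)
    then have "p - ?f v = 0" by (rule semi_invariant_eq_0)
    with v(1) show "\<exists>v\<in>?F. p = ?f v" by (intro bexI [of _ v]) simp_all
  qed
qed

end
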